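(* Let $F$ be a germ of holomorphic diffeomorphism of $\mathbb{C}^n$ fixing the origin $0$, with diagonal differential $dF_0=\mathrm{diag}(\lambda_1,\ldots,\lambda_n)$, and let $1\le m\le n$. Suppose $F$ is one-resonant and non-degenerate with respect to $\{\lambda_1,\ldots,\lambda_m\}$, with index of resonance $\alpha$. Then there exist $k\in\mathbb{N}$ and numbers $\mu,a_1,\ldots,a_m\in\mathbb{C}$ such that $F$ is formally conjugate to a map $\hat F(z)=(\hat F_1(z),\ldots,\hat F_n(z))$, where $$\hat F_j(z)=\lambda_jz_j+a_jz^{k\alpha}z_j+\mu\,\alpha_j\,\overline{\lambda_j}^{\,-1}z^{2k\alpha}z_j,\quad j=1,\ldots,m,$$ and the components $\hat F_j(z)$ for $j=m+1,\ldots,n$ contain only resonant monomials.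
   Context: Notation: $\mathbb{N}=\{0,1,2,\ldots\}$. For $l=(l_1,\ldots,l_n)\in\mathbb{N}^n$ put $|l|=\sum l_j$, $z^l=z_1^{l_1}\cdots z_n^{l_n}$, $\lambda^l=\lambda_1^{l_1}\cdots\lambda_n^{l_n}$; $e_j$ is the $j$-th unit vector. Formal conjugation: conjugation by an $n$-tuple of formal power series in $z_1,\ldots,z_n$ without constant term and with invertible linear part; $\hat F$ is in general a formal map. Resonance: a pair $(j,l)$ with $j\in\{1,\ldots,n\}$, $l\in\mathbb{N}^n$, $|l|\ge2$ and $\lambda_j=\lambda^l$. A (nonlinear) monomial $cz^l$, $|l|\ge 2$, occurring in the $j$-th component of a map is resonant if $(j,l)$ is a resonance; the phrase "$\hat F_j$ contains only resonant monomials" refers to the terms of degree at least $2$ (the linear part of $\hat F_j$ being $\lambda_jz_j$). One-resonant: $F$ is one-resonant with respect to the first $m$ eigenvalues $\{\lambda_1,\ldots,\lambda_m\}$ if there is a fixed multi-index $\alpha=(\alpha_1,\ldots,\alpha_m,0,\ldots,0)\in\mathbb{N}^n$, $\alpha\neq0$ (the index of resonance), such that the resonances $(j,l)$ with $j\in\{1,\ldots,m\}$ are precisely the pairs $(j,k\alpha+e_j)$ with $j\in\{1,\ldots,m\}$ and $k\ge1$ an arbitrary integer. (Arbitrary resonances are allowed for $j>m$.) Non-degenerate: let $F$ be one-resonant with respect to $\{\lambda_1,\ldots,\lambda_m\}$ with index of resonance $\alpha$. $F$ is non-degenerate with respect to $\{\lambda_1,\ldots,\lambda_m\}$ if there are holomorphic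 coordinates at $0$ in which $$F_j(z)=\lambda_jz_j+a_jz^{k\alpha}z_j+O(|z|^{|\alpha|k+2}),\quad j=1,\ldots,m,$$ with $k\ge1$ an integer, $a=(a_1,\ldots,a_m)\neq0$, and $$\Lambda(F)=\sum_{j=1}^m\frac{a_j\alpha_j}{\lambda_j}\neq0.$$ (Here $k$ is independent of the choice of such coordinates and $a$ is unique up to a nonzero scalar multiple, so the condition is well defined.) *)

theory Defs
  imports "HOL-Analysis.Analysis" "HOL-Library.Landau_Symbols"
begin

section \<open>Multi-indices\<close>

text \<open>
  The dimension is the cardinality of the index type \<open>'n\<close>, and multi-indices are elements of
  \<open>nat ^ 'n\<close>: the \<open>j\<close>-th unit multi-index is \<open>axis j 1\<close> and the multiple \<open>k\<alpha>\<close> is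
  \<open>k *s \<alpha>\<close>.
\<close>

definition mdeg :: "nat ^ 'n \<Rightarrow> nat" where
  "mdeg l = (\<Sum>j\<in>UNIV. l $ j)"

definition mpow :: "complex ^ 'n \<Rightarrow> nat ^ 'n \<Rightarrow> complex" where
  "mpow z l = (\<Prod>j\<in>UNIV. (z $ j) ^ (l $ j))"

text \<open>The first \<open>m\<close> indices, with respect to the linear order of the index type.\<close>

definition first_indices :: "nat \<Rightarrow> ('n::{finite,linorder}) set" where
  "first_indices m = {j. card {i. i < j} < m}"

lemma finite_vec_le: "finite {p :: nat ^ 'n. p \<le> l}"
proof -
  have "finite (PiE (UNIV :: 'n set) (\<lambda>i. {..l $ i}))"
    by (intro finite_PiE) auto
  moreover have "vec_nth ` {p :: nat ^ 'n. p \<le> l} \<subseteq> PiE UNIV (\<lambda>i. {..l $ i})"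
    by (auto simp: less_eq_vec_def)
  ultimately have "finite (vec_nth ` {p :: nat ^ 'n. p \<le> l})"
    by (rule finite_subset[rotated])
  then show ?thesis
    by (rule finite_imageD) (auto simp: inj_on_def vec_nth_inject)
qed

lemma finite_mdeg_le: "finite {p :: nat ^ 'n. mdeg p \<le> d}"
proof (rule finite_subset)
  show "{p :: nat ^ 'n. mdeg p \<le> d} \<subseteq> {p. p \<le> (\<chi> i. d)}"
  proof safe
    fix p :: "nat ^ 'n"
    assume p: "mdeg p \<le> d"
    have "p $ i \<le> mdeg p" for i
      unfolding mdeg_def by (rule member_le_sum) auto
    with p show "p \<le> (\<chi> i. d)"
      by (auto simp: less_eq_vec_def intro: order_trans)
  qed
qed (rule finite_vec_le)

lemma finite_antidiag: "finite {(p, q :: nat ^ 'n). p + q = l}"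
proof (rule finite_subset)
  show "{(p, q). p + q = l} \<subseteq> {p. p \<le> l} \<times> {p. p \<le> l}"
    by (auto simp: less_eq_vec_def)
  show "finite ({p. p \<le> l} \<times> {p. p \<le> l})"
    by (rule finite_cartesian_product; rule finite_vec_le)
qed

lemma finite_antidiag_iff: "finite {x :: (nat ^ 'n) \<times> (nat ^ 'n). fst x + snd x = l}"
proof -
  have "{x :: (nat ^ 'n) \<times> (nat ^ 'n). fst x + snd x = l} = {(p, q). p + q = l}"
    by auto
  then show ?thesis
    using finite_antidiag[of l] by simp
qed


section \<open>Formal power series in several variables\<close>

typedef ('a, 'n) mfps = "UNIV :: (nat ^ 'n::finite \<Rightarrow> 'a) set"
  morphisms mfps_nth Abs_mfps
  by simp

lemma mfps_nth_Abs [simp]: "mfps_nth (Abs_mfps f) = f"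
  by (simp add: Abs_mfps_inverse)

lemma mfps_eqI: "(\<And>l. mfps_nth f l = mfps_nth g l) \<Longrightarrow> f = g"
  by (metis ext mfps_nth_inject)

instantiation mfps :: (comm_ring_1, finite) comm_ring_1
begin

definition zero_mfps :: "('a, 'b) mfps" where
  "0 = Abs_mfps (\<lambda>l. 0)"

definition one_mfps :: "('a, 'b) mfps" where
  "1 = Abs_mfps (\<lambda>l. if l = 0 then 1 else 0)"

definition plus_mfps :: "('a, 'b) mfps \<Rightarrow> ('a, 'b) mfps \<Rightarrow> ('a, 'b) mfps" where
  "f + g = Abs_mfps (\<lambda>l. mfps_nth f l + mfps_nth g l)"

definition minus_mfps :: "('a, 'b) mfps \<Rightarrow> ('a, 'b) mfps \<Rightarrow> ('a, 'b) mfps" where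
  "f - g = Abs_mfps (\<lambda>l. mfps_nth f l - mfps_nth g l)"

definition uminus_mfps :: "('a, 'b) mfps \<Rightarrow> ('a, 'b) mfps" where
  "- f = Abs_mfps (\<lambda>l. - mfps_nth f l)"

definition times_mfps :: "('a, 'b) mfps \<Rightarrow> ('a, 'b) mfps \<Rightarrow> ('a, 'b) mfps" where
  "f * g = Abs_mfps (\<lambda>l. \<Sum>(p, q) | p + q = l. mfps_nth f p * mfps_nth g q)"

instance
proof
  fix f g h :: "('a, 'b) mfps"
  show "f + g + h = f + (g + h)" "f + g = g + f" "0 + f = f" "- f + f = 0" "f - g = f + - g"
    by (rule mfps_eqI;
        simp add: plus_mfps_def zero_mfps_def uminus_mfps_def minus_mfps_def algebra_simps)+
  show "(0 :: ('a, 'b) mfps) \<noteq> 1"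
  proof
    assume "(0 :: ('a, 'b) mfps) = 1"
    then have "mfps_nth (0 :: ('a, 'b) mfps) 0 = mfps_nth 1 0" by simp
    then show False by (simp add: zero_mfps_def one_mfps_def)
  qed
  show "(f + g) * h = f * h + g * h"
    by (rule mfps_eqI)
      (simp add: plus_mfps_def times_mfps_def case_prod_beta distrib_right sum.distrib)
  show "f * g = g * f"
  proof (rule mfps_eqI)
    fix l
    show "mfps_nth (f * g) l = mfps_nth (g * f) l"
      unfolding times_mfps_def mfps_nth_Abs
      by (rule sum.reindex_bij_witness[of _ prod.swap prod.swap])
        (auto simp: algebra_simps)
  qed
  show "1 * f = f"
  proof (rule mfps_eqI)
    fix l
    have "mfps_nth (1 * f) l = (\<Sum>x\<in>{(p, q). p + q = l}. if x = (0, l) then mfps_nth f l else 0)"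
      unfolding times_mfps_def one_mfps_def mfps_nth_Abs
      by (rule sum.cong) (auto split: if_splits)
    also have "\<dots> = mfps_nth f l"
      by (subst sum.delta[OF finite_antidiag]) auto
    finally show "mfps_nth (1 * f) l = mfps_nth f l" .
  qed
  show "f * g * h = f * (g * h)"
  proof (rule mfps_eqI)
    fix l
    have "mfps_nth (f * g * h) l =
        (\<Sum>x\<in>{(p, q). p + q = l}. \<Sum>y\<in>{(s, r). s + r = fst x}.
          mfps_nth f (fst y) * mfps_nth g (snd y) * mfps_nth h (snd x))"
      by (simp add: times_mfps_def case_prod_beta sum_distrib_right)
    also have "\<dots> = (\<Sum>(x, y)\<in>(SIGMA x:{(p, q). p + q = l}. {(s, r). s + r = fst x}).
          mfps_nth f (fst y) * mfps_nth g (snd y) * mfps_nth h (snd x))"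
      by (rule sum.Sigma) (auto simp: finite_antidiag finite_antidiag_iff case_prod_beta)
    also have "\<dots> = (\<Sum>(x, y)\<in>(SIGMA x:{(p, q). p + q = l}. {(s, r). s + r = snd x}).
          mfps_nth f (fst x) * (mfps_nth g (fst y) * mfps_nth h (snd y)))"
      by (rule sum.reindex_bij_witness
            [of _ "\<lambda>((p, q), (s, r)). ((p + s, r), (p, s))"
                  "\<lambda>((p, q), (s, r)). ((s, r + q), (r, q))"])
        (auto simp: algebra_simps)
    also have "\<dots> = (\<Sum>x\<in>{(p, q). p + q = l}. \<Sum>y\<in>{(s, r). s + r = snd x}.
          mfps_nth f (fst x) * (mfps_nth g (fst y) * mfps_nth h (snd y)))"
      by (rule sum.Sigma[symmetric]) (auto simp: finite_antidiag finite_antidiag_iff case_prod_beta)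
    also have "\<dots> = mfps_nth (f * (g * h)) l"
      by (simp add: times_mfps_def case_prod_beta sum_distrib_left)
    finally show "mfps_nth (f * g * h) l = mfps_nth (f * (g * h)) l" .
  qed
qed

end

definition mfps_monom :: "'a \<Rightarrow> nat ^ 'n \<Rightarrow> ('a::comm_ring_1, 'n) mfps" where
  "mfps_monom c l = Abs_mfps (\<lambda>k. if k = l then c else 0)"

text \<open>
  Substitution of the tuple \<open>g\<close> into \<open>f\<close>. As for \<^const>\<open>fps_compose\<close>, this is the usual
  composition when every \<open>g j\<close> has zero constant term: then only the monomials of \<open>f\<close> of degree at
  most \<open>mdeg l\<close> contribute to the coefficient at \<open>l\<close>.
\<close>

definition mfps_compose ::
  "('a::comm_ring_1, 'n::finite) mfps \<Rightarrow> ('n \<Rightarrow> ('a, 'n) mfps) \<Rightarrow> ('a, 'n) mfps" where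
  "mfps_compose f g =
     Abs_mfps (\<lambda>l. \<Sum>k | mdeg k \<le> mdeg l.
       mfps_nth f k * mfps_nth (\<Prod>j\<in>UNIV. g j ^ (k $ j)) l)"

text \<open>Tuples of formal power series without constant term and with invertible linear part.\<close>

definition formal_diffeo :: "('n::finite \<Rightarrow> (complex, 'n) mfps) \<Rightarrow> bool" where
  "formal_diffeo \<Phi> \<longleftrightarrow>
     (\<forall>i. mfps_nth (\<Phi> i) 0 = 0) \<and>
     invertible (\<chi> i j. mfps_nth (\<Phi> i) (axis j 1))"


section \<open>Holomorphic maps in several variables\<close>

definition has_power_series ::
  "(complex ^ 'n \<Rightarrow> complex) \<Rightarrow> (complex, 'n) mfps \<Rightarrow> complex ^ 'n \<Rightarrow> bool" where
  "has_power_series f p w \<longleftrightarrow>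
     (\<forall>\<^sub>F z in nhds w. ((\<lambda>l. mfps_nth p l * mpow (z - w) l) has_sum f z) UNIV)"

text \<open>
  A map is holomorphic on an open set if its components are locally sums of convergent power
  series.
\<close>

definition mholomorphic_on ::
  "(complex ^ 'n \<Rightarrow> complex ^ 'n) \<Rightarrow> (complex ^ 'n) set \<Rightarrow> bool" where
  "mholomorphic_on F U \<longleftrightarrow>
     open U \<and> (\<forall>w\<in>U. \<forall>j. \<exists>p. has_power_series (\<lambda>z. F z $ j) p w)"

definition holomorphic_germ :: "(complex ^ 'n \<Rightarrow> complex ^ 'n) \<Rightarrow> bool" where
  "holomorphic_germ F \<longleftrightarrow> (\<exists>U. 0 \<in> U \<and> mholomorphic_on F U)"

text \<open>
  Germs at the origin are represented by total functions of which only the values near \<open>0\<close>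
  matter. The following says that \<open>F\<close> and \<open>G\<close> are mutually inverse germs of biholomorphisms
  fixing \<open>0\<close>.
\<close>

definition inverse_germs ::
  "(complex ^ 'n \<Rightarrow> complex ^ 'n) \<Rightarrow> (complex ^ 'n \<Rightarrow> complex ^ 'n) \<Rightarrow> bool" where
  "inverse_germs F G \<longleftrightarrow>
     holomorphic_germ F \<and> holomorphic_germ G \<and> F 0 = 0 \<and> G 0 = 0 \<and>
     (\<forall>\<^sub>F z in nhds 0. G (F z) = z \<and> F (G z) = z)"

definition diffeo_germ :: "(complex ^ 'n \<Rightarrow> complex ^ 'n) \<Rightarrow> bool" where
  "diffeo_germ F \<longleftrightarrow> (\<exists>G. inverse_germs F G)"

text \<open>
  \<open>F\<close>, with Taylor series \<open>P\<close> at \<open>0\<close>, is formally conjugate to the formal map \<open>H\<close>: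
  \<open>\<Phi> \<circ> P = H \<circ> \<Phi>\<close> for some invertible formal \<open>\<Phi>\<close>.
\<close>

definition formally_conjugate ::
  "(complex ^ 'n \<Rightarrow> complex ^ 'n) \<Rightarrow> ('n \<Rightarrow> (complex, 'n) mfps) \<Rightarrow> bool" where
  "formally_conjugate F H \<longleftrightarrow>
     (\<exists>P \<Phi>. (\<forall>j. has_power_series (\<lambda>z. F z $ j) (P j) 0) \<and> formal_diffeo \<Phi> \<and>
        (\<forall>j. mfps_compose (\<Phi> j) P = mfps_compose (H j) \<Phi>))"


section \<open>Resonances\<close>

definition resonance :: "complex ^ 'n \<Rightarrow> 'n \<Rightarrow> nat ^ 'n \<Rightarrow> bool" where
  "resonance lam j l \<longleftrightarrow> 2 \<le> mdeg l \<and> lam $ j = mpow lam l"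

text \<open>
  In the next two definitions \<open>J\<close> is the set of the distinguished indices \<open>1, \<dots>, m\<close>, and
  \<open>lam\<close> is the tuple of eigenvalues.
\<close>

definition one_resonant :: "complex ^ 'n \<Rightarrow> 'n set \<Rightarrow> nat ^ 'n \<Rightarrow> bool" where
  "one_resonant lam J \<alpha> \<longleftrightarrow>
     \<alpha> \<noteq> 0 \<and> (\<forall>j. j \<notin> J \<longrightarrow> \<alpha> $ j = 0) \<and>
     (\<forall>j\<in>J. \<forall>l. resonance lam j l \<longleftrightarrow> (\<exists>k\<ge>1. l = k *s \<alpha> + axis j 1))"

text \<open>
  The map \<open>\<phi>\<close> is the change of coordinates, so \<open>\<phi> \<circ> F \<circ> \<psi>\<close> is \<open>F\<close> in the new coordinates.
\<close>

definition nondegenerate ::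
  "(complex ^ 'n \<Rightarrow> complex ^ 'n) \<Rightarrow> complex ^ 'n \<Rightarrow> 'n set \<Rightarrow> nat ^ 'n \<Rightarrow> bool" where
  "nondegenerate F lam J \<alpha> \<longleftrightarrow>
     (\<exists>\<phi> \<psi> k a. inverse_germs \<phi> \<psi> \<and> 1 \<le> k \<and> (\<exists>j\<in>J. a j \<noteq> 0) \<and>
        (\<forall>j\<in>J. (\<lambda>z. norm (\<phi> (F (\<psi> z)) $ j -
                     (lam $ j * z $ j + a j * mpow z (k *s \<alpha>) * z $ j)))
                 \<in> O[at 0](\<lambda>z. norm z ^ (mdeg \<alpha> * k + 2))) \<and>
        (\<Sum>j\<in>J. a j * of_nat (\<alpha> $ j) / lam $ j) \<noteq> 0)"

text \<open>
  \<open>h\<close> is a \<open>j\<close>-th component with linear part \<open>lam\<^sub>j z\<^sub>j\<close> whose terms of degree at least \<open>2\<close> are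
  all resonant.
\<close>

definition only_resonant :: "complex ^ 'n \<Rightarrow> 'n \<Rightarrow> (complex, 'n) mfps \<Rightarrow> bool" where
  "only_resonant lam j h \<longleftrightarrow>
     mfps_nth h 0 = 0 \<and>
     (\<forall>i. mfps_nth h (axis i 1) = (if i = j then lam $ j else 0)) \<and>
     (\<forall>l. 2 \<le> mdeg l \<and> mfps_nth h l \<noteq> 0 \<longrightarrow> resonance lam j l)"

end

theory Submission
  imports Defs "HOL-Computational_Algebra.Formal_Power_Series"
begin

text \<open>
  The proof works with Taylor series only. The given coordinates conjugate the first \<open>m\<close> components
  of the series of \<open>F\<close> to \<open>\<lambda>\<^sub>j z\<^sub>j + a\<^sub>j z\<^sup>k\<^sup>\<alpha> z\<^sub>j\<close> modulo terms of higher order, and the method of Poincare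
  and Dulac, started at that order, turns them into \<open>z\<^sub>j g\<^sub>j(u)\<close> with \<open>u = z\<^sup>\<alpha>\<close>. This map acts on \<open>u\<close> by
  \<open>\<theta>(u) = u \<Prod> g\<^sub>j(u)\<^sup>\<alpha>\<^sup>j = u + \<Lambda> u\<^sup>k\<^sup>+\<^sup>1 + \<dots>\<close>. A further substitution \<open>z\<^sub>j \<mapsto> z\<^sub>j \<psi>\<^sub>j(u)\<close> is found degree by
  degree: since \<open>\<Lambda> \<noteq> 0\<close>, the coefficients of \<open>u\<^sup>s\<close> in the \<open>\<psi>\<^sub>j\<close> can be used to remove the terms of
  order \<open>k + s\<close> of the \<open>g\<^sub>j\<close>, with a one-dimensional obstruction at \<open>s = k\<close> that produces \<open>\<mu>\<close>.
  Finally the remaining components are normalized by the method of Poincare and Dulac, which leaves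
  the first \<open>m\<close> components unchanged because these only depend on \<open>z\<^sub>1, \<dots>, z\<^sub>m\<close>.
\<close>

text \<open>Conjugacies are kept in the form \<open>\<Phi> o P = H o \<Phi>\<close> with
  \<open>P\<close> fixed: every correction changes only \<open>\<Phi>\<close> and \<open>H\<close>,
  and limits are taken coefficient by coefficient. The given coordinates are analytic, their
  conjugacy is only approximate, and their linear part need not be diagonal. Uniqueness of Taylor
  expansions turns the estimate into a congruence of series, and comparison of its linear terms
  shows that the rows with index in \<open>J\<close> are diagonal, because no other eigenvalue
  equals such a \<open>\<lambda>_j\<close>. In the one-variable problem, coefficients
  \<open>b_j\<close> of \<open>u^s\<close> in the \<open>\<psi>_j\<close> act on the terms of order
  \<open>k + s\<close> by \<open>b \<mapsto> s \<Lambda> \<lambda>_j b_j - k a_j \<Sum> \<alpha>_i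
  b_i\<close>. For \<open>s = k\<close> the image of this map is the hyperplane
  \<open>\<Sum> (\<alpha>_j / \<lambda>_j) e_j = 0\<close>, so one more direction is required. The
  normal form uses the Hermitian normal \<open>\<alpha>_j / cnj \<lambda>_j\<close> of this
  hyperplane, whose pairing \<open>\<Sum> \<alpha>_j^2 / |\<lambda>_j|^2\<close> is positive. This
  is the origin of both the conjugate and the exponent \<open>2k\<close>.\<close>

declare One_nat_def [simp del]

lemma mdeg_add: "mdeg (p + q) = mdeg p + mdeg q"
  by (simp add: mdeg_def sum.distrib)

lemma mdeg_zero [simp]: "mdeg 0 = 0"
  by (simp add: mdeg_def)

lemma mdeg_axis [simp]: "mdeg (axis i n) = n"
  by (simp add: mdeg_def axis_def)

lemma mdeg_smult: "mdeg (k *s l) = k * mdeg l"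
  by (simp add: mdeg_def sum_distrib_left)

lemma mdeg_eq_0_iff: "mdeg l = 0 \<longleftrightarrow> l = 0"
  by (auto simp: mdeg_def vec_eq_iff)

lemma mdeg_eq_1: 
  assumes "mdeg l = 1"
  obtains i where "l = axis i 1"
proof -
  have "\<exists>i. l $ i = 1 \<and> (\<forall>j. j \<noteq> i \<longrightarrow> l $ j = 0)"
    using assms sum_eq_1_iff[of UNIV "($) l"] by (auto simp: mdeg_def)
  then obtain i where "l $ i = 1" "\<And>j. j \<noteq> i \<Longrightarrow> l $ j = 0" by blast
  then have "l = axis i 1" by (auto simp: vec_eq_iff axis_def)
  then show ?thesis by (rule that)
qed

lemma axis_eq_nat_iff: "axis i (1::nat) = axis j 1 \<longleftrightarrow> i = j"
  by (simp add: axis_eq_axis)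

lemma mpow_add: "mpow z (p + q) = mpow z p * mpow z q"
  by (simp add: mpow_def power_add prod.distrib)

lemma mpow_zero [simp]: "mpow z 0 = 1"
  by (simp add: mpow_def)

lemma mpow_axis [simp]: "mpow z (axis i n) = z $ i ^ n"
proof -
  have "mpow z (axis i n) = (\<Prod>j\<in>UNIV. if j = i then z $ i ^ n else 1)"
    unfolding mpow_def by (rule prod.cong) (auto simp: axis_def)
  then show ?thesis by simp
qed

lemma mpow_eq_0_iff: "mpow z l = 0 \<longleftrightarrow> (\<exists>i. z $ i = 0 \<and> l $ i \<noteq> 0)"
  by (auto simp: mpow_def)


section \<open>Formal power series filtered by order\<close>

lemma mfps_nth_zero [simp]: "mfps_nth 0 l = 0"
  and mfps_nth_one: "mfps_nth 1 l = (if l = 0 then 1 else 0)"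
  and mfps_nth_add [simp]: "mfps_nth (f + g) l = mfps_nth f l + mfps_nth g l"
  and mfps_nth_diff [simp]: "mfps_nth (f - g) l = mfps_nth f l - mfps_nth g l"
  and mfps_nth_monom: "mfps_nth (mfps_monom c m) l = (if l = m then c else 0)"
  by (simp_all add: zero_mfps_def one_mfps_def plus_mfps_def minus_mfps_def mfps_monom_def)

lemma mfps_nth_mult:
  "mfps_nth (f * g) l = (\<Sum>(p, q) | p + q = l. mfps_nth f p * mfps_nth g q)"
  by (simp add: times_mfps_def)

lemma mfps_nth_sum: "mfps_nth (\<Sum>i\<in>A. f i) l = (\<Sum>i\<in>A. mfps_nth (f i) l)"
  by (induction A rule: infinite_finite_induct) auto

lemma mfps_nth_monom_mult: "mfps_nth (mfps_monom c m * f) (m + l) = c * mfps_nth f l"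
proof -
  have "mfps_nth (mfps_monom c m * f) (m + l)
      = (\<Sum>x\<in>{(p, q). p + q = m + l}. if x = (m, l) then c * mfps_nth f l else 0)"
    unfolding mfps_nth_mult mfps_nth_monom by (rule sum.cong) (auto split: if_splits)
  also have "\<dots> = c * mfps_nth f l"
    by (subst sum.delta[OF finite_antidiag]) auto
  finally show ?thesis .
qed

lemma mfps_nth_monom_mult_eq_0:
  assumes "\<And>q. l \<noteq> m + q"
  shows "mfps_nth (mfps_monom c m * f) l = 0"
  unfolding mfps_nth_mult mfps_nth_monom using assms by (intro sum.neutral) auto

lemma mfps_nth_const_mult [simp]: "mfps_nth (mfps_monom c 0 * f) l = c * mfps_nth f l"
  using mfps_nth_monom_mult[of c 0 f l] by simp

lemma mfps_monom_mult: "mfps_monom c m * mfps_monom d n = mfps_monom (c * d) (m + n)"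
proof (rule mfps_eqI)
  fix l
  show "mfps_nth (mfps_monom c m * mfps_monom d n) l = mfps_nth (mfps_monom (c * d) (m + n)) l"
  proof (cases "\<exists>q. l = m + q")
    case True
    then show ?thesis by (auto simp: mfps_nth_monom_mult mfps_nth_monom)
  next
    case False
    then show ?thesis
      by (subst mfps_nth_monom_mult_eq_0) (auto simp: mfps_nth_monom)
  qed
qed

lemma mfps_monom_zero [simp]: "mfps_monom 0 l = 0"
  and mfps_monom_one: "mfps_monom 1 0 = 1"
  by (rule mfps_eqI; simp add: mfps_nth_monom mfps_nth_one)+

lemma mfps_monom_power: "mfps_monom c m ^ n = mfps_monom (c ^ n) (n *s m)"
  by (induction n) (auto simp: mfps_monom_mult vector_add_ldistrib vector_sadd_rdistrib mfps_monom_one[symmetric] vec_eq_iff intro!: arg_cong[of _ _ "mfps_monom _"])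

lemma prod_mfps_monom:
  "(\<Prod>i\<in>A. mfps_monom (c i) (m i)) = mfps_monom (\<Prod>i\<in>A. c i) (\<Sum>i\<in>A. m i)"
  by (induction A rule: infinite_finite_induct) (auto simp: mfps_monom_mult mfps_monom_one[symmetric])

lemma sum_smult_axis: "(\<Sum>i\<in>UNIV. (l $ i) *s axis i 1) = (l :: nat ^ 'n)"
  by (simp add: vec_eq_iff axis_def if_distrib cong: if_cong)

lemma prod_diag_monom_power:
  "(\<Prod>i\<in>UNIV. mfps_monom (c $ i) (axis i 1) ^ (l $ i)) = mfps_monom (mpow c l) l"
  by (simp add: mfps_monom_power prod_mfps_monom sum_smult_axis mpow_def)


text \<open>The \<open>d\<close>-th power of the ideal generated by the variables. That
  \<open>f - g\<close> lies in it means agreement in all degrees below \<open>d\<close>;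
  approximations and limits of series refer to this filtration.\<close>

definition mfps_ideal :: "nat \<Rightarrow> ('a::comm_ring_1, 'n::finite) mfps set" where
  "mfps_ideal d = {f. \<forall>l. mdeg l < d \<longrightarrow> mfps_nth f l = 0}"

lemma mfps_idealD: "f \<in> mfps_ideal d \<Longrightarrow> mdeg l < d \<Longrightarrow> mfps_nth f l = 0"
  by (simp add: mfps_ideal_def)

lemma mfps_ideal_0 [simp]: "f \<in> mfps_ideal 0"
  by (simp add: mfps_ideal_def)

lemma mfps_ideal_zero [simp]: "0 \<in> mfps_ideal d"
  by (simp add: mfps_ideal_def)

lemma mfps_ideal_mono: "f \<in> mfps_ideal e \<Longrightarrow> d \<le> e \<Longrightarrow> f \<in> mfps_ideal d"
  by (simp add: mfps_ideal_def)

lemma mfps_ideal_add: "f \<in> mfps_ideal d \<Longrightarrow> g \<in> mfps_ideal d \<Longrightarrow> f + g \<in> mfps_ideal d"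
  and mfps_ideal_diff: "f \<in> mfps_ideal d \<Longrightarrow> g \<in> mfps_ideal d \<Longrightarrow> f - g \<in> mfps_ideal d"
  by (simp_all add: mfps_ideal_def)

lemma mfps_ideal_diff_commute: "f - g \<in> mfps_ideal d \<longleftrightarrow> g - f \<in> mfps_ideal d"
  by (auto simp: mfps_ideal_def)

lemma mfps_ideal_diff_trans:
  "f - g \<in> mfps_ideal d \<Longrightarrow> g - h \<in> mfps_ideal d \<Longrightarrow> f - h \<in> mfps_ideal d"
  using mfps_ideal_add[of "f - g" d "g - h"] by simp

lemma mfps_ideal_eq_0: "(\<And>d. f \<in> mfps_ideal d) \<Longrightarrow> f = 0"
  by (rule mfps_eqI) (metis lessI mfps_idealD mfps_nth_zero)

lemma mfps_monom_in_ideal: "d \<le> mdeg l \<Longrightarrow> mfps_monom c l \<in> mfps_ideal d"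
  by (auto simp: mfps_ideal_def mfps_nth_monom)

lemma mfps_ideal_mult:
  assumes "f \<in> mfps_ideal d" "g \<in> mfps_ideal e"
  shows "f * g \<in> mfps_ideal (d + e)"
proof -
  have "mfps_nth f p * mfps_nth g q = 0" if "mdeg (p + q) < d + e" for p q
    using that mfps_idealD[OF assms(1), of p] mfps_idealD[OF assms(2), of q]
    by (cases "mdeg p < d") (auto simp: mdeg_add)
  then show ?thesis
    by (auto simp: mfps_ideal_def mfps_nth_mult intro!: sum.neutral)
qed

lemma mfps_ideal_mult_left: "g \<in> mfps_ideal d \<Longrightarrow> f * g \<in> mfps_ideal d"
  using mfps_ideal_mult[of f 0 g d] by simp

lemma mfps_ideal_mult_right: "f \<in> mfps_ideal d \<Longrightarrow> f * g \<in> mfps_ideal d"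
  using mfps_ideal_mult[of f d g 0] by simp

lemma mfps_ideal_power: "f \<in> mfps_ideal 1 \<Longrightarrow> f ^ n \<in> mfps_ideal n"
  by (induction n) (use mfps_ideal_mult[of f 1] in \<open>auto simp: One_nat_def\<close>)

lemma mfps_ideal_prod_power:
  assumes "\<And>i. f i \<in> mfps_ideal 1"
  shows "(\<Prod>i\<in>A. f i ^ k i) \<in> mfps_ideal (\<Sum>i\<in>A. k i)"
  by (induction A rule: infinite_finite_induct)
     (auto intro: mfps_ideal_mult mfps_ideal_power assms)

text \<open>\<open>d\<close> is the precision relative to the orders \<open>m\<close> and
  \<open>n\<close> of the factors, and relative precision survives multiplication. Hence an error of
  order \<open>Suc d\<close> in series without constant term becomes one of order
  \<open>d + n\<close> in their \<open>n\<close>-th powers.\<close>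

lemma mfps_ideal_mult_diff:
  assumes "f - f' \<in> mfps_ideal (d + m)" "g - g' \<in> mfps_ideal (d + n)"
    and "f \<in> mfps_ideal m" "g' \<in> mfps_ideal n"
  shows "f * g - f' * g' \<in> mfps_ideal (d + (m + n))"
proof -
  have "f * g - f' * g' = f * (g - g') + (f - f') * g'"
    by (simp add: algebra_simps)
  moreover have "f * (g - g') \<in> mfps_ideal (d + (m + n))"
    using mfps_ideal_mult[OF assms(3,2)] by (simp add: ac_simps)
  moreover have "(f - f') * g' \<in> mfps_ideal (d + (m + n))"
    using mfps_ideal_mult[OF assms(1,4)] by (simp add: ac_simps)
  ultimately show ?thesis by (simp add: mfps_ideal_add)
qed

lemma mfps_ideal_power_diff:
  assumes "f - g \<in> mfps_ideal (Suc d)" "f \<in> mfps_ideal 1" "g \<in> mfps_ideal 1"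
  shows "f ^ n - g ^ n \<in> mfps_ideal (d + n)"
proof (induction n)
  case (Suc n)
  have "f * f ^ n - g * g ^ n \<in> mfps_ideal (d + (1 + n))"
    using Suc assms by (intro mfps_ideal_mult_diff mfps_ideal_power) (auto simp: One_nat_def)
  then show ?case by (simp add: One_nat_def)
qed simp

lemma mfps_ideal_prod_power_diff:
  assumes "\<And>i. f i - g i \<in> mfps_ideal (Suc d)"
    and "\<And>i. f i \<in> mfps_ideal 1" "\<And>i. g i \<in> mfps_ideal 1"
  shows "(\<Prod>i\<in>A. f i ^ k i) - (\<Prod>i\<in>A. g i ^ k i) \<in> mfps_ideal (d + (\<Sum>i\<in>A. k i))"
proof (induction A rule: infinite_finite_induct)
  case (insert x A)
  then show ?case
    using assms
    by (auto intro!: mfps_ideal_mult_diff mfps_ideal_power_diff mfps_ideal_power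
        mfps_ideal_prod_power)
qed auto

text \<open>The coefficient at \<open>l\<close> no longer changes from stage
  \<open>Suc (mdeg l)\<close> on, so the limit can read it off there.\<close>

lemma mfps_limit:
  fixes f :: "nat \<Rightarrow> ('a::comm_ring_1, 'n::finite) mfps"
  assumes "\<And>n. f (Suc n) - f n \<in> mfps_ideal (D + n)"
  obtains g where "\<And>n. g - f n \<in> mfps_ideal (D + n)"
proof
  define g where "g = Abs_mfps (\<lambda>l. mfps_nth (f (Suc (mdeg l))) l)"
  have step: "f (m + i) - f m \<in> mfps_ideal (D + m)" for m i
  proof (induction i)
    case (Suc i)
    have "f (Suc (m + i)) - f (m + i) \<in> mfps_ideal (D + m)"
      using assms[of "m + i"] by (rule mfps_ideal_mono) simp
    then show ?case using Suc mfps_ideal_diff_trans by force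
  qed simp
  have eq: "mfps_nth (f i) l = mfps_nth (f j) l" if "i \<le> j" "mdeg l < D + i" for i j l
    using mfps_idealD[OF step[of i "j - i"], of l] that by simp
  show "g - f n \<in> mfps_ideal (D + n)" for n
    unfolding mfps_ideal_def
  proof safe
    fix l :: "nat ^ 'n"
    assume l: "mdeg l < D + n"
    have "mfps_nth (f (Suc (mdeg l))) l = mfps_nth (f n) l"
    proof (cases "n \<le> Suc (mdeg l)")
      case True
      then show ?thesis by (rule eq[OF _ l, symmetric])
    next
      case False
      show ?thesis by (rule eq) (use False in auto)
    qed
    then show "mfps_nth (g - f n) l = 0" by (simp add: g_def)
  qed
qed

definition mfps_trunc :: "nat \<Rightarrow> ('a::comm_ring_1, 'n::finite) mfps \<Rightarrow> ('a, 'n) mfps" where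
  "mfps_trunc d f = (\<Sum>l | mdeg l \<le> d. mfps_monom (mfps_nth f l) l)"

lemma mfps_trunc_diff: "f - mfps_trunc d f \<in> mfps_ideal (Suc d)"
  by (auto simp: mfps_ideal_def mfps_trunc_def mfps_nth_sum mfps_nth_monom finite_mdeg_le)

text \<open>Additive maps that respect the filtration are continuous, and polynomials are dense: the
  difference of the two maps vanishes on every truncation, and the remainder only contributes in
  arbitrarily high order. This reduces identities between series to monomials.\<close>

lemma mfps_additive_ext:
  fixes A B :: "('a::comm_ring_1, 'n::finite) mfps \<Rightarrow> ('b::comm_ring_1, 'm::finite) mfps"
  assumes A: "\<And>f g. A (f + g) = A f + A g" "\<And>f d. f \<in> mfps_ideal d \<Longrightarrow> A f \<in> mfps_ideal d"
    and B: "\<And>f g. B (f + g) = B f + B g" "\<And>f d. f \<in> mfps_ideal d \<Longrightarrow> B f \<in> mfps_ideal d"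
    and monom: "\<And>c l. A (mfps_monom c l) = B (mfps_monom c l)"
  shows "A f = B f"
proof -
  define C where "C f = A f - B f" for f
  have C: "C (f + g) = C f + C g" for f g
    by (simp add: C_def A B)
  then have C0: "C 0 = 0"
    by (metis add_cancel_right_right)
  have Csum: "C (\<Sum>i\<in>S. h i) = (\<Sum>i\<in>S. C (h i))" for S and h :: "nat ^ 'n \<Rightarrow> _"
    by (induction S rule: infinite_finite_induct) (auto simp: C C0)
  have "C f \<in> mfps_ideal d" for d
  proof -
    have "C f = C (mfps_trunc d f) + C (f - mfps_trunc d f)"
      by (simp flip: C)
    also have "C (mfps_trunc d f) = 0"
      unfolding mfps_trunc_def Csum by (simp add: C_def monom)
    finally show ?thesis
      using A(2)[of "f - mfps_trunc d f" d] B(2)[of "f - mfps_trunc d f" d]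
        mfps_ideal_mono[OF mfps_trunc_diff[of f d], of d]
      by (simp add: C_def mfps_ideal_diff)
  qed
  then have "C f = 0" by (rule mfps_ideal_eq_0)
  then show ?thesis by (simp add: C_def)
qed


section \<open>Substitution\<close>

lemma mfps_nth_compose:
  "mfps_nth (mfps_compose f P) l =
    (\<Sum>k | mdeg k \<le> mdeg l. mfps_nth f k * mfps_nth (\<Prod>j\<in>UNIV. P j ^ (k $ j)) l)"
  by (simp add: mfps_compose_def)

lemma mfps_compose_add: "mfps_compose (f + g) P = mfps_compose f P + mfps_compose g P"
  by (rule mfps_eqI) (simp add: mfps_nth_compose algebra_simps sum.distrib)

lemma mfps_compose_diff: "mfps_compose (f - g) P = mfps_compose f P - mfps_compose g P"
  by (rule mfps_eqI) (simp add: mfps_nth_compose algebra_simps sum_subtractf)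

lemma mfps_compose_ideal: "f \<in> mfps_ideal d \<Longrightarrow> mfps_compose f P \<in> mfps_ideal d"
  by (auto simp: mfps_ideal_def mfps_nth_compose)

text \<open>The cutoff \<open>mdeg k \<le> mdeg l\<close> in \<open>mfps_compose\<close> loses
  nothing here, because a product of \<open>mdeg k\<close> series without constant term has order at
  least \<open>mdeg k\<close>.\<close>

lemma mfps_compose_monom:
  assumes "\<And>i. P i \<in> mfps_ideal 1"
  shows "mfps_compose (mfps_monom c k) P = mfps_monom c 0 * (\<Prod>j\<in>UNIV. P j ^ (k $ j))"
proof (rule mfps_eqI)
  fix l
  have "(\<Prod>j\<in>UNIV. P j ^ (k $ j)) \<in> mfps_ideal (mdeg k)"
    unfolding mdeg_def by (rule mfps_ideal_prod_power[OF assms])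
  then have "mfps_nth (\<Prod>j\<in>UNIV. P j ^ (k $ j)) l = 0" if "\<not> mdeg k \<le> mdeg l"
    by (rule mfps_idealD) (use that in simp)
  then show "mfps_nth (mfps_compose (mfps_monom c k) P) l =
      mfps_nth (mfps_monom c 0 * (\<Prod>j\<in>UNIV. P j ^ (k $ j))) l"
    by (auto simp: mfps_nth_compose mfps_nth_monom if_distrib if_distribR finite_mdeg_le
        cong: if_cong)
qed

text \<open>Both sides are additive and continuous in each factor, so the density argument is
  applied once per factor and leaves a product of two monomials.\<close>

lemma mfps_compose_mult:
  assumes P: "\<And>i. P i \<in> mfps_ideal 1"
  shows "mfps_compose (f * g) P = mfps_compose f P * mfps_compose g P"
proof (rule mfps_additive_ext[of "\<lambda>f. mfps_compose (f * g) P"])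
  fix c l
  show "mfps_compose (mfps_monom c l * g) P = mfps_compose (mfps_monom c l) P * mfps_compose g P"
  proof (rule mfps_additive_ext[of "\<lambda>g. mfps_compose (mfps_monom c l * g) P"])
    fix d m
    show "mfps_compose (mfps_monom c l * mfps_monom d m) P =
        mfps_compose (mfps_monom c l) P * mfps_compose (mfps_monom d m) P"
      using mfps_monom_mult[of c 0 d 0]
      by (simp add: mfps_compose_monom[OF P] mfps_monom_mult power_add prod.distrib mult_ac
          flip: mult.assoc[of "mfps_monom c 0" "mfps_monom d 0"])
  qed (auto simp: distrib_left mfps_compose_add intro: mfps_compose_ideal mfps_ideal_mult_left)
qed (auto simp: distrib_right mfps_compose_add intro: mfps_compose_ideal mfps_ideal_mult_right)

lemma mfps_compose_const: "(\<And>i. P i \<in> mfps_ideal 1) \<Longrightarrow>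
    mfps_compose (mfps_monom c 0) P = mfps_monom c 0"
  by (subst mfps_compose_monom) auto

lemma mfps_compose_one: "(\<And>i. P i \<in> mfps_ideal 1) \<Longrightarrow> mfps_compose 1 P = 1"
  using mfps_compose_const[of P 1] by (simp add: mfps_monom_one)

lemma mfps_compose_axis: "(\<And>i. P i \<in> mfps_ideal 1) \<Longrightarrow>
    mfps_compose (mfps_monom c (axis i 1)) P = mfps_monom c 0 * P i"
proof (subst mfps_compose_monom)
  have "(\<Prod>j\<in>UNIV. P j ^ (axis i 1 $ j)) = (\<Prod>j\<in>UNIV. if j = i then P i else 1)"
    by (rule prod.cong) (auto simp: axis_def)
  then show "mfps_monom c 0 * (\<Prod>j\<in>UNIV. P j ^ (axis i 1 $ j)) = mfps_monom c 0 * P i"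
    by simp
qed

lemma mfps_compose_power: "(\<And>i. P i \<in> mfps_ideal 1) \<Longrightarrow>
    mfps_compose (f ^ n) P = mfps_compose f P ^ n"
  by (induction n) (auto simp: mfps_compose_mult mfps_compose_one)

lemma mfps_compose_prod: "(\<And>i. P i \<in> mfps_ideal 1) \<Longrightarrow>
    mfps_compose (\<Prod>i\<in>A. f i) P = (\<Prod>i\<in>A. mfps_compose (f i) P)"
  by (induction A rule: infinite_finite_induct) (auto simp: mfps_compose_mult mfps_compose_one)

text \<open>The point is the gain \<open>e\<close>: only monomials of degree \<open>|k| > e\<close>
  occur in \<open>f\<close>, and their values at \<open>P\<close> and \<open>Q\<close> agree below
  order \<open>d + |k|\<close>. For \<open>e = 1\<close>, a correction of the inner series is
  invisible, at its own leading order, to the nonlinear part of the outer one.\<close>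

lemma mfps_compose_diff_right:
  assumes f: "f \<in> mfps_ideal (Suc e)" and d: "\<And>i. P i - Q i \<in> mfps_ideal (Suc d)"
    and P: "\<And>i. P i \<in> mfps_ideal 1" and Q: "\<And>i. Q i \<in> mfps_ideal 1"
  shows "mfps_compose f P - mfps_compose f Q \<in> mfps_ideal (Suc (d + e))"
proof -
  have "mfps_nth (mfps_compose f P - mfps_compose f Q) l = 0" if l: "mdeg l < Suc (d + e)" for l
  proof -
    have "mfps_nth f k * mfps_nth ((\<Prod>j\<in>UNIV. P j ^ (k $ j)) - (\<Prod>j\<in>UNIV. Q j ^ (k $ j))) l = 0"
      for k
    proof (cases "mdeg k < Suc e")
      case True
      then show ?thesis using f by (simp add: mfps_idealD)
    next
      case False
      have "(\<Prod>j\<in>UNIV. P j ^ (k $ j)) - (\<Prod>j\<in>UNIV. Q j ^ (k $ j)) \<in> mfps_ideal (d + mdeg k)"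
        unfolding mdeg_def by (rule mfps_ideal_prod_power_diff[OF d P Q])
      then show ?thesis
        using l False mfps_idealD[of _ "d + mdeg k" l] by fastforce
    qed
    then show ?thesis
      by (simp add: mfps_nth_compose algebra_simps flip: sum_subtractf)
  qed
  then show ?thesis by (simp add: mfps_ideal_def)
qed

lemma mfps_compose_cong:
  assumes "f - g \<in> mfps_ideal (Suc d)" "\<And>i. P i - Q i \<in> mfps_ideal (Suc d)"
    and "\<And>i. P i \<in> mfps_ideal 1" "\<And>i. Q i \<in> mfps_ideal 1" "f \<in> mfps_ideal 1"
  shows "mfps_compose f P - mfps_compose g Q \<in> mfps_ideal (Suc d)"
proof (rule mfps_ideal_diff_trans)
  show "mfps_compose f P - mfps_compose f Q \<in> mfps_ideal (Suc d)"
    using mfps_compose_diff_right[of f 0 P Q d] assms by (simp add: One_nat_def)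
  show "mfps_compose f Q - mfps_compose g Q \<in> mfps_ideal (Suc d)"
    using assms(1) by (simp add: mfps_compose_ideal flip: mfps_compose_diff)
qed

definition diag_tangent :: "('n::finite \<Rightarrow> (complex, 'n) mfps) \<Rightarrow> complex ^ 'n \<Rightarrow> bool" where
  "diag_tangent P c \<longleftrightarrow> (\<forall>i. P i - mfps_monom (c $ i) (axis i 1) \<in> mfps_ideal 2)"

lemma diag_tangent_ideal: "diag_tangent P c \<Longrightarrow> P i \<in> mfps_ideal 1"
  using mfps_ideal_add[of "P i - mfps_monom (c $ i) (axis i 1)" 1 "mfps_monom (c $ i) (axis i 1)"]
    mfps_ideal_mono[of "P i - mfps_monom (c $ i) (axis i 1)" 2 1]
  by (simp add: diag_tangent_def mfps_monom_in_ideal)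

text \<open>To lowest order, a substitution with diagonal linear part multiplies the monomial
  \<open>z^l\<close> by \<open>c^l\<close>. This eigenvalue is the origin of the divisors
  \<open>lam_j - lam^l\<close> in the homological equation.\<close>

lemma mfps_nth_compose_diag:
  assumes P: "diag_tangent P c" and f: "f \<in> mfps_ideal (mdeg l)"
  shows "mfps_nth (mfps_compose f P) l = mfps_nth f l * mpow c l"
proof -
  have *: "mfps_nth f k * mfps_nth (\<Prod>j\<in>UNIV. P j ^ (k $ j)) l
      = (if k = l then mfps_nth f l * mpow c l else 0)" for k
  proof (cases "mdeg k < mdeg l")
    case True
    then show ?thesis using mfps_idealD[OF f True] by auto
  next
    case False
    \<comment> \<open>Replacing \<open>P\<close> by its linear part is an error of relative order 1,
      so it only shows beyond degree \<open>mdeg k\<close>, which is at least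
      \<open>mdeg l\<close>.\<close>
    have "(\<Prod>j\<in>UNIV. P j ^ (k $ j)) - (\<Prod>j\<in>UNIV. mfps_monom (c $ j) (axis j 1) ^ (k $ j))
        \<in> mfps_ideal (1 + mdeg k)"
      unfolding mdeg_def using P diag_tangent_ideal[OF P]
      by (intro mfps_ideal_prod_power_diff)
        (auto simp: diag_tangent_def numeral_2_eq_2 intro: mfps_monom_in_ideal)
    from mfps_idealD[OF this, of l] False show ?thesis
      by (simp add: prod_diag_monom_power mfps_nth_monom)
  qed
  show ?thesis
    unfolding mfps_nth_compose * by (simp add: finite_mdeg_le)
qed


section \<open>The problem in one variable\<close>

abbreviation fps_eqm :: "nat \<Rightarrow> complex fps \<Rightarrow> complex fps \<Rightarrow> bool" where
  "fps_eqm n f g \<equiv> fps_X ^ n dvd f - g"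

lemma fps_X_power_dvd_iff: "fps_X ^ n dvd (f :: complex fps) \<longleftrightarrow> (\<forall>i<n. fps_nth f i = 0)"
proof
  assume "\<forall>i<n. fps_nth f i = 0"
  then have "f = fps_X ^ n * fps_shift n f"
    by (auto simp: fps_eq_iff fps_X_power_mult_nth)
  then show "fps_X ^ n dvd f" by (metis dvd_triv_left)
qed (auto simp: fps_X_power_mult_nth elim!: dvdE)

lemma fps_eqm_0_iff: "fps_eqm 1 f (fps_const c) \<longleftrightarrow> fps_nth f 0 = c"
  by (simp add: fps_X_power_dvd_iff[of 1, simplified])

lemma fps_eqm_trans: "fps_eqm n f g \<Longrightarrow> fps_eqm n g h \<Longrightarrow> fps_eqm n f h"
  using dvd_add[of "fps_X ^ n" "f - g" "g - h"] by simp

lemma fps_eqm_dvd: "fps_eqm n f g \<Longrightarrow> fps_X ^ n dvd g \<Longrightarrow> fps_X ^ n dvd f"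
  using dvd_add[of "fps_X ^ n" "f - g" g] by simp

lemma fps_eqm_mono: "fps_eqm n f g \<Longrightarrow> m \<le> n \<Longrightarrow> fps_eqm m f g"
  by (meson dvd_trans le_imp_power_dvd)

lemma fps_eqm_add: "fps_eqm n f f' \<Longrightarrow> fps_eqm n g g' \<Longrightarrow> fps_eqm n (f + g) (f' + g')"
  by (simp add: add_diff_add)

lemma fps_eqm_diff: "fps_eqm n f f' \<Longrightarrow> fps_eqm n g g' \<Longrightarrow> fps_eqm n (f - g) (f' - g')"
  using dvd_diff[of "fps_X ^ n" "f - f'" "g - g'"] by (simp add: algebra_simps)

lemma fps_eqm_mult: "fps_eqm n f f' \<Longrightarrow> fps_eqm n g g' \<Longrightarrow> fps_eqm n (f * g) (f' * g')"
proof -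
  assume "fps_eqm n f f'" "fps_eqm n g g'"
  then have "fps_X ^ n dvd (f - f') * g + f' * (g - g')"
    by (intro dvd_add dvd_mult dvd_mult2)
  then show ?thesis by (simp add: algebra_simps)
qed

lemma fps_eqm_power: "fps_eqm n f g \<Longrightarrow> fps_eqm n (f ^ m) (g ^ m)"
  by (induction m) (auto intro: fps_eqm_mult)

lemma fps_eqm_prod: "(\<And>i. i \<in> A \<Longrightarrow> fps_eqm n (f i) (g i)) \<Longrightarrow> fps_eqm n (\<Prod>i\<in>A. f i) (\<Prod>i\<in>A. g i)"
  by (induction A rule: infinite_finite_induct) (auto intro: fps_eqm_mult)

lemma fps_eqm_shift: "fps_eqm n f g \<Longrightarrow> fps_eqm (m + n) (fps_X ^ m * f) (fps_X ^ m * g)"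
  by (simp add: power_add mult_dvd_mono flip: right_diff_distrib)

lemma fps_eqm_compose:
  assumes "fps_eqm n f g" "fps_nth \<theta> 0 = 0"
  shows "fps_eqm n (fps_compose f \<theta>) (fps_compose g \<theta>)"
proof -
  obtain r where r: "f - g = fps_X ^ n * r" using assms(1) by (auto elim: dvdE)
  have "fps_X ^ 1 dvd \<theta>" using assms(2) by (subst fps_X_power_dvd_iff) auto
  then have "fps_X ^ n dvd \<theta> ^ n" by (simp add: dvd_power_same)
  moreover have "fps_compose f \<theta> - fps_compose g \<theta> = \<theta> ^ n * fps_compose r \<theta>"
    using assms(2) by (simp add: r fps_compose_mult_distrib fps_compose_power[symmetric]
        flip: fps_compose_sub_distrib)
  ultimately show ?thesis by simp
qed

lemma fps_eqm_limit:
  fixes f :: "nat \<Rightarrow> complex fps"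
  assumes "\<And>n. fps_eqm n (f (Suc n)) (f n)"
  obtains g where "\<And>n. fps_eqm n g (f n)"
proof
  define g where "g = Abs_fps (\<lambda>i. fps_nth (f (Suc i)) i)"
  have step: "fps_eqm m (f (m + i)) (f m)" for m i
  proof (induction i)
    case (Suc i)
    have "fps_eqm m (f (Suc (m + i))) (f (m + i))"
      using assms[of "m + i"] by (rule fps_eqm_mono) simp
    from fps_eqm_trans[OF this Suc] show ?case by simp
  qed simp
  have "fps_nth (f (Suc i)) i = fps_nth (f n) i" if "i < n" for i n
    using step[of "Suc i" "n - Suc i"] that unfolding fps_X_power_dvd_iff by simp
  then show "fps_eqm n g (f n)" for n
    by (simp add: fps_X_power_dvd_iff g_def)
qed

text \<open>\<open>d\<close> is the relative size of the perturbation, so that it is additive under products.\<close>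

definition fps_pert ::
  "nat \<Rightarrow> complex fps \<Rightarrow> complex fps \<Rightarrow> complex \<Rightarrow> complex \<Rightarrow> bool" where
  "fps_pert n f p c d \<longleftrightarrow>
     fps_nth p 0 = c \<and> fps_eqm (Suc n) f (p + fps_const (c * d) * fps_X ^ n)"

text \<open>A Leibniz rule: modulo \<open>X^(n+1)\<close> the factor \<open>X^n\<close> sees only
  the constant term of the other series, and the product of the two perturbations has order
  \<open>2n > n\<close>.\<close>

lemma fps_pert_mult:
  assumes n: "1 \<le> n" and f: "fps_pert n f p c d" and g: "fps_pert n g q c' d'"
  shows "fps_pert n (f * g) (p * q) (c * c') (d + d')"
proof -
  let ?p' = "p + fps_const (c * d) * fps_X ^ n" and ?q' = "q + fps_const (c' * d') * fps_X ^ n"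
  have 0: "fps_eqm 1 p (fps_const c)" "fps_eqm 1 q (fps_const c')"
    using f g unfolding fps_eqm_0_iff by (auto simp: fps_pert_def)
  have 1: "fps_eqm (Suc n) (fps_X ^ n * p) (fps_X ^ n * fps_const c)"
    "fps_eqm (Suc n) (fps_X ^ n * q) (fps_X ^ n * fps_const c')"
    using fps_eqm_shift[OF 0(1), of n] fps_eqm_shift[OF 0(2), of n] by (simp_all add: One_nat_def)
  have 2: "fps_X ^ Suc n dvd (fps_X :: complex fps) ^ n * fps_X ^ n"
    using n by (metis le_imp_power_dvd power_add add_le_mono le_refl plus_1_eq_Suc)
  have "fps_eqm (Suc n) (f * g) (?p' * ?q')"
    using f g by (intro fps_eqm_mult) (auto simp: fps_pert_def)
  moreover have "fps_eqm (Suc n) (?p' * ?q') (p * q + fps_const (c * c' * (d + d')) * fps_X ^ n)"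
  proof -
    have "?p' * ?q' - (p * q + fps_const (c * c' * (d + d')) * fps_X ^ n)
      = fps_const (c' * d') * (fps_X ^ n * p - fps_X ^ n * fps_const c)
        + fps_const (c * d) * (fps_X ^ n * q - fps_X ^ n * fps_const c')
        + fps_const (c * d * (c' * d')) * (fps_X ^ n * fps_X ^ n)"
      by (simp add: algebra_simps flip: fps_const_mult fps_const_add)
    then show ?thesis
      by (simp only:) (intro dvd_add dvd_mult[OF 1(1)] dvd_mult[OF 1(2)] dvd_mult[OF 2])
  qed
  ultimately have "fps_eqm (Suc n) (f * g) (p * q + fps_const (c * c' * (d + d')) * fps_X ^ n)"
    by (rule fps_eqm_trans)
  then show ?thesis
    using f g by (simp add: fps_pert_def)
qed

lemma fps_pert_one: "fps_pert n 1 1 1 0"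
  by (simp add: fps_pert_def)

lemma fps_pert_power: "1 \<le> n \<Longrightarrow> fps_pert n f p c d \<Longrightarrow> fps_pert n (f ^ m) (p ^ m) (c ^ m) (of_nat m * d)"
  by (induction m) (auto simp: fps_pert_one distrib_right intro: fps_pert_mult)

lemma fps_pert_prod:
  assumes "1 \<le> n" "\<And>i. i \<in> A \<Longrightarrow> fps_pert n (f i) (p i) (c i) (d i)"
  shows "fps_pert n (\<Prod>i\<in>A. f i) (\<Prod>i\<in>A. p i) (\<Prod>i\<in>A. c i) (\<Sum>i\<in>A. d i)"
  using assms(2)
  by (induction A rule: infinite_finite_induct) (auto simp: fps_pert_one intro: fps_pert_mult assms(1))

text \<open>
  The map \<open>(z\<^sub>j)\<^sub>j \<mapsto> (z\<^sub>j g\<^sub>j(u))\<^sub>j\<close> with \<open>u = z\<^sup>\<alpha>\<close> induces \<open>\<theta>\<close> on the variable \<open>u\<close>, and it is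
  conjugated to its normal form by \<open>(z\<^sub>j \<psi>\<^sub>j(u))\<^sub>j\<close> if and only if the series \<open>err \<psi> \<mu> j\<close> below
  vanish.
\<close>

locale resonant_system =
  fixes J :: "'i set" and \<alpha> :: "'i \<Rightarrow> nat" and lam a :: "'i \<Rightarrow> complex"
    and g :: "'i \<Rightarrow> complex fps" and k :: nat
  assumes finJ: "finite J" and k: "1 \<le> k" and lam: "\<And>j. j \<in> J \<Longrightarrow> lam j \<noteq> 0"
    and prod_lam: "(\<Prod>j\<in>J. lam j ^ \<alpha> j) = 1"
    and nondeg: "(\<Sum>j\<in>J. a j * of_nat (\<alpha> j) / lam j) \<noteq> 0"
    and g: "\<And>j. j \<in> J \<Longrightarrow> fps_eqm (Suc k) (g j) (fps_const (lam j) + fps_const (a j) * fps_X ^ k)"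
begin

definition \<Lambda> where "\<Lambda> = (\<Sum>j\<in>J. of_nat (\<alpha> j) * (a j / lam j))"

text \<open>The direction in which \<open>\<mu>\<close> acts. Up to complex conjugation these are
  the coefficients \<open>\<alpha>_j / \<lambda>_j\<close> of the functional that detects the
  obstruction.\<close>

definition \<kappa> where "\<kappa> j = of_nat (\<alpha> j) * inverse (cnj (lam j))"

text \<open>The factor by which the map multiplies \<open>u = z^\<alpha>\<close>, as a series in
  \<open>u\<close>.\<close>

definition \<gamma> where "\<gamma> = (\<Prod>j\<in>J. g j ^ \<alpha> j)"

definition \<theta> where "\<theta> = fps_X * \<gamma>"

text \<open>After the substitution \<open>z_j \<mapsto> z_j \<psi>_j(u)\<close> the resonant
  monomial is \<open>u \<rho>(u)\<close> in terms of the old one.\<close>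

definition \<rho> where "\<rho> \<psi> = (\<Prod>j\<in>J. \<psi> j ^ \<alpha> j)" for \<psi> :: "'i \<Rightarrow> complex fps"

text \<open>The \<open>j\<close>-th component of the normal form divided by \<open>z_j\<close>,
  evaluated in the new coordinates but written in the old variable \<open>u\<close>; hence
  \<open>X \<rho>\<close> stands in place of the resonant monomial.\<close>

definition nf where
  "nf \<psi> \<mu> j = fps_const (lam j) + fps_const (a j) * (fps_X * \<rho> \<psi>) ^ k
     + fps_const (\<mu> * \<kappa> j) * (fps_X * \<rho> \<psi>) ^ (2 * k)"

definition err where
  "err \<psi> \<mu> j = g j * fps_compose (\<psi> j) \<theta> - \<psi> j * nf \<psi> \<mu> j"

lemma \<Lambda>_nz: "\<Lambda> \<noteq> 0"
  using nondeg by (simp add: \<Lambda>_def ac_simps)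

lemma \<theta>_0 [simp]: "fps_nth \<theta> 0 = 0"
  by (simp add: \<theta>_def)

text \<open>Relative perturbations add: each \<open>g_i\<close> has
  \<open>a_i / \<lambda>_i\<close>, so \<open>\<gamma>\<close> has \<open>\<Lambda>\<close> and
  constant term 1, and \<open>g_j \<gamma>^s\<close> has
  \<open>a_j / \<lambda>_j + s \<Lambda>\<close>. Up to the factor \<open>X^s\<close> this product
  is the image of \<open>X^s\<close> under \<open>p \<mapsto> g_j (p o \<theta>)\<close>.\<close>

lemma g_\<gamma>_power:
  assumes j: "j \<in> J"
  shows "fps_eqm (Suc k) (g j * \<gamma> ^ s)
    (fps_const (lam j) + fps_const (a j + lam j * (of_nat s * \<Lambda>)) * fps_X ^ k)"
proof -
  have *: "fps_pert k (g i) (fps_const (lam i)) (lam i) (a i / lam i)" if "i \<in> J" for i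
    using g[OF that] lam[OF that] by (simp add: fps_pert_def)
  have "fps_pert k \<gamma> (\<Prod>i\<in>J. fps_const (lam i) ^ \<alpha> i) (\<Prod>i\<in>J. lam i ^ \<alpha> i) \<Lambda>"
    unfolding \<gamma>_def \<Lambda>_def by (intro fps_pert_prod fps_pert_power k *)
  moreover have "(\<Prod>i\<in>J. fps_const (lam i) ^ \<alpha> i) = fps_const (\<Prod>i\<in>J. lam i ^ \<alpha> i)"
    by (simp only: fps_const_power)
      (induction J rule: infinite_finite_induct; simp flip: fps_const_mult)
  ultimately have "fps_pert k \<gamma> 1 1 \<Lambda>"
    by (simp add: prod_lam)
  from fps_pert_mult[OF k *[OF j] fps_pert_power[OF k this, of s]] show ?thesis
    using lam[OF j] by (simp add: fps_pert_def algebra_simps)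
qed

lemma \<rho>_0: "(\<And>j. j \<in> J \<Longrightarrow> fps_nth (\<psi> j) 0 = 1) \<Longrightarrow> fps_nth (\<rho> \<psi>) 0 = 1"
  unfolding \<rho>_def
  by (induction J rule: infinite_finite_induct) (auto simp: fps_nth_power_0)

text \<open>At order \<open>k + s\<close> the change of \<open>\<psi>\<close> is felt only through
  \<open>(X \<rho>)^k\<close>, since its effect on \<open>(X \<rho>)^(2k)\<close> starts at order
  \<open>2k + s > k + s\<close>. A change \<open>\<nu>\<close> of \<open>\<mu>\<close> acts at order
  \<open>2k\<close>, which is the order \<open>k + s\<close> precisely for
  \<open>s = k\<close>.\<close>

lemma nf_update:
  assumes j: "j \<in> J" and s: "1 \<le> s" and \<nu>: "s = k \<or> \<nu> = 0"
    and \<psi>0: "\<And>i. i \<in> J \<Longrightarrow> fps_nth (\<psi> i) 0 = 1"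
    and \<psi>': "\<psi>' = (\<lambda>i. \<psi> i + fps_const (b i) * fps_X ^ s)"
  shows "fps_eqm (Suc (k + s)) (nf \<psi>' (\<mu> + \<nu>) j)
     (nf \<psi> \<mu> j + fps_const (of_nat k * a j * (\<Sum>i\<in>J. of_nat (\<alpha> i) * b i) + \<nu> * \<kappa> j) * fps_X ^ (k + s))"
proof -
  define T where "T = (\<Sum>i\<in>J. of_nat (\<alpha> i) * b i)"
  have "fps_pert s (\<rho> \<psi>') (\<rho> \<psi>) (\<Prod>i\<in>J. 1 ^ \<alpha> i) T"
    unfolding \<rho>_def T_def
    by (intro fps_pert_prod fps_pert_power s) (auto simp: fps_pert_def \<psi>' \<psi>0)
  then have \<rho>': "fps_pert s (\<rho> \<psi>') (\<rho> \<psi>) 1 T" by simp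
  have 1: "fps_eqm (Suc (k + s)) ((fps_X * \<rho> \<psi>') ^ k)
      ((fps_X * \<rho> \<psi>) ^ k + fps_const (of_nat k * T) * fps_X ^ (k + s))"
  proof -
    have "fps_eqm (Suc s) (\<rho> \<psi>' ^ k) (\<rho> \<psi> ^ k + fps_const (of_nat k * T) * fps_X ^ s)"
      using fps_pert_power[OF s \<rho>', of k] by (simp add: fps_pert_def)
    from fps_eqm_shift[OF this, of k] show ?thesis
      by (simp add: power_mult_distrib power_add algebra_simps)
  qed
  have 2: "fps_eqm (Suc (k + s)) ((fps_X * \<rho> \<psi>') ^ (2 * k)) ((fps_X * \<rho> \<psi>) ^ (2 * k))"
  proof -
    have "fps_eqm s (\<psi>' i) (\<psi> i)" for i
      by (simp add: \<psi>')
    then have "fps_eqm s (\<rho> \<psi>' ^ (2 * k)) (\<rho> \<psi> ^ (2 * k))"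
      unfolding \<rho>_def by (intro fps_eqm_power fps_eqm_prod)
    from fps_eqm_shift[OF this, of "2 * k"] show ?thesis
      unfolding power_mult_distrib by (rule fps_eqm_mono) (use k in simp)
  qed
  have 3: "fps_eqm (Suc (k + s)) (fps_const (\<nu> * \<kappa> j) * (fps_X * \<rho> \<psi>) ^ (2 * k))
      (fps_const (\<nu> * \<kappa> j) * fps_X ^ (k + s))"
  proof (cases "s = k")
    case True
    have "fps_eqm 1 (\<rho> \<psi>) (fps_const 1)"
      unfolding fps_eqm_0_iff by (rule \<rho>_0[OF \<psi>0])
    from fps_eqm_shift[OF fps_eqm_power[OF this, of "2 * k"], of "2 * k"]
    have "fps_eqm (Suc (k + s)) ((fps_X * \<rho> \<psi>) ^ (2 * k)) (fps_X ^ (k + s))"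
      by (simp add: True power_mult_distrib One_nat_def flip: mult_2)
    then show ?thesis by (intro fps_eqm_mult) auto
  qed (use \<nu> in simp)
  have "fps_eqm (Suc (k + s)) (nf \<psi>' (\<mu> + \<nu>) j)
     (fps_const (lam j)
      + fps_const (a j) * ((fps_X * \<rho> \<psi>) ^ k + fps_const (of_nat k * T) * fps_X ^ (k + s))
      + fps_const ((\<mu> + \<nu>) * \<kappa> j) * (fps_X * \<rho> \<psi>) ^ (2 * k))"
    unfolding nf_def by (intro fps_eqm_add fps_eqm_mult 1 2) auto
  also have "fps_const (lam j)
      + fps_const (a j) * ((fps_X * \<rho> \<psi>) ^ k + fps_const (of_nat k * T) * fps_X ^ (k + s))
      + fps_const ((\<mu> + \<nu>) * \<kappa> j) * (fps_X * \<rho> \<psi>) ^ (2 * k)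
    = nf \<psi> \<mu> j + fps_const (of_nat k * a j * T) * fps_X ^ (k + s)
      + fps_const (\<nu> * \<kappa> j) * (fps_X * \<rho> \<psi>) ^ (2 * k)"
    by (simp add: nf_def algebra_simps flip: fps_const_mult fps_const_add)
  finally have "fps_eqm (Suc (k + s)) (nf \<psi>' (\<mu> + \<nu>) j)
     (nf \<psi> \<mu> j + fps_const (of_nat k * a j * T) * fps_X ^ (k + s)
      + fps_const (\<nu> * \<kappa> j) * (fps_X * \<rho> \<psi>) ^ (2 * k))" .
  moreover have "fps_eqm (Suc (k + s))
     (nf \<psi> \<mu> j + fps_const (of_nat k * a j * T) * fps_X ^ (k + s)
      + fps_const (\<nu> * \<kappa> j) * (fps_X * \<rho> \<psi>) ^ (2 * k))
     (nf \<psi> \<mu> j + fps_const (of_nat k * a j * T) * fps_X ^ (k + s)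
      + fps_const (\<nu> * \<kappa> j) * fps_X ^ (k + s))"
    by (rule fps_eqm_add[OF _ 3]) simp
  ultimately have "fps_eqm (Suc (k + s)) (nf \<psi>' (\<mu> + \<nu>) j)
     (nf \<psi> \<mu> j + fps_const (of_nat k * a j * T) * fps_X ^ (k + s)
      + fps_const (\<nu> * \<kappa> j) * fps_X ^ (k + s))"
    by (rule fps_eqm_trans)
  then show ?thesis
    unfolding T_def[symmetric] by (simp add: algebra_simps flip: fps_const_add)
qed

lemma nf_mod: 
  assumes \<psi>0: "\<And>i. i \<in> J \<Longrightarrow> fps_nth (\<psi> i) 0 = 1"
  shows "fps_eqm (Suc k) (nf \<psi> \<mu> j) (fps_const (lam j) + fps_const (a j) * fps_X ^ k)"
proof -
  have "fps_eqm 1 (\<rho> \<psi>) (fps_const 1)"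
    unfolding fps_eqm_0_iff by (rule \<rho>_0[OF \<psi>0])
  from fps_eqm_shift[OF fps_eqm_power[OF this, of k], of k]
  have 1: "fps_eqm (Suc k) ((fps_X * \<rho> \<psi>) ^ k) (fps_X ^ k)"
    by (simp add: power_mult_distrib One_nat_def)
  have 2: "fps_eqm (Suc k) ((fps_X * \<rho> \<psi>) ^ (2 * k)) 0"
    unfolding power_mult_distrib diff_0_right
    by (intro dvd_mult2 le_imp_power_dvd) (use k in simp)
  have "fps_eqm (Suc k) (nf \<psi> \<mu> j)
      (fps_const (lam j) + fps_const (a j) * fps_X ^ k + fps_const (\<mu> * \<kappa> j) * 0)"
    unfolding nf_def by (intro fps_eqm_add fps_eqm_mult 1 2) auto
  then show ?thesis by simp
qed

text \<open>The new contributions \<open>b_j \<lambda>_j X^s\<close> and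
  \<open>b_j a_j X^(k+s)\<close> occur in both terms of \<open>err\<close> and cancel. What remains
  of the first term is \<open>b_j \<lambda>_j s \<Lambda>\<close>, which comes from
  \<open>\<theta>\<close> and is where nondegeneracy enters.\<close>

lemma err_update:
  assumes j: "j \<in> J" and s: "1 \<le> s" and \<nu>: "s = k \<or> \<nu> = 0"
    and \<psi>0: "\<And>i. i \<in> J \<Longrightarrow> fps_nth (\<psi> i) 0 = 1"
    and \<psi>': "\<psi>' = (\<lambda>i. \<psi> i + fps_const (b i) * fps_X ^ s)"
  shows "fps_eqm (Suc (k + s)) (err \<psi>' (\<mu> + \<nu>) j)
     (err \<psi> \<mu> j + fps_const (b j * lam j * of_nat s * \<Lambda>
        - of_nat k * a j * (\<Sum>i\<in>J. of_nat (\<alpha> i) * b i) - \<nu> * \<kappa> j) * fps_X ^ (k + s))"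
proof -
  define e where "e = of_nat k * a j * (\<Sum>i\<in>J. of_nat (\<alpha> i) * b i) + \<nu> * \<kappa> j"
  have "fps_compose (\<psi>' j) \<theta> = fps_compose (\<psi> j) \<theta> + fps_const (b j) * (fps_X ^ s * \<gamma> ^ s)"
    by (simp add: \<psi>' fps_compose_add_distrib fps_compose_mult_distrib
        fps_compose_power[symmetric] \<theta>_def power_mult_distrib)
  then have 1: "g j * fps_compose (\<psi>' j) \<theta>
      = g j * fps_compose (\<psi> j) \<theta> + fps_const (b j) * (fps_X ^ s * (g j * \<gamma> ^ s))"
    by (simp add: algebra_simps)
  have *: "fps_eqm (Suc (k + s)) (fps_X ^ s * (g j * \<gamma> ^ s)) (fps_X ^ s *
      (fps_const (lam j) + fps_const (a j + lam j * (of_nat s * \<Lambda>)) * fps_X ^ k))"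
    using fps_eqm_shift[OF g_\<gamma>_power[OF j, of s], of s] by (simp only: add.commute[of s] add_Suc_right add_Suc)
  have L: "fps_eqm (Suc (k + s)) (g j * fps_compose (\<psi>' j) \<theta>)
      (g j * fps_compose (\<psi> j) \<theta> + fps_const (b j) * (fps_X ^ s *
      (fps_const (lam j) + fps_const (a j + lam j * (of_nat s * \<Lambda>)) * fps_X ^ k)))"
    unfolding 1 by (rule fps_eqm_add[OF _ fps_eqm_mult[OF _ *]]) auto
  have 2: "fps_eqm (Suc (k + s)) (\<psi>' j * nf \<psi>' (\<mu> + \<nu>) j)
      (\<psi>' j * (nf \<psi> \<mu> j + fps_const e * fps_X ^ (k + s)))"
    using nf_update[OF j s \<nu> \<psi>0 \<psi>', where \<mu>=\<mu>] unfolding e_def by (intro fps_eqm_mult) auto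
  have "fps_eqm (Suc k) (nf \<psi> \<mu> j) (fps_const (lam j) + fps_const (a j) * fps_X ^ k)"
    by (rule nf_mod) (rule \<psi>0)
  from fps_eqm_shift[OF this, of s]
  have 3: "fps_eqm (Suc (k + s)) (fps_const (b j) * (fps_X ^ s * nf \<psi> \<mu> j))
      (fps_const (b j) * (fps_X ^ s * (fps_const (lam j) + fps_const (a j) * fps_X ^ k)))"
    by (intro fps_eqm_mult[of _ "fps_const (b j)"]) (simp_all only: add.commute[of s] add_Suc_right add_Suc diff_self dvd_0_right)
  have "fps_eqm 1 (\<psi>' j) (fps_const 1)"
    unfolding fps_eqm_0_iff using \<psi>0[OF j] s by (simp add: \<psi>')
  from fps_eqm_shift[OF this, of "k + s"]
  have 4: "fps_eqm (Suc (k + s)) (fps_const e * (fps_X ^ (k + s) * \<psi>' j)) (fps_const e * fps_X ^ (k + s))"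
    by (intro fps_eqm_mult) (auto simp: One_nat_def)
  have 5: "\<psi>' j * (nf \<psi> \<mu> j + fps_const e * fps_X ^ (k + s)) = \<psi> j * nf \<psi> \<mu> j
      + fps_const (b j) * (fps_X ^ s * nf \<psi> \<mu> j) + fps_const e * (fps_X ^ (k + s) * \<psi>' j)"
    by (simp add: \<psi>' algebra_simps)
  have R: "fps_eqm (Suc (k + s)) (\<psi>' j * nf \<psi>' (\<mu> + \<nu>) j) (\<psi> j * nf \<psi> \<mu> j
      + fps_const (b j) * (fps_X ^ s * (fps_const (lam j) + fps_const (a j) * fps_X ^ k))
      + fps_const e * fps_X ^ (k + s))"
    by (rule fps_eqm_trans[OF 2[unfolded 5] fps_eqm_add[OF fps_eqm_add[OF _ 3] 4]]) simp
  have c: "fps_const (b j * lam j * of_nat s * \<Lambda> - of_nat k * a j * (\<Sum>i\<in>J. of_nat (\<alpha> i) * b i) - \<nu> * \<kappa> j)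
      = fps_const (b j) * fps_const (lam j) * fps_const (of_nat s) * fps_const \<Lambda> - fps_const e"
    by (simp add: e_def)
  show ?thesis
    using fps_eqm_diff[OF L R] unfolding c err_def
    by (simp add: algebra_simps power_add flip: fps_const_add fps_const_mult)
qed

text \<open>The conjugate makes each summand \<open>\<alpha>_j^2 / |\<lambda>_j|^2\<close>, which is
  nonnegative, and nondegeneracy provides an index in \<open>J\<close> with
  \<open>\<alpha>_i \<noteq> 0\<close>.\<close>

lemma sum_\<alpha>_\<kappa>_nz: "(\<Sum>j\<in>J. of_nat (\<alpha> j) * (\<kappa> j / lam j)) \<noteq> 0"
proof -
  define x where "x j = (real (\<alpha> j))\<^sup>2 / (cmod (lam j))\<^sup>2" for j
  have "of_nat (\<alpha> j) * (\<kappa> j / lam j) = of_real (x j)" for j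
  proof -
    have "cnj (lam j) * lam j = of_real ((cmod (lam j))\<^sup>2)"
      by (simp only: complex_norm_square mult.commute)
    moreover have "of_nat (\<alpha> j) * (\<kappa> j / lam j) = (of_nat (\<alpha> j))\<^sup>2 / (cnj (lam j) * lam j)"
      by (simp add: \<kappa>_def power2_eq_square divide_inverse)
    ultimately show ?thesis by (simp add: x_def)
  qed
  then have "(\<Sum>j\<in>J. of_nat (\<alpha> j) * (\<kappa> j / lam j)) = of_real (\<Sum>j\<in>J. x j)"
    by simp
  moreover obtain i where "i \<in> J" "a i * of_nat (\<alpha> i) / lam i \<noteq> 0"
    using nondeg by (meson sum.neutral)
  then have "(\<Sum>j\<in>J. x j) > 0"
    using finJ lam by (intro sum_pos2[of J i]) (auto simp: x_def)
  ultimately show ?thesis by (simp only: of_real_eq_0_iff)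
qed

text \<open>
  Summing the equations with weights \<open>\<alpha>\<^sub>j / \<lambda>\<^sub>j\<close> leaves \<open>(s - k) \<Lambda> \<Sum> \<alpha>\<^sub>j b\<^sub>j\<close>, so the only obstruction
  occurs for \<open>s = k\<close>, and \<open>\<nu>\<close> removes it.
\<close>

lemma linear_system:
  assumes s: "1 \<le> s"
  obtains b \<nu> where "s = k \<or> \<nu> = 0"
    and "\<And>j. j \<in> J \<Longrightarrow> e j + (b j * lam j * of_nat s * \<Lambda>
        - of_nat k * a j * (\<Sum>i\<in>J. of_nat (\<alpha> i) * b i) - \<nu> * \<kappa> j) = 0"
proof -
  define K where "K = (\<Sum>j\<in>J. of_nat (\<alpha> j) * (\<kappa> j / lam j))"
  define S where "S = (\<Sum>j\<in>J. of_nat (\<alpha> j) * (e j / lam j))"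
  define \<nu> where "\<nu> = (if s = k then S / K else 0)"
  \<comment> \<open>\<open>T\<close> is the value that the coupling sum
    \<open>\<Sum> \<alpha>_i b_i\<close> has to take. Once it is prescribed, the equations decouple
    and determine \<open>b\<close>; the computation below checks consistency. For
    \<open>s = k\<close> the factor \<open>s - k\<close> vanishes and any value would do.\<close>
  define T where "T = (if s = k then 0 else - S / ((of_nat s - of_nat k) * \<Lambda>))"
  define b where "b j = (of_nat k * a j * T + \<nu> * \<kappa> j - e j) / (lam j * of_nat s * \<Lambda>)" for j
  have "(\<Sum>i\<in>J. of_nat (\<alpha> i) * b i)
      = (\<Sum>i\<in>J. of_nat k * T * (of_nat (\<alpha> i) * (a i / lam i)) + \<nu> * (of_nat (\<alpha> i) * (\<kappa> i / lam i))
          - of_nat (\<alpha> i) * (e i / lam i)) / (of_nat s * \<Lambda>)"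
    unfolding sum_divide_distrib
    using lam s \<Lambda>_nz by (intro sum.cong) (auto simp: b_def divide_simps algebra_simps)
  also have "\<dots> = (of_nat k * T * \<Lambda> + \<nu> * K - S) / (of_nat s * \<Lambda>)"
    by (simp add: sum.distrib sum_subtractf sum_distrib_left \<Lambda>_def K_def S_def)
  also have "\<dots> = T"
  proof (cases "s = k")
    case True
    then show ?thesis using sum_\<alpha>_\<kappa>_nz by (simp add: \<nu>_def T_def K_def)
  next
    case False
    then have "S = - T * ((of_nat s - of_nat k) * \<Lambda>)"
      by (simp add: T_def \<Lambda>_nz)
    then show ?thesis using False s \<Lambda>_nz by (simp add: \<nu>_def field_simps)
  qed
  finally have "(\<Sum>i\<in>J. of_nat (\<alpha> i) * b i) = T" .
  then show ?thesis
    using s \<Lambda>_nz lam by (intro that[of \<nu> b]) (auto simp: \<nu>_def b_def)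
qed

lemma err_step:
  assumes s: "1 \<le> s" and \<psi>0: "\<And>i. i \<in> J \<Longrightarrow> fps_nth (\<psi> i) 0 = 1"
    and err: "\<And>j. j \<in> J \<Longrightarrow> fps_X ^ (k + s) dvd err \<psi> \<mu> j"
  obtains \<psi>' \<mu>' where "\<And>i. i \<in> J \<Longrightarrow> fps_nth (\<psi>' i) 0 = 1"
    and "\<And>j. j \<in> J \<Longrightarrow> fps_X ^ Suc (k + s) dvd err \<psi>' \<mu>' j"
    and "\<And>i. fps_eqm s (\<psi>' i) (\<psi> i)" and "s \<noteq> k \<Longrightarrow> \<mu>' = \<mu>"
proof -
  obtain b \<nu> where \<nu>: "s = k \<or> \<nu> = 0"
    and b: "\<And>j. j \<in> J \<Longrightarrow> fps_nth (err \<psi> \<mu> j) (k + s) + (b j * lam j * of_nat s * \<Lambda>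
        - of_nat k * a j * (\<Sum>i\<in>J. of_nat (\<alpha> i) * b i) - \<nu> * \<kappa> j) = 0"
    using linear_system[OF s, of "\<lambda>j. fps_nth (err \<psi> \<mu> j) (k + s)"] by blast
  define \<psi>' where "\<psi>' = (\<lambda>i. \<psi> i + fps_const (b i) * fps_X ^ s)"
  show ?thesis
  proof
    show "fps_nth (\<psi>' i) 0 = 1" if "i \<in> J" for i
      using \<psi>0[OF that] s by (simp add: \<psi>'_def)
    show "fps_eqm s (\<psi>' i) (\<psi> i)" for i
      by (simp add: \<psi>'_def)
    show "s \<noteq> k \<Longrightarrow> \<mu> + \<nu> = \<mu>"
      using \<nu> by simp
    fix j assume j: "j \<in> J"
    let ?c = "b j * lam j * of_nat s * \<Lambda>
        - of_nat k * a j * (\<Sum>i\<in>J. of_nat (\<alpha> i) * b i) - \<nu> * \<kappa> j"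
    have "fps_X ^ Suc (k + s) dvd err \<psi> \<mu> j + fps_const ?c * fps_X ^ (k + s)"
      unfolding fps_X_power_dvd_iff
    proof safe
      fix i assume "i < Suc (k + s)"
      then consider "i < k + s" | "i = k + s" by linarith
      then show "fps_nth (err \<psi> \<mu> j + fps_const ?c * fps_X ^ (k + s)) i = 0"
      proof cases
        case 1
        then show ?thesis using err[OF j] by (simp add: fps_X_power_dvd_iff)
      next
        case 2
        then show ?thesis using b[OF j] by (simp only: fps_add_nth fps_mult_left_const_nth fps_X_power_nth) simp
      qed
    qed
    moreover have "fps_eqm (Suc (k + s)) (err \<psi>' (\<mu> + \<nu>) j)
        (err \<psi> \<mu> j + fps_const ?c * fps_X ^ (k + s))"
      by (rule err_update[OF j s \<nu> _ \<psi>'_def]) (rule \<psi>0)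
    ultimately show "fps_X ^ Suc (k + s) dvd err \<psi>' (\<mu> + \<nu>) j"
      by (rule fps_eqm_dvd[rotated])
  qed
qed

text \<open>Continuity of the error in \<open>\<psi>\<close> without loss of precision, for the
  passage to the limit.\<close>

lemma err_cong:
  assumes j: "j \<in> J" and "\<And>i. i \<in> J \<Longrightarrow> fps_eqm n (\<psi> i) (\<psi>' i)"
  shows "fps_eqm n (err \<psi> \<mu> j) (err \<psi>' \<mu> j)"
proof -
  have \<rho>: "fps_eqm n (\<rho> \<psi>) (\<rho> \<psi>')"
    unfolding \<rho>_def by (intro fps_eqm_prod fps_eqm_power assms(2))
  have "fps_eqm n (fps_X * \<rho> \<psi>) (fps_X * \<rho> \<psi>')"
    by (rule fps_eqm_mult[OF _ \<rho>]) simp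
  then have "fps_eqm n (nf \<psi> \<mu> j) (nf \<psi>' \<mu> j)"
    unfolding nf_def by (intro fps_eqm_add fps_eqm_mult[OF _ fps_eqm_power]) simp_all
  moreover have "fps_eqm n (fps_compose (\<psi> j) \<theta>) (fps_compose (\<psi>' j) \<theta>)"
    by (rule fps_eqm_compose[OF assms(2)[OF j] \<theta>_0])
  ultimately show ?thesis
    unfolding err_def
    by (intro fps_eqm_diff[OF fps_eqm_mult[OF _ _] fps_eqm_mult[OF assms(2)[OF j]]]) simp_all
qed

theorem conjugation_exists:
  obtains \<psi> \<mu> where "\<And>j. j \<in> J \<Longrightarrow> fps_nth (\<psi> j) 0 = 1" and "\<And>j. j \<in> J \<Longrightarrow> err \<psi> \<mu> j = 0"
proof -
  define Q where "Q n x \<longleftrightarrow> (\<forall>j\<in>J. fps_nth (fst x j) 0 = 1) \<and>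
      (\<forall>j\<in>J. fps_X ^ (k + Suc n) dvd err (fst x) (snd x) j)" for n x
  \<comment> \<open>With \<open>\<psi> = 1\<close> and \<open>\<mu> = 0\<close> the normal form is
    \<open>\<lambda>_j + a_j X^k\<close>, so the hypothesis on \<open>g\<close> is exactly the
    required initial precision.\<close>
  have "\<exists>x. Q 0 x"
  proof
    have "fps_X ^ Suc k dvd err (\<lambda>_. 1) 0 j" if "j \<in> J" for j
      using g[OF that] by (simp add: err_def nf_def \<rho>_def)
    then show "Q 0 (\<lambda>_. 1, 0)" by (simp add: Q_def)
  qed
  moreover have "\<exists>y. Q (Suc n) y \<and> ((\<forall>i. fps_eqm (Suc n) (fst y i) (fst x i)) \<and>
      (Suc n \<noteq> k \<longrightarrow> snd y = snd x))" if "Q n x" for n x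
  proof -
    have 0: "fps_nth (fst x j) 0 = 1" and e: "fps_X ^ (k + Suc n) dvd err (fst x) (snd x) j"
      if "j \<in> J" for j
      using \<open>Q n x\<close> that by (auto simp only: Q_def)
    show ?thesis
    proof (rule err_step[of "Suc n" "fst x" "snd x"])
      fix \<psi>' \<mu>'
      assume "\<And>i. i \<in> J \<Longrightarrow> fps_nth (\<psi>' i) 0 = 1"
        "\<And>j. j \<in> J \<Longrightarrow> fps_X ^ Suc (k + Suc n) dvd err \<psi>' \<mu>' j"
        "\<And>i. fps_eqm (Suc n) (\<psi>' i) (fst x i)" "Suc n \<noteq> k \<Longrightarrow> \<mu>' = snd x"
      then show ?thesis
        unfolding Q_def by (intro exI[of _ "(\<psi>', \<mu>')"] conjI ballI allI impI)
          (simp_all only: fst_conv snd_conv add_Suc_right not_False_eq_True simp_thms)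
    qed (use 0 e in auto)
  qed
  ultimately have "\<exists>x. \<forall>n. Q n (x n) \<and> ((\<forall>i. fps_eqm (Suc n) (fst (x (Suc n)) i) (fst (x n) i)) \<and>
      (Suc n \<noteq> k \<longrightarrow> snd (x (Suc n)) = snd (x n)))"
    by (rule dependent_nat_choice)
  then obtain x where x: "\<And>n. Q n (x n)"
      "\<And>n i. fps_eqm (Suc n) (fst (x (Suc n)) i) (fst (x n) i)"
      "\<And>n. Suc n \<noteq> k \<Longrightarrow> snd (x (Suc n)) = snd (x n)"
    by blast
  \<comment> \<open>Only the step that leads to stage \<open>k\<close> may change
    \<open>\<mu>\<close>, so its value at stage \<open>k\<close> is final.\<close>
  have \<mu>: "snd (x (k + n)) = snd (x k)" for n
    by (induction n) (auto simp: x(3))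
  have "\<exists>p. \<forall>n. fps_eqm n p (fst (x n) i)" for i
  proof (rule fps_eqm_limit[of "\<lambda>n. fst (x n) i"])
    show "fps_eqm n (fst (x (Suc n)) i) (fst (x n) i)" for n
      by (rule fps_eqm_mono[OF x(2)]) simp
  qed blast
  then obtain \<psi> where \<psi>: "\<And>i n. fps_eqm n (\<psi> i) (fst (x n) i)"
    by metis
  show ?thesis
  proof
    fix j assume j: "j \<in> J"
    show "fps_nth (\<psi> j) 0 = 1"
      using \<psi>[of 1 j] x(1)[of 1] j by (auto simp: Q_def fps_X_power_dvd_iff[of 1, simplified])
    \<comment> \<open>Stage \<open>k + n\<close> is late enough both for the final
      \<open>\<mu>\<close> and for precision \<open>n\<close>.\<close>
    have "fps_X ^ n dvd err \<psi> (snd (x k)) j" for n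
    proof -
      have "fps_X ^ n dvd err (fst (x (k + n))) (snd (x k)) j"
      proof (rule dvd_trans)
        show "fps_X ^ n dvd (fps_X :: complex fps) ^ (k + Suc (k + n))"
          by (rule le_imp_power_dvd) simp
        show "fps_X ^ (k + Suc (k + n)) dvd err (fst (x (k + n))) (snd (x k)) j"
          using x(1)[of "k + n"] j unfolding Q_def \<mu> by blast
      qed
      moreover have "fps_eqm n (err \<psi> (snd (x k)) j) (err (fst (x (k + n))) (snd (x k)) j)"
        by (rule err_cong[OF j]) (rule fps_eqm_mono[OF \<psi>], simp)
      ultimately show ?thesis by (rule fps_eqm_dvd[rotated])
    qed
    then show "err \<psi> (snd (x k)) j = 0"
      by (auto simp: fps_X_power_dvd_iff fps_eq_iff)
  qed
qed

end


section \<open>Series in one variable evaluated at a series in several variables\<close>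

text \<open>As for \<open>mfps_compose\<close>, the cutoff makes this total and is harmless when
  \<open>U\<close> has no constant term.\<close>

definition mfps_of_fps :: "complex fps \<Rightarrow> (complex, 'n::finite) mfps \<Rightarrow> (complex, 'n) mfps" where
  "mfps_of_fps f U = Abs_mfps (\<lambda>l. \<Sum>p\<le>mdeg l. fps_nth f p * mfps_nth (U ^ p) l)"

lemma mfps_nth_of_fps:
  "mfps_nth (mfps_of_fps f U) l = (\<Sum>p\<le>mdeg l. fps_nth f p * mfps_nth (U ^ p) l)"
  by (simp add: mfps_of_fps_def)

lemma mfps_of_fps_add: "mfps_of_fps (f + g) U = mfps_of_fps f U + mfps_of_fps g U"
  by (rule mfps_eqI) (simp add: mfps_nth_of_fps sum.distrib distrib_right)

lemma mfps_of_fps_ideal: "fps_X ^ d dvd f \<Longrightarrow> mfps_of_fps f U \<in> mfps_ideal d"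
  by (auto simp: mfps_ideal_def mfps_nth_of_fps fps_X_power_dvd_iff)

lemma mfps_of_fps_monom:
  assumes "U \<in> mfps_ideal 1"
  shows "mfps_of_fps (fps_const c * fps_X ^ p) U = mfps_monom c 0 * U ^ p"
proof (rule mfps_eqI)
  fix l
  have "mfps_nth (U ^ p) l = 0" if "\<not> p \<le> mdeg l"
    using mfps_idealD[OF mfps_ideal_power[OF assms]] that by simp
  then show "mfps_nth (mfps_of_fps (fps_const c * fps_X ^ p) U) l = mfps_nth (mfps_monom c 0 * U ^ p) l"
    by (auto simp: mfps_nth_of_fps if_distrib if_distribR cong: if_cong)
qed

lemma mfps_of_fps_const [simp]: "U \<in> mfps_ideal 1 \<Longrightarrow> mfps_of_fps (fps_const c) U = mfps_monom c 0"
  using mfps_of_fps_monom[of U c 0] by simp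

lemma mfps_of_fps_one [simp]: "U \<in> mfps_ideal 1 \<Longrightarrow> mfps_of_fps 1 U = 1"
  using mfps_of_fps_const[of U 1] by (simp add: mfps_monom_one)

lemma mfps_of_fps_X [simp]: "U \<in> mfps_ideal 1 \<Longrightarrow> mfps_of_fps fps_X U = U"
  using mfps_of_fps_monom[of U 1 1] by (simp add: mfps_monom_one)

lemma fps_additive_ext:
  fixes A B :: "complex fps \<Rightarrow> ('b::comm_ring_1, 'm::finite) mfps"
  assumes A: "\<And>f g. A (f + g) = A f + A g" "\<And>f d. fps_X ^ d dvd f \<Longrightarrow> A f \<in> mfps_ideal d"
    and B: "\<And>f g. B (f + g) = B f + B g" "\<And>f d. fps_X ^ d dvd f \<Longrightarrow> B f \<in> mfps_ideal d"
    and monom: "\<And>c p. A (fps_const c * fps_X ^ p) = B (fps_const c * fps_X ^ p)"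
  shows "A f = B f"
proof -
  define C where "C f = A f - B f" for f
  have C: "C (f + g) = C f + C g" for f g
    by (simp add: C_def A B)
  then have C0: "C 0 = 0"
    by (metis add_cancel_right_right)
  have Csum: "C (\<Sum>i\<in>S. h i) = (\<Sum>i\<in>S. C (h i))" for S and h :: "nat \<Rightarrow> _"
    by (induction S rule: infinite_finite_induct) (auto simp: C C0)
  have "C f \<in> mfps_ideal d" for d
  proof -
    define t where "t = (\<Sum>p<d. fps_const (fps_nth f p) * fps_X ^ p)"
    have "C f = C t + C (f - t)"
      by (simp flip: C)
    also have "C t = 0"
      unfolding t_def Csum by (simp add: C_def monom)
    finally have "C f = A (f - t) - B (f - t)"
      by (simp add: C_def)
    moreover have "fps_X ^ d dvd f - t"
      by (simp add: fps_X_power_dvd_iff t_def fps_sum_nth if_distrib cong: if_cong)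
    ultimately show ?thesis
      using A(2)[of d "f - t"] B(2)[of d "f - t"] by (simp add: mfps_ideal_diff)
  qed
  then have "C f = 0" by (rule mfps_ideal_eq_0)
  then show ?thesis by (simp add: C_def)
qed

lemma mfps_of_fps_mult:
  assumes U: "U \<in> mfps_ideal 1"
  shows "mfps_of_fps (f * g) U = mfps_of_fps f U * mfps_of_fps g U"
proof (rule fps_additive_ext[of "\<lambda>f. mfps_of_fps (f * g) U"])
  fix c :: complex and p
  let ?m = "fps_const c * fps_X ^ p"
  show "mfps_of_fps (?m * g) U = mfps_of_fps ?m U * mfps_of_fps g U"
  proof (rule fps_additive_ext[of "\<lambda>g. mfps_of_fps (?m * g) U"])
    fix d q
    have *: "?m * (fps_const d * fps_X ^ q) = fps_const (c * d) * fps_X ^ (p + q)"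
      by (simp add: power_add mult_ac flip: fps_const_mult)
    have **: "mfps_monom (c * d) 0 = mfps_monom c 0 * mfps_monom d 0"
      by (simp add: mfps_monom_mult)
    show "mfps_of_fps (?m * (fps_const d * fps_X ^ q)) U
        = mfps_of_fps ?m U * mfps_of_fps (fps_const d * fps_X ^ q) U"
      unfolding * mfps_of_fps_monom[OF U] ** by (simp add: power_add mult_ac)
  qed (auto simp: distrib_left mfps_of_fps_add intro: mfps_of_fps_ideal mfps_ideal_mult_left)
qed (auto simp: distrib_right mfps_of_fps_add intro: mfps_of_fps_ideal mfps_ideal_mult_right)

lemma mfps_of_fps_power:
  "U \<in> mfps_ideal 1 \<Longrightarrow> mfps_of_fps (f ^ n) U = mfps_of_fps f U ^ n"
  by (induction n) (auto simp: mfps_of_fps_mult)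

lemma mfps_of_fps_prod:
  "U \<in> mfps_ideal 1 \<Longrightarrow> mfps_of_fps (\<Prod>i\<in>A. f i) U = (\<Prod>i\<in>A. mfps_of_fps (f i) U)"
  by (induction A rule: infinite_finite_induct) (auto simp: mfps_of_fps_mult)

lemma mfps_compose_of_fps:
  assumes U: "U \<in> mfps_ideal 1" and P: "\<And>i. P i \<in> mfps_ideal 1"
  shows "mfps_compose (mfps_of_fps f U) P = mfps_of_fps f (mfps_compose U P)"
proof (rule fps_additive_ext[of "\<lambda>f. mfps_compose (mfps_of_fps f U) P"])
  fix c p
  have "mfps_compose U P \<in> mfps_ideal 1"
    by (rule mfps_compose_ideal[OF U])
  then show "mfps_compose (mfps_of_fps (fps_const c * fps_X ^ p) U) P
      = mfps_of_fps (fps_const c * fps_X ^ p) (mfps_compose U P)"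
    by (simp add: mfps_of_fps_monom U mfps_compose_mult P mfps_compose_const mfps_compose_power)
qed (auto simp: mfps_of_fps_add mfps_compose_add intro: mfps_of_fps_ideal mfps_compose_ideal)

lemma mfps_of_fps_compose:
  assumes U: "U \<in> mfps_ideal 1" and \<sigma>: "fps_nth \<sigma> 0 = 0"
  shows "mfps_of_fps (fps_compose f \<sigma>) U = mfps_of_fps f (mfps_of_fps \<sigma> U)"
proof (rule fps_additive_ext[of "\<lambda>f. mfps_of_fps (fps_compose f \<sigma>) U"])
  have *: "fps_X ^ 1 dvd \<sigma>"
    unfolding fps_X_power_dvd_iff using \<sigma> by simp
  have "mfps_of_fps \<sigma> U \<in> mfps_ideal 1"
    by (rule mfps_of_fps_ideal[OF *])
  then show "mfps_of_fps (fps_compose (fps_const c * fps_X ^ p) \<sigma>) U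
      = mfps_of_fps (fps_const c * fps_X ^ p) (mfps_of_fps \<sigma> U)" for c p
    using \<sigma> by (simp add: mfps_of_fps_monom fps_compose_mult_distrib fps_compose_power[symmetric]
        mfps_of_fps_mult U mfps_of_fps_power)
  show "mfps_of_fps (fps_compose f \<sigma>) U \<in> mfps_ideal d" if "fps_X ^ d dvd f" for f d
    using fps_eqm_compose[of d f 0 \<sigma>] that \<sigma> by (intro mfps_of_fps_ideal) simp
qed (auto simp: mfps_of_fps_add fps_compose_add_distrib intro: mfps_of_fps_ideal)


section \<open>Removal of non-resonant terms\<close>

text \<open>In degree \<open>d\<close>, a correction \<open>x\<close> of \<open>\<Phi>\<close>
  changes the defect coefficient at \<open>l\<close> by \<open>(lam^l - lam_j) x_l\<close>, and a
  correction \<open>y\<close> of \<open>H\<close> changes it by \<open>- c^l y_l\<close>. So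
  \<open>x\<close> removes the coefficients with \<open>lam_j \<noteq> lam^l\<close>, and
  \<open>y\<close> absorbs the others.\<close>

lemma normal_form_step:
  fixes lam c :: "complex ^ 'n::finite" and P \<Phi> H :: "'n \<Rightarrow> (complex, 'n) mfps"
  assumes P: "diag_tangent P lam" and \<Phi>: "diag_tangent \<Phi> c" and c: "\<And>i. c $ i \<noteq> 0"
    and H: "\<And>j. j \<in> S \<Longrightarrow> H j - mfps_monom (lam $ j) (axis j 1) \<in> mfps_ideal 2"
    and E: "\<And>j. j \<in> S \<Longrightarrow> mfps_compose (\<Phi> j) P - mfps_compose (H j) \<Phi> \<in> mfps_ideal d"
    and d: "2 \<le> d"
  obtains \<Phi>' H' where "\<And>i. \<Phi>' i - \<Phi> i \<in> mfps_ideal d" "\<And>i. H' i - H i \<in> mfps_ideal d"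
    and "\<And>i. i \<notin> S \<Longrightarrow> \<Phi>' i = \<Phi> i"
    and "\<And>j. j \<in> S \<Longrightarrow> mfps_compose (\<Phi>' j) P - mfps_compose (H' j) \<Phi>' \<in> mfps_ideal (Suc d)"
    and "\<And>j l. j \<in> S \<Longrightarrow> mfps_nth (H' j) l \<noteq> mfps_nth (H j) l \<Longrightarrow> lam $ j = mpow lam l"
proof -
  define E where "E j = mfps_compose (\<Phi> j) P - mfps_compose (H j) \<Phi>" for j
  define x where "x j = Abs_mfps (\<lambda>l. if mdeg l = d \<and> j \<in> S \<and> lam $ j \<noteq> mpow lam l
    then mfps_nth (E j) l / (lam $ j - mpow lam l) else 0)" for j
  define y where "y j = Abs_mfps (\<lambda>l. if mdeg l = d \<and> lam $ j = mpow lam l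
    then mfps_nth (E j) l / mpow c l else 0)" for j
  define \<Phi>' where "\<Phi>' j = \<Phi> j + x j" for j
  define H' where "H' j = H j + y j" for j
  have x: "x j \<in> mfps_ideal d" and y: "y j \<in> mfps_ideal d" for j
    by (auto simp: x_def y_def mfps_ideal_def)
  have \<Phi>': "diag_tangent \<Phi>' c"
    unfolding diag_tangent_def
  proof
    fix i
    have "(\<Phi> i - mfps_monom (c $ i) (axis i 1)) + x i \<in> mfps_ideal 2"
      using \<Phi> mfps_ideal_mono[OF x d] by (auto simp: diag_tangent_def intro: mfps_ideal_add)
    then show "\<Phi>' i - mfps_monom (c $ i) (axis i 1) \<in> mfps_ideal 2"
      by (simp add: \<Phi>'_def algebra_simps)
  qed
  note I1 = diag_tangent_ideal[OF \<Phi>] diag_tangent_ideal[OF \<Phi>']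
  show ?thesis
  proof
    show "\<Phi>' i - \<Phi> i \<in> mfps_ideal d" "H' i - H i \<in> mfps_ideal d" for i
      by (simp_all add: \<Phi>'_def H'_def x y)
    show "\<Phi>' i = \<Phi> i" if "i \<notin> S" for i
      using that by (simp add: \<Phi>'_def x_def zero_mfps_def[symmetric])
    show "lam $ j = mpow lam l" if "mfps_nth (H' j) l \<noteq> mfps_nth (H j) l" for j l
      using that by (auto simp: H'_def y_def split: if_splits)
    fix j assume j: "j \<in> S"
    define r where "r = H j - mfps_monom (lam $ j) (axis j 1)"
    have "mfps_compose (H j) \<Phi>' - mfps_compose (H j) \<Phi> = mfps_monom (lam $ j) 0 * x j
        + (mfps_compose r \<Phi>' - mfps_compose r \<Phi>)"
      unfolding r_def mfps_compose_diff mfps_compose_axis[OF I1(1)] mfps_compose_axis[OF I1(2)]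
      by (simp add: \<Phi>'_def[of j] algebra_simps)
    then have expand: "mfps_compose (\<Phi>' j) P - mfps_compose (H' j) \<Phi>' =
        E j + mfps_compose (x j) P - mfps_monom (lam $ j) 0 * x j - mfps_compose (y j) \<Phi>'
        - (mfps_compose r \<Phi>' - mfps_compose r \<Phi>)"
      by (simp add: E_def H'_def \<Phi>'_def[of j] mfps_compose_add algebra_simps)
    \<comment> \<open>The nonlinear part \<open>r\<close> has order \<open>2 = Suc 1\<close> and the
      correction has order \<open>d = Suc (d - 1)\<close>, so \<open>r\<close> does not react to it
      in degree \<open>d\<close>.\<close>
    have "mfps_compose r \<Phi>' - mfps_compose r \<Phi> \<in> mfps_ideal (Suc ((d - 1) + 1))"
      using H[OF j] d I1 x
      by (intro mfps_compose_diff_right) (auto simp: r_def \<Phi>'_def numeral_2_eq_2 One_nat_def)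
    then have r: "mfps_compose r \<Phi>' - mfps_compose r \<Phi> \<in> mfps_ideal (Suc d)"
      using d by simp
    have Ej: "E j \<in> mfps_ideal d" using E[OF j] by (simp add: E_def)
    show "mfps_compose (\<Phi>' j) P - mfps_compose (H' j) \<Phi>' \<in> mfps_ideal (Suc d)"
      unfolding mfps_ideal_def
    proof safe
      fix l :: "nat ^ 'n"
      assume "mdeg l < Suc d"
      then have l: "mfps_nth (mfps_compose r \<Phi>' - mfps_compose r \<Phi>) l = 0" "mdeg l < d \<or> mdeg l = d"
        using mfps_idealD[OF r] by auto
      from l(2) show "mfps_nth (mfps_compose (\<Phi>' j) P - mfps_compose (H' j) \<Phi>') l = 0"
      proof
        assume "mdeg l < d"
        then show ?thesis
          using l(1) mfps_idealD[OF Ej] mfps_idealD[OF x] mfps_idealD[OF mfps_compose_ideal[OF x]]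
            mfps_idealD[OF mfps_compose_ideal[OF y]]
          unfolding expand by simp
      next
        assume deg: "mdeg l = d"
        have "mfps_nth (mfps_compose (x j) P) l = mfps_nth (x j) l * mpow lam l"
          "mfps_nth (mfps_compose (y j) \<Phi>') l = mfps_nth (y j) l * mpow c l"
          using mfps_nth_compose_diag[OF P] mfps_nth_compose_diag[OF \<Phi>'] x y by (simp_all add: deg)
        moreover have "mpow c l \<noteq> 0" using c by (simp add: mpow_eq_0_iff)
        ultimately show ?thesis
          using l(1) j deg unfolding expand by (auto simp: x_def y_def field_simps)
      qed
    qed
  qed
qed

text \<open>Because the iteration starts at an arbitrary precision \<open>D\<close>, terms of
  \<open>H\<^sub>0\<close> below degree \<open>D\<close> survive. It serves twice: for the
  distinguished components with a prescribed nonlinear term, and for the others from their linear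
  part.\<close>

theorem formal_normal_form:
  fixes lam c :: "complex ^ 'n::finite" and P \<Phi>\<^sub>0 H\<^sub>0 :: "'n \<Rightarrow> (complex, 'n) mfps"
  assumes P: "diag_tangent P lam" and \<Phi>0: "diag_tangent \<Phi>\<^sub>0 c" and c: "\<And>i. c $ i \<noteq> 0"
    and H0: "\<And>j. j \<in> S \<Longrightarrow> H\<^sub>0 j - mfps_monom (lam $ j) (axis j 1) \<in> mfps_ideal 2"
    and E0: "\<And>j. j \<in> S \<Longrightarrow> mfps_compose (\<Phi>\<^sub>0 j) P - mfps_compose (H\<^sub>0 j) \<Phi>\<^sub>0 \<in> mfps_ideal D"
    and D: "2 \<le> D"
  obtains \<Phi> H where "diag_tangent \<Phi> c" "\<And>j. j \<in> S \<Longrightarrow> H j - H\<^sub>0 j \<in> mfps_ideal D"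
    and "\<And>i. i \<notin> S \<Longrightarrow> \<Phi> i = \<Phi>\<^sub>0 i"
    and "\<And>j. j \<in> S \<Longrightarrow> mfps_compose (\<Phi> j) P = mfps_compose (H j) \<Phi>"
    and "\<And>j l. j \<in> S \<Longrightarrow> mfps_nth (H j) l \<noteq> mfps_nth (H\<^sub>0 j) l \<Longrightarrow> lam $ j = mpow lam l"
proof -
  define Q where "Q n z \<longleftrightarrow> (case z of (\<Phi>, H) \<Rightarrow>
      (\<forall>i. \<Phi> i - \<Phi>\<^sub>0 i \<in> mfps_ideal D) \<and> (\<forall>i. H i - H\<^sub>0 i \<in> mfps_ideal D) \<and>
      (\<forall>i. i \<notin> S \<longrightarrow> \<Phi> i = \<Phi>\<^sub>0 i) \<and>
      (\<forall>j\<in>S. mfps_compose (\<Phi> j) P - mfps_compose (H j) \<Phi> \<in> mfps_ideal (D + n)) \<and>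
      (\<forall>j\<in>S. \<forall>l. mfps_nth (H j) l \<noteq> mfps_nth (H\<^sub>0 j) l \<longrightarrow> lam $ j = mpow lam l))" for n z
  define R where "R n z w \<longleftrightarrow> (\<forall>i. fst w i - fst z i \<in> mfps_ideal (D + n)) \<and>
      (\<forall>i. snd w i - snd z i \<in> mfps_ideal (D + n))"
    for n and z w :: "('n \<Rightarrow> (complex, 'n) mfps) \<times> ('n \<Rightarrow> (complex, 'n) mfps)"
  have tangent: "diag_tangent \<Phi> c" if "\<And>i. \<Phi> i - \<Phi>\<^sub>0 i \<in> mfps_ideal D" for \<Phi>
    unfolding diag_tangent_def
  proof
    fix i
    show "\<Phi> i - mfps_monom (c $ i) (axis i 1) \<in> mfps_ideal 2"
      by (rule mfps_ideal_diff_trans[OF mfps_ideal_mono[OF that D]])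
        (use \<Phi>0 in \<open>simp add: diag_tangent_def\<close>)
  qed
  have "\<exists>z. Q 0 z"
    by (rule exI[of _ "(\<Phi>\<^sub>0, H\<^sub>0)"]) (auto simp: Q_def E0)
  moreover have "\<exists>w. Q (Suc n) w \<and> R n z w" if "Q n z" for n z
  proof -
    obtain \<Phi> H where z: "z = (\<Phi>, H)" by (cases z)
    have Q: "\<And>i. \<Phi> i - \<Phi>\<^sub>0 i \<in> mfps_ideal D" "\<And>i. H i - H\<^sub>0 i \<in> mfps_ideal D"
      "\<And>i. i \<notin> S \<Longrightarrow> \<Phi> i = \<Phi>\<^sub>0 i"
      "\<And>j. j \<in> S \<Longrightarrow> mfps_compose (\<Phi> j) P - mfps_compose (H j) \<Phi> \<in> mfps_ideal (D + n)"
      "\<And>j l. j \<in> S \<Longrightarrow> mfps_nth (H j) l \<noteq> mfps_nth (H\<^sub>0 j) l \<Longrightarrow> lam $ j = mpow lam l"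
      using that unfolding Q_def z by auto
    have H: "H j - mfps_monom (lam $ j) (axis j 1) \<in> mfps_ideal 2" if "j \<in> S" for j
      by (rule mfps_ideal_diff_trans[OF mfps_ideal_mono[OF Q(2) D] H0[OF that]])
    from D have "2 \<le> D + n" by simp
    from normal_form_step[OF P tangent[OF Q(1)] c H Q(4) this]
    obtain \<Phi>' H' where *: "\<And>i. \<Phi>' i - \<Phi> i \<in> mfps_ideal (D + n)"
      "\<And>i. H' i - H i \<in> mfps_ideal (D + n)" "\<And>i. i \<notin> S \<Longrightarrow> \<Phi>' i = \<Phi> i"
      "\<And>j. j \<in> S \<Longrightarrow> mfps_compose (\<Phi>' j) P - mfps_compose (H' j) \<Phi>' \<in> mfps_ideal (Suc (D + n))"
      "\<And>j l. j \<in> S \<Longrightarrow> mfps_nth (H' j) l \<noteq> mfps_nth (H j) l \<Longrightarrow> lam $ j = mpow lam l"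
      by blast
    have "\<Phi>' i - \<Phi>\<^sub>0 i \<in> mfps_ideal D" for i
      by (rule mfps_ideal_diff_trans[OF mfps_ideal_mono[OF *(1)] Q(1)]) simp
    moreover have "H' i - H\<^sub>0 i \<in> mfps_ideal D" for i
      by (rule mfps_ideal_diff_trans[OF mfps_ideal_mono[OF *(2)] Q(2)]) simp
    moreover have "lam $ j = mpow lam l" if "j \<in> S" "mfps_nth (H' j) l \<noteq> mfps_nth (H\<^sub>0 j) l" for j l
      using *(5)[of j l] Q(5)[of j l] that by metis
    ultimately have "Q (Suc n) (\<Phi>', H')"
      using *(3,4) Q(3) by (simp add: Q_def)
    moreover have "R n z (\<Phi>', H')" using *(1,2) by (simp add: R_def z)
    ultimately show ?thesis by blast
  qed
  ultimately obtain z where z: "\<And>n. Q n (z n)" "\<And>n. R n (z n) (z (Suc n))"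
    using dependent_nat_choice[of Q R] by metis
  have "\<exists>g. \<forall>n. g - fst (z n) i \<in> mfps_ideal (D + n)" for i
    using mfps_limit[of "\<lambda>n. fst (z n) i" D] z(2) unfolding R_def by metis
  then obtain \<Phi> where \<Phi>: "\<And>i n. \<Phi> i - fst (z n) i \<in> mfps_ideal (D + n)" by metis
  have "\<exists>g. \<forall>n. g - snd (z n) i \<in> mfps_ideal (D + n)" for i
    using mfps_limit[of "\<lambda>n. snd (z n) i" D] z(2) unfolding R_def by metis
  then obtain H where H: "\<And>i n. H i - snd (z n) i \<in> mfps_ideal (D + n)" by metis
  have Q: "\<And>i. fst (z n) i - \<Phi>\<^sub>0 i \<in> mfps_ideal D" "\<And>i. snd (z n) i - H\<^sub>0 i \<in> mfps_ideal D"
    "\<And>i. i \<notin> S \<Longrightarrow> fst (z n) i = \<Phi>\<^sub>0 i"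
    "\<And>j. j \<in> S \<Longrightarrow> mfps_compose (fst (z n) j) P - mfps_compose (snd (z n) j) (fst (z n))
        \<in> mfps_ideal (D + n)"
    "\<And>j l. j \<in> S \<Longrightarrow> mfps_nth (snd (z n) j) l \<noteq> mfps_nth (H\<^sub>0 j) l \<Longrightarrow> lam $ j = mpow lam l" for n
    using z(1)[of n] unfolding Q_def by (auto split: prod.splits)
  have \<Phi>_D: "\<Phi> i - \<Phi>\<^sub>0 i \<in> mfps_ideal D" for i
    using mfps_ideal_diff_trans[OF _ Q(1)[of 0 i]] \<Phi>[of i 0] by simp
  have H_D: "H i - H\<^sub>0 i \<in> mfps_ideal D" for i
    using mfps_ideal_diff_trans[OF _ Q(2)[of 0 i]] H[of i 0] by simp
  have I1: "\<Phi> i \<in> mfps_ideal 1" "fst (z n) i \<in> mfps_ideal 1" for i n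
    by (rule diag_tangent_ideal[OF tangent[OF \<Phi>_D]])
      (rule diag_tangent_ideal[of "fst (z n)", OF tangent[OF Q(1)]])
  show ?thesis
  proof
    show "diag_tangent \<Phi> c" by (rule tangent[OF \<Phi>_D])
    show "H j - H\<^sub>0 j \<in> mfps_ideal D" for j by (rule H_D)
    show "\<Phi> i = \<Phi>\<^sub>0 i" if "i \<notin> S" for i
    proof -
      have "\<Phi> i - \<Phi>\<^sub>0 i \<in> mfps_ideal n" for n
        using \<Phi>[of i n] Q(3)[OF that, of n] mfps_ideal_mono[of _ "D + n" n] by simp
      then have "\<Phi> i - \<Phi>\<^sub>0 i = 0" by (rule mfps_ideal_eq_0)
      then show ?thesis by simp
    qed
    show "lam $ j = mpow lam l" if "j \<in> S" "mfps_nth (H j) l \<noteq> mfps_nth (H\<^sub>0 j) l" for j l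
    proof -
      \<comment> \<open>Each coefficient of the limit already occurs at a finite stage, so the
        resonance condition is inherited.\<close>
      have "mfps_nth (H j) l = mfps_nth (snd (z (Suc (mdeg l))) j) l"
        using mfps_idealD[OF H[of j "Suc (mdeg l)"], of l] by simp
      then show ?thesis using Q(5)[OF that(1)] that(2) by metis
    qed
    fix j assume j: "j \<in> S"
    have HI: "H j \<in> mfps_ideal 1"
    proof -
      have "H j - mfps_monom (lam $ j) (axis j 1) \<in> mfps_ideal 2"
        by (rule mfps_ideal_diff_trans[OF mfps_ideal_mono[OF H_D D] H0[OF j]])
      from mfps_ideal_add[OF mfps_ideal_mono[OF this, of 1]
          mfps_monom_in_ideal[of 1 "axis j 1" "lam $ j"]]
      show ?thesis by simp
    qed
    have "mfps_compose (\<Phi> j) P - mfps_compose (H j) \<Phi> \<in> mfps_ideal n" for n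
    proof -
      obtain e where e: "D + n = Suc e" using D by (cases "D + n") auto
      let ?\<Phi> = "fst (z n)" and ?H = "snd (z n)"
      have 1: "mfps_compose (\<Phi> j) P - mfps_compose (?\<Phi> j) P \<in> mfps_ideal (D + n)"
        using mfps_compose_ideal[OF \<Phi>] by (simp flip: mfps_compose_diff)
      have 2: "mfps_compose (H j) \<Phi> - mfps_compose (?H j) ?\<Phi> \<in> mfps_ideal (D + n)"
        unfolding e using H[of j n] \<Phi>[of _ n] I1 HI unfolding e by (intro mfps_compose_cong)
      have "mfps_compose (\<Phi> j) P - mfps_compose (H j) \<Phi> \<in> mfps_ideal (D + n)"
        using mfps_ideal_diff[OF mfps_ideal_add[OF 1 Q(4)[OF j, of n]] 2] by (simp add: algebra_simps)
      then show ?thesis by (rule mfps_ideal_mono) simp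
    qed
    then have "mfps_compose (\<Phi> j) P - mfps_compose (H j) \<Phi> = 0" by (rule mfps_ideal_eq_0)
    then show "mfps_compose (\<Phi> j) P = mfps_compose (H j) \<Phi>" by simp
  qed
qed


section \<open>Asymptotic expansions of holomorphic germs\<close>

text \<open>The bound includes the origin itself, so for \<open>d > 0\<close> it forces
  \<open>f 0 = 0\<close>. Substituting a germ that may take the value 0 then requires no case
  distinction.\<close>

definition is_O :: "(complex ^ 'n \<Rightarrow> complex) \<Rightarrow> nat \<Rightarrow> bool" where
  "is_O f d \<longleftrightarrow> (\<exists>C\<ge>0. \<forall>\<^sub>F z in nhds 0. norm (f z) \<le> C * norm z ^ d)"

definition is_o :: "(complex ^ 'n \<Rightarrow> complex) \<Rightarrow> nat \<Rightarrow> bool" where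
  "is_o f d \<longleftrightarrow> (\<forall>\<epsilon>>0. \<forall>\<^sub>F z in nhds 0. norm (f z) \<le> \<epsilon> * norm z ^ d)"

lemma is_OI: "(\<forall>\<^sub>F z in nhds 0. norm (f z) \<le> C * norm z ^ d) \<Longrightarrow> is_O f d"
  unfolding is_O_def
proof (intro exI conjI)
  assume "\<forall>\<^sub>F z in nhds 0. norm (f z) \<le> C * norm z ^ d"
  then show "\<forall>\<^sub>F z in nhds 0. norm (f z) \<le> max C 0 * norm z ^ d"
    by (rule eventually_mono) (auto elim!: order_trans intro!: mult_right_mono)
qed simp

lemma eventually_norm_le:
  assumes "0 < r"
  shows "\<forall>\<^sub>F z :: complex ^ 'n in nhds 0. norm z \<le> r"
  using eventually_nhds_ball[OF assms, of "0 :: complex ^ 'n"] by eventually_elim simp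

lemma is_O_zero [simp]: "is_O (\<lambda>_. 0) d"
  by (rule is_OI[of _ 0]) simp

lemma is_O_add:
  assumes "is_O f d" "is_O g d"
  shows "is_O (\<lambda>z. f z + g z) d"
proof -
  obtain C C' where "\<forall>\<^sub>F z in nhds 0. norm (f z) \<le> C * norm z ^ d"
    "\<forall>\<^sub>F z in nhds 0. norm (g z) \<le> C' * norm z ^ d"
    using assms by (auto simp: is_O_def)
  then have "\<forall>\<^sub>F z in nhds 0. norm (f z + g z) \<le> (C + C') * norm z ^ d"
    by eventually_elim (auto simp: distrib_right intro: norm_triangle_le)
  then show ?thesis by (rule is_OI)
qed

lemma is_O_uminus: "is_O f d \<Longrightarrow> is_O (\<lambda>z. - f z) d"
  by (simp add: is_O_def)

lemma is_O_diff: "is_O f d \<Longrightarrow> is_O g d \<Longrightarrow> is_O (\<lambda>z. f z - g z) d"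
  using is_O_add[OF _ is_O_uminus, of f d g] by simp

lemma is_O_sum: "(\<And>i. i \<in> A \<Longrightarrow> is_O (f i) d) \<Longrightarrow> is_O (\<lambda>z. \<Sum>i\<in>A. f i z) d"
  by (induction A rule: infinite_finite_induct) (auto intro: is_O_add)

lemma is_O_mult:
  assumes "is_O f d" "is_O g e"
  shows "is_O (\<lambda>z. f z * g z) (d + e)"
proof -
  obtain C C' where "0 \<le> C" "\<forall>\<^sub>F z in nhds 0. norm (f z) \<le> C * norm z ^ d"
    "\<forall>\<^sub>F z in nhds 0. norm (g z) \<le> C' * norm z ^ e"
    using assms by (auto simp: is_O_def)
  from this(2,3) have "\<forall>\<^sub>F z in nhds 0. norm (f z * g z) \<le> (C * C') * norm z ^ (d + e)"
  proof eventually_elim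
    case (elim z)
    have "norm (f z * g z) \<le> (C * norm z ^ d) * (C' * norm z ^ e)"
      unfolding norm_mult using elim \<open>0 \<le> C\<close> by (intro mult_mono) auto
    then show ?case by (simp add: power_add mult_ac)
  qed
  then show ?thesis by (rule is_OI)
qed

lemma is_O_mono:
  assumes "is_O f e" "d \<le> e"
  shows "is_O f d"
proof -
  obtain C where "0 \<le> C" "\<forall>\<^sub>F z in nhds 0. norm (f z) \<le> C * norm z ^ e"
    using assms by (auto simp: is_O_def)
  from this(2) eventually_norm_le[of 1, simplified]
  have "\<forall>\<^sub>F z in nhds 0. norm (f z) \<le> C * norm z ^ d"
  proof eventually_elim
    case (elim z)
    have "C * norm z ^ e \<le> C * norm z ^ d"
      using elim \<open>0 \<le> C\<close> assms(2) by (intro mult_left_mono power_decreasing) auto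
    then show ?case using elim by simp
  qed
  then show ?thesis by (rule is_OI)
qed

lemma is_O_cong: "\<forall>\<^sub>F z in nhds 0. f z = g z \<Longrightarrow> is_O f d \<longleftrightarrow> is_O g d"
  unfolding is_O_def by (intro ex_cong1 conj_cong refl eventually_cong) (auto elim: eventually_mono)

lemma is_O_imp_is_o:
  fixes f :: "complex ^ 'n \<Rightarrow> complex"
  assumes "is_O f (Suc d)"
  shows "is_o f d"
  unfolding is_o_def
proof safe
  fix \<epsilon> :: real
  assume \<epsilon>: "0 < \<epsilon>"
  obtain C where "0 \<le> C" and C: "\<forall>\<^sub>F z in nhds 0. norm (f z) \<le> C * norm z ^ Suc d"
    using assms by (auto simp: is_O_def)
  have "\<forall>\<^sub>F z :: complex ^ 'n in nhds 0. norm z \<le> \<epsilon> / (C + 1)"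
    using \<epsilon> \<open>0 \<le> C\<close> by (intro eventually_norm_le) auto
  with C show "\<forall>\<^sub>F z in nhds 0. norm (f z) \<le> \<epsilon> * norm z ^ d"
  proof eventually_elim
    case (elim z)
    have "C * norm z \<le> (C + 1) * norm z" by (simp add: distrib_right)
    also have "\<dots> \<le> \<epsilon>" using elim \<open>0 \<le> C\<close> by (simp add: field_simps)
    finally have "C * norm z * norm z ^ d \<le> \<epsilon> * norm z ^ d"
      by (rule mult_right_mono) simp
    then show ?case using elim by (simp add: mult_ac)
  qed
qed

lemma is_o_add:
  assumes "is_o f d" "is_o g d"
  shows "is_o (\<lambda>z. f z + g z) d"
  unfolding is_o_def
proof safe
  fix \<epsilon> :: real
  assume "0 < \<epsilon>"
  then have "\<forall>\<^sub>F z in nhds 0. norm (f z) \<le> (\<epsilon> / 2) * norm z ^ d"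
    "\<forall>\<^sub>F z in nhds 0. norm (g z) \<le> (\<epsilon> / 2) * norm z ^ d"
    using assms unfolding is_o_def by (metis half_gt_zero)+
  then show "\<forall>\<^sub>F z in nhds 0. norm (f z + g z) \<le> \<epsilon> * norm z ^ d"
    by eventually_elim (auto intro: norm_triangle_le)
qed

lemma is_o_diff_is_O:
  assumes "is_o f d" "is_O g (Suc d)"
  shows "is_o (\<lambda>z. f z - g z) d"
  using is_o_add[OF assms(1) is_O_imp_is_o[OF is_O_uminus[OF assms(2)]]] by simp

lemma is_o_mono:
  assumes "is_o f e" "d \<le> e"
  shows "is_o f d"
  unfolding is_o_def
proof safe
  fix \<epsilon> :: real
  assume \<epsilon>: "0 < \<epsilon>"
  then have "\<forall>\<^sub>F z in nhds 0. norm (f z) \<le> \<epsilon> * norm z ^ e"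
    using assms by (simp add: is_o_def)
  with eventually_norm_le[of 1, simplified]
  show "\<forall>\<^sub>F z in nhds 0. norm (f z) \<le> \<epsilon> * norm z ^ d"
  proof eventually_elim
    case (elim z)
    have "\<epsilon> * norm z ^ e \<le> \<epsilon> * norm z ^ d"
      using elim \<epsilon> assms(2) by (intro mult_left_mono power_decreasing) auto
    then show ?case using elim by simp
  qed
qed

lemma norm_mpow_le: "norm (mpow z l) \<le> norm z ^ mdeg l"
proof -
  have "norm (mpow z l) = (\<Prod>j\<in>UNIV. norm (z $ j) ^ (l $ j))"
    by (simp add: mpow_def norm_power flip: prod_norm)
  also have "\<dots> \<le> (\<Prod>j\<in>UNIV. norm z ^ (l $ j))"
    by (intro prod_mono conjI power_mono Finite_Cartesian_Product.norm_nth_le) auto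
  finally show ?thesis by (simp add: mdeg_def power_sum)
qed

lemma is_O_monom: "is_O (\<lambda>z. c * mpow z l) (mdeg l)"
  by (rule is_OI[of _ "norm c"], rule always_eventually)
    (auto simp: norm_mult intro: mult_left_mono norm_mpow_le)

section \<open>Taylor expansions of finite order\<close>

definition mfps_poly :: "nat \<Rightarrow> (complex, 'n) mfps \<Rightarrow> complex ^ 'n \<Rightarrow> complex" where
  "mfps_poly d p z = (\<Sum>l | mdeg l \<le> d. mfps_nth p l * mpow z l)"

text \<open>Only the coefficients up to degree \<open>d\<close> matter. This notion is stable under
  products and substitution by finite algebra alone, and it can be compared directly with the error
  term of the given coordinates.\<close>

definition expands :: "nat \<Rightarrow> (complex ^ 'n \<Rightarrow> complex) \<Rightarrow> (complex, 'n) mfps \<Rightarrow> bool" where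
  "expands d f p \<longleftrightarrow> is_O (\<lambda>z. f z - mfps_poly d p z) (Suc d)"

text \<open>Convergence at one point with all coordinates equal to \<open>r > 0\<close> makes the
  sum of \<open>|p_l| r^|l|\<close> finite. For \<open>|z| \<le> r\<close> it dominates the tail,
  with the factor \<open>(|z| / r)^(d+1)\<close> split off.\<close>

lemma expands_has_power_series:
  fixes f :: "complex ^ 'n \<Rightarrow> complex"
  assumes "has_power_series f p 0"
  shows "expands d f p"
proof -
  obtain e where e: "0 < e"
    and f: "\<And>z. norm z < e \<Longrightarrow> ((\<lambda>l. mfps_nth p l * mpow z l) has_sum f z) UNIV"
    using assms unfolding has_power_series_def eventually_nhds_metric by (auto simp: dist_norm)
  \<comment> \<open>This makes the sum of the moduli of the coordinates of \<open>v\<close> equal to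
    \<open>e / 2\<close>, so \<open>v\<close> lies within the region of convergence.\<close>
  define r where "r = e / (2 * real CARD('n))"
  have r: "0 < r" using e by (simp add: r_def)
  define v where "v = ((\<chi> i. complex_of_real r) :: complex ^ 'n)"
  have "norm v \<le> (\<Sum>i\<in>UNIV. norm (v $ i))"
    unfolding norm_vec_def by (rule L2_set_le_sum) simp
  also have "\<dots> < e" using r e by (simp add: v_def) (simp add: r_def)
  finally have "(\<lambda>l. mfps_nth p l * mpow v l) summable_on UNIV"
    using f has_sum_imp_summable by blast
  then have "(\<lambda>l. norm (mfps_nth p l * mpow v l)) summable_on UNIV"
    by (rule summable_on_iff_abs_summable_on_complex[THEN iffD1])
  moreover have "norm (mpow v l) = r ^ mdeg l" for l
    using r by (simp add: mpow_def v_def mdeg_def power_sum norm_power flip: prod_norm)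
  ultimately have sum: "(\<lambda>l. norm (mfps_nth p l) * r ^ mdeg l) summable_on UNIV"
    by (simp add: norm_mult)
  let ?R = "{l :: nat ^ 'n. \<not> mdeg l \<le> d}"
  define S where "S = infsum (\<lambda>l. norm (mfps_nth p l) * r ^ mdeg l) ?R"
  have S: "((\<lambda>l. norm (mfps_nth p l) * r ^ mdeg l) has_sum S) ?R"
    unfolding S_def using sum by (intro has_sum_infsum) (rule summable_on_subset_banach, auto)
  have "norm (f z - mfps_poly d p z) \<le> (S / r ^ Suc d) * norm z ^ Suc d"
    if z: "norm z \<le> r" "norm z < e" for z
  proof -
    have "((\<lambda>l. mfps_nth p l * mpow z l) has_sum mfps_poly d p z) {l. mdeg l \<le> d}"
      unfolding mfps_poly_def by (rule has_sum_finite[OF finite_mdeg_le])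
    from has_sum_Diff[OF f[OF z(2)] this]
    have 1: "((\<lambda>l. mfps_nth p l * mpow z l) has_sum (f z - mfps_poly d p z)) ?R"
      by (simp add: set_diff_eq)
    have "norm (f z - mfps_poly d p z) \<le> (norm z / r) ^ Suc d * S"
    proof (rule norm_infsum_le[OF 1 has_sum_cmult_right[OF S]])
      fix l :: "nat ^ 'n"
      assume "l \<in> ?R"
      then have l: "Suc d \<le> mdeg l" by simp
      have "norm (mfps_nth p l * mpow z l) \<le> norm (mfps_nth p l) * norm z ^ mdeg l"
        by (simp add: norm_mult mult_left_mono norm_mpow_le)
      also have "\<dots> = norm (mfps_nth p l) * r ^ mdeg l * (norm z / r) ^ mdeg l"
        using r by (simp add: power_divide)
      also have "\<dots> \<le> norm (mfps_nth p l) * r ^ mdeg l * (norm z / r) ^ Suc d"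
        using r z l by (intro mult_left_mono power_decreasing) auto
      finally show "norm (mfps_nth p l * mpow z l)
          \<le> (norm z / r) ^ Suc d * (norm (mfps_nth p l) * r ^ mdeg l)"
        by (simp add: mult_ac)
    qed
    then show ?thesis by (simp add: power_divide mult_ac)
  qed
  moreover have "\<forall>\<^sub>F z :: complex ^ 'n in nhds 0. norm z \<le> min r (e / 2)"
    using r e by (intro eventually_norm_le) auto
  ultimately have "\<forall>\<^sub>F z in nhds 0. norm (f z - mfps_poly d p z) \<le> (S / r ^ Suc d) * norm z ^ Suc d"
    using e by (auto elim!: eventually_mono)
  then show ?thesis
    unfolding expands_def by (rule is_OI)
qed

lemma expands_mod:
  assumes "expands d f p" "p - q \<in> mfps_ideal (Suc d)"
  shows "expands d f q"
proof -
  have "mfps_nth p l = mfps_nth q l" if "mdeg l \<le> d" for l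
    using mfps_idealD[OF assms(2), of l] that by simp
  then have "mfps_poly d p = mfps_poly d q"
    by (auto simp: mfps_poly_def intro!: ext sum.cong)
  then show ?thesis using assms(1) by (simp add: expands_def)
qed

lemma expands_cong_O:
  assumes "expands d g p" "is_O (\<lambda>z. f z - g z) (Suc d)"
  shows "expands d f p"
  using is_O_add[OF assms(2) assms(1)[unfolded expands_def]] by (simp add: expands_def)

lemma expands_cong: "expands d f p \<Longrightarrow> \<forall>\<^sub>F z in nhds 0. f z = g z \<Longrightarrow> expands d g p"
  unfolding expands_def by (subst is_O_cong[of _ "\<lambda>z. f z - mfps_poly d p z"]) (auto elim: eventually_mono)

lemma expands_add: "expands d f p \<Longrightarrow> expands d g q \<Longrightarrow> expands d (\<lambda>z. f z + g z) (p + q)"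
  using is_O_add[of "\<lambda>z. f z - mfps_poly d p z" "Suc d" "\<lambda>z. g z - mfps_poly d q z"]
  by (simp add: expands_def mfps_poly_def distrib_right sum.distrib algebra_simps)

lemma expands_diff: "expands d f p \<Longrightarrow> expands d g q \<Longrightarrow> expands d (\<lambda>z. f z - g z) (p - q)"
  using is_O_diff[of "\<lambda>z. f z - mfps_poly d p z" "Suc d" "\<lambda>z. g z - mfps_poly d q z"]
  by (simp add: expands_def mfps_poly_def left_diff_distrib sum_subtractf algebra_simps)

lemma expands_zero: "expands d (\<lambda>_. 0) 0"
  by (simp add: expands_def mfps_poly_def)

lemma expands_sum: "(\<And>i. i \<in> A \<Longrightarrow> expands d (f i) (p i)) \<Longrightarrow>
    expands d (\<lambda>z. \<Sum>i\<in>A. f i z) (\<Sum>i\<in>A. p i)"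
  by (induction A rule: infinite_finite_induct) (auto intro: expands_add expands_zero)

lemma expands_monom: "expands d (\<lambda>z. c * mpow z l) (mfps_monom c l)"
proof -
  have "mfps_poly d (mfps_monom c l) z = (if mdeg l \<le> d then c * mpow z l else 0)" for z
    by (simp add: mfps_poly_def mfps_nth_monom if_distrib if_distribR finite_mdeg_le cong: if_cong)
  then show ?thesis
    unfolding expands_def using is_O_mono[OF is_O_monom[of c l], of "Suc d"]
    by (cases "mdeg l \<le> d") auto
qed

lemma is_O_poly: "is_O (mfps_poly d p) 0"
  unfolding mfps_poly_def by (intro is_O_sum is_O_mono[OF is_O_monom]) simp

text \<open>Modulo the error order both functions may be replaced by their Taylor polynomials, whose
  product corresponds exactly to the product of the truncated series.\<close>

lemma expands_mult:
  assumes f: "expands d f p" and g: "expands d g q"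
  shows "expands d (\<lambda>z. f z * g z) (p * q)"
proof (rule expands_cong_O)
  let ?f = "mfps_poly d p" and ?g = "mfps_poly d q"
  have "is_O (\<lambda>z. (g z - ?g z) + ?g z) 0"
    using g by (intro is_O_add is_O_poly) (auto simp: expands_def intro: is_O_mono)
  then have "is_O (\<lambda>z. (f z - ?f z) * ((g z - ?g z) + ?g z) + ?f z * (g z - ?g z)) (Suc d)"
    using is_O_mult[OF f[unfolded expands_def], of "\<lambda>z. (g z - ?g z) + ?g z" 0]
      is_O_mult[OF is_O_poly g[unfolded expands_def], of d p]
    by (intro is_O_add) auto
  then show "is_O (\<lambda>z. f z * g z - ?f z * ?g z) (Suc d)"
    by (simp add: algebra_simps)
  have "expands d (\<lambda>z. \<Sum>l | mdeg l \<le> d. \<Sum>m | mdeg m \<le> d. (mfps_nth p l * mfps_nth q m) * mpow z (l + m))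
      (\<Sum>l | mdeg l \<le> d. \<Sum>m | mdeg m \<le> d. mfps_monom (mfps_nth p l * mfps_nth q m) (l + m))"
    by (intro expands_sum expands_monom)
  moreover have "(\<Sum>l | mdeg l \<le> d. \<Sum>m | mdeg m \<le> d. mfps_monom (mfps_nth p l * mfps_nth q m) (l + m))
      = mfps_trunc d p * mfps_trunc d q"
    by (simp add: mfps_trunc_def sum_product mfps_monom_mult)
  moreover have "(\<lambda>z. \<Sum>l | mdeg l \<le> d. \<Sum>m | mdeg m \<le> d. (mfps_nth p l * mfps_nth q m) * mpow z (l + m))
      = (\<lambda>z. ?f z * ?g z)"
    by (simp add: mfps_poly_def sum_product mpow_add mult_ac)
  ultimately have "expands d (\<lambda>z. ?f z * ?g z) (mfps_trunc d p * mfps_trunc d q)"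
    by simp
  then show "expands d (\<lambda>z. ?f z * ?g z) (p * q)"
  proof (rule expands_mod)
    have "mfps_trunc d p * mfps_trunc d q - p * q
      = (mfps_trunc d p - p) * mfps_trunc d q + p * (mfps_trunc d q - q)"
      by (simp add: algebra_simps)
    moreover have "mfps_trunc d h - h \<in> mfps_ideal (Suc d)" for h :: "(complex, 'a) mfps"
      using mfps_trunc_diff mfps_ideal_diff_commute by blast
    ultimately show "mfps_trunc d p * mfps_trunc d q - p * q \<in> mfps_ideal (Suc d)"
      by (simp add: mfps_ideal_add mfps_ideal_mult_left mfps_ideal_mult_right)
  qed
qed

lemma expands_const: "expands d (\<lambda>_. c) (mfps_monom c 0)"
  using expands_monom[of d c 0] by simp

lemma expands_one: "expands d (\<lambda>_. 1) 1"
  using expands_const[of d 1] by (simp add: mfps_monom_one)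

lemma expands_power: "expands d f p \<Longrightarrow> expands d (\<lambda>z. f z ^ n) (p ^ n)"
  by (induction n) (auto intro: expands_mult expands_one)

lemma expands_prod: "(\<And>i. i \<in> A \<Longrightarrow> expands d (f i) (p i)) \<Longrightarrow>
    expands d (\<lambda>z. \<Prod>i\<in>A. f i z) (\<Prod>i\<in>A. p i)"
  by (induction A rule: infinite_finite_induct) (auto intro: expands_mult expands_one)

lemma is_O_poly_ideal: "p \<in> mfps_ideal e \<Longrightarrow> is_O (mfps_poly d p) e"
  unfolding mfps_poly_def
proof (intro is_O_sum)
  fix l :: "nat ^ 'a"
  assume "p \<in> mfps_ideal e"
  then show "is_O (\<lambda>z. mfps_nth p l * mpow z l) e"
    using is_O_mono[OF is_O_monom[of _ l], of e] mfps_idealD[of p e l] by (cases "e \<le> mdeg l") auto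
qed

lemma expands_is_O:
  assumes "expands d f p" "p \<in> mfps_ideal e" "e \<le> Suc d"
  shows "is_O f e"
proof -
  have "is_O (\<lambda>z. (f z - mfps_poly d p z) + mfps_poly d p z) e"
    using assms by (intro is_O_add is_O_poly_ideal) (auto simp: expands_def intro: is_O_mono)
  then show ?thesis by simp
qed

lemma is_O_vec:
  fixes G :: "complex ^ 'n \<Rightarrow> complex ^ 'n"
  assumes "\<And>i. is_O (\<lambda>z. G z $ i) 1"
  obtains C where "0 \<le> C" "\<forall>\<^sub>F z in nhds 0. norm (G z) \<le> C * norm z"
proof -
  obtain C where C: "\<And>i. 0 \<le> C i" "\<And>i. \<forall>\<^sub>F z in nhds 0. norm (G z $ i) \<le> C i * norm z"
  proof -
    have "\<forall>i. \<exists>C\<ge>0. \<forall>\<^sub>F z in nhds 0. norm (G z $ i) \<le> C * norm z"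
      using assms by (simp add: is_O_def)
    then show ?thesis using that by (auto dest!: choice)
  qed
  have "\<forall>\<^sub>F z in nhds 0. \<forall>i. norm (G z $ i) \<le> C i * norm z"
    by (rule eventually_all_finite) (rule C)
  then have "\<forall>\<^sub>F z in nhds 0. norm (G z) \<le> (\<Sum>i\<in>UNIV. C i) * norm z"
  proof eventually_elim
    case (elim z)
    have "norm (G z) \<le> (\<Sum>i\<in>UNIV. norm (G z $ i))"
      unfolding norm_vec_def by (rule L2_set_le_sum) simp
    also have "\<dots> \<le> (\<Sum>i\<in>UNIV. C i * norm z)"
      using elim by (intro sum_mono) auto
    finally show ?case by (simp add: sum_distrib_right)
  qed
  moreover have "0 \<le> (\<Sum>i\<in>UNIV. C i)" by (simp add: C sum_nonneg)
  ultimately show ?thesis by (rule that[rotated])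
qed

lemma tendsto_zero_of_linear_bound:
  fixes G :: "complex ^ 'n \<Rightarrow> complex ^ 'n"
  assumes "\<forall>\<^sub>F z in nhds 0. norm (G z) \<le> C * norm z"
  shows "filterlim G (nhds 0) (nhds 0)"
proof (rule tendsto_norm_zero_cancel, rule real_tendsto_sandwich[OF _ assms tendsto_const])
  have "((\<lambda>z :: complex ^ 'n. z) \<longlongrightarrow> 0) (nhds 0)"
    by (rule filterlim_ident)
  from tendsto_mult_right_zero[OF tendsto_norm_zero[OF this], of C]
  show "((\<lambda>z :: complex ^ 'n. C * norm z) \<longlongrightarrow> 0) (nhds 0)" .
qed simp

lemma is_O_compose:
  fixes G :: "complex ^ 'n \<Rightarrow> complex ^ 'n"
  assumes f: "is_O f d" and G: "\<And>i. is_O (\<lambda>z. G z $ i) 1"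
  shows "is_O (\<lambda>z. f (G z)) d"
proof -
  obtain C where C: "0 \<le> C" "\<forall>\<^sub>F z in nhds 0. norm (f z) \<le> C * norm z ^ d"
    using f by (auto simp: is_O_def)
  obtain K where K: "0 \<le> K" "\<forall>\<^sub>F z in nhds 0. norm (G z) \<le> K * norm z"
    using is_O_vec[OF G] .
  have "\<forall>\<^sub>F z in nhds 0. norm (f (G z)) \<le> C * norm (G z) ^ d"
    using tendsto_zero_of_linear_bound[OF K(2)] C(2) by (rule eventually_compose_filterlim[rotated])
  with K(2) have "\<forall>\<^sub>F z in nhds 0. norm (f (G z)) \<le> (C * K ^ d) * norm z ^ d"
  proof eventually_elim
    case (elim z)
    have "C * norm (G z) ^ d \<le> C * (K * norm z) ^ d"
      using elim C(1) by (intro mult_left_mono power_mono) auto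
    then show ?case using elim by (simp add: power_mult_distrib mult_ac)
  qed
  then show ?thesis by (rule is_OI)
qed

lemma expands_compose:
  fixes G :: "complex ^ 'n \<Rightarrow> complex ^ 'n"
  assumes f: "expands d f q" and G: "\<And>i. expands d (\<lambda>z. G z $ i) (P i)"
    and P: "\<And>i. P i \<in> mfps_ideal 1"
  shows "expands d (\<lambda>z. f (G z)) (mfps_compose q P)"
proof (rule expands_cong_O)
  have "is_O (\<lambda>z. G z $ i) 1" for i
    by (rule expands_is_O[OF G P]) simp
  then show "is_O (\<lambda>z. f (G z) - mfps_poly d q (G z)) (Suc d)"
    by (rule is_O_compose[OF f[unfolded expands_def]])
  have "expands d (\<lambda>z. \<Sum>l | mdeg l \<le> d. mfps_nth q l * (\<Prod>i\<in>UNIV. (G z $ i) ^ (l $ i)))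
      (\<Sum>l | mdeg l \<le> d. mfps_monom (mfps_nth q l) 0 * (\<Prod>i\<in>UNIV. P i ^ (l $ i)))"
    by (intro expands_sum expands_mult expands_const expands_prod expands_power G)
  moreover have "(\<Sum>l | mdeg l \<le> d. mfps_monom (mfps_nth q l) 0 * (\<Prod>i\<in>UNIV. P i ^ (l $ i)))
      = mfps_compose (mfps_trunc d q) P"
  proof -
    have sum: "mfps_compose (\<Sum>l\<in>A. h l) P = (\<Sum>l\<in>A. mfps_compose (h l) P)"
      for A and h :: "nat ^ 'n \<Rightarrow> _"
    proof (induction A rule: infinite_finite_induct)
      case empty
      show ?case using mfps_compose_diff[of 0 0 P] by simp
    next
      case (infinite A)
      then show ?case using mfps_compose_diff[of 0 0 P] by simp
    qed (simp add: mfps_compose_add)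
    show ?thesis by (simp add: mfps_trunc_def sum mfps_compose_monom[OF P])
  qed
  ultimately have "expands d (\<lambda>z. mfps_poly d q (G z)) (mfps_compose (mfps_trunc d q) P)"
    by (simp add: mfps_poly_def mpow_def)
  then show "expands d (\<lambda>z. mfps_poly d q (G z)) (mfps_compose q P)"
  proof (rule expands_mod)
    have "mfps_trunc d q - q \<in> mfps_ideal (Suc d)"
      using mfps_trunc_diff mfps_ideal_diff_commute by blast
    then show "mfps_compose (mfps_trunc d q) P - mfps_compose q P \<in> mfps_ideal (Suc d)"
      by (simp add: mfps_compose_ideal flip: mfps_compose_diff)
  qed
qed

section \<open>Uniqueness of expansions\<close>

lemma polynomial_coeffs_zero:
  fixes p :: "nat ^ 'n \<Rightarrow> complex"
  assumes L: "finite L" and zero: "\<And>z. (\<Sum>l\<in>L. p l * mpow z l) = 0" and l: "l \<in> L"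
  shows "p l = 0"
proof -
  text \<open>The variables are eliminated one at a time.\<close>
  have "\<forall>r z. (\<Sum>l\<in>{l\<in>L. \<forall>i\<in>A. l $ i = r i}. p l * (\<Prod>i\<in>-A. z i ^ (l $ i))) = 0"
    if "finite A" for A :: "'n set"
    using that
  proof induction
    case empty
    show ?case
    proof safe
      fix z :: "'n \<Rightarrow> complex"
      show "(\<Sum>l\<in>{l\<in>L. \<forall>i\<in>{}. l $ i = r i}. p l * (\<Prod>i\<in>-{}. z i ^ (l $ i))) = 0" for r
        using zero[of "\<chi> i. z i"] by (simp add: mpow_def)
    qed
  next
    case (insert x A)
    show ?case
    proof safe
      fix r :: "'n \<Rightarrow> nat" and z :: "'n \<Rightarrow> complex"
      define LA where "LA = {l\<in>L. \<forall>i\<in>A. l $ i = r i}"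
      \<comment> \<open>With all remaining variables except \<open>x\<close> fixed, the sum is a
        polynomial in \<open>t\<close> with coefficients \<open>c n\<close>. \<open>N\<close> bounds
        every exponent of \<open>x\<close> occurring in \<open>L\<close>, and also
        \<open>r x\<close>, so that \<open>c (r x)\<close> is one of these coefficients.\<close>
      define N where "N = r x + (\<Sum>l\<in>L. l $ x)"
      define c where "c n = (\<Sum>l\<in>{l\<in>LA. l $ x = n}. p l * (\<Prod>i\<in>-insert x A. z i ^ (l $ i)))" for n
      have LA: "finite LA" using L by (simp add: LA_def)
      have "(\<Sum>n\<le>N. c n * t ^ n) = 0" for t
      proof -
        have "0 = (\<Sum>l\<in>LA. p l * (\<Prod>i\<in>-A. (z(x := t)) i ^ (l $ i)))"
          using insert.IH by (simp add: LA_def)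
        also have "\<dots> = (\<Sum>l\<in>LA. p l * (\<Prod>i\<in>-insert x A. z i ^ (l $ i)) * t ^ (l $ x))"
        proof (rule sum.cong[OF refl])
          fix l
          have eq: "- A = insert x (- insert x A)" using insert.hyps by auto
          have "(\<Prod>i\<in>-A. (z(x := t)) i ^ (l $ i))
              = t ^ (l $ x) * (\<Prod>i\<in>-insert x A. (z(x := t)) i ^ (l $ i))"
            unfolding eq by (subst prod.insert) auto
          also have "(\<Prod>i\<in>-insert x A. (z(x := t)) i ^ (l $ i)) = (\<Prod>i\<in>-insert x A. z i ^ (l $ i))"
            by (rule prod.cong) auto
          finally show "p l * (\<Prod>i\<in>-A. (z(x := t)) i ^ (l $ i))
              = p l * (\<Prod>i\<in>-insert x A. z i ^ (l $ i)) * t ^ (l $ x)"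
            by (simp add: mult_ac)
        qed
        also have "\<dots> = (\<Sum>n\<le>N. \<Sum>l\<in>{l\<in>LA. l $ x = n}.
            p l * (\<Prod>i\<in>-insert x A. z i ^ (l $ i)) * t ^ (l $ x))"
        proof (rule sum.group[symmetric])
          show "(\<lambda>l. l $ x) ` LA \<subseteq> {..N}"
            using L by (auto simp: N_def LA_def intro!: trans_le_add2 member_le_sum)
        qed (use LA in auto)
        also have "\<dots> = (\<Sum>n\<le>N. c n * t ^ n)"
          unfolding c_def sum_distrib_right by (intro sum.cong) auto
        finally show ?thesis by simp
      qed
      then have "\<forall>n\<le>N. c n = 0"
        using Transcendental.polyfun_eq_0[of c N] by blast
      then have "c (r x) = 0" by (simp add: N_def)
      moreover have "{l\<in>LA. l $ x = r x} = {l\<in>L. \<forall>i\<in>insert x A. l $ i = r i}"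
        by (auto simp: LA_def)
      ultimately show "(\<Sum>l\<in>{l\<in>L. \<forall>i\<in>insert x A. l $ i = r i}.
          p l * (\<Prod>i\<in>-insert x A. z i ^ (l $ i))) = 0"
        by (simp add: c_def)
    qed
  qed
  from this[of UNIV] have "(\<Sum>m\<in>{m\<in>L. \<forall>i. m $ i = l $ i}. p m) = 0"
    by simp
  moreover have "{m\<in>L. \<forall>i. m $ i = l $ i} = {l}"
    using l by (auto simp: vec_eq_iff)
  ultimately show ?thesis by simp
qed

text \<open>By induction on the degree: if \<open>p\<close> has order \<open>e \<le> d\<close>, its
  homogeneous part \<open>q\<close> of degree \<open>e\<close> is \<open>o(|z|^e)\<close>, and
  \<open>q (t v) = t^e q v\<close> along real rays forces \<open>q v = 0\<close>.\<close>

lemma expands_unique: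
  fixes p :: "(complex, 'n::finite) mfps"
  assumes f: "expands d f p" and o: "is_o f d"
  shows "p \<in> mfps_ideal (Suc d)"
proof -
  have poly: "is_o (mfps_poly d p) d"
    using is_o_diff_is_O[OF o f[unfolded expands_def]] by simp
  have "p \<in> mfps_ideal e" if "e \<le> Suc d" for e
    using that
  proof (induction e)
    case (Suc e)
    then have IH: "p \<in> mfps_ideal e" and e: "e \<le> d" by simp_all
    define q where "q z = (\<Sum>l | mdeg l = e. mfps_nth p l * mpow z l)" for z :: "complex ^ 'n"
    have fin: "finite {l :: nat ^ 'n. mdeg l = e}"
      by (rule finite_subset[OF _ finite_mdeg_le[of e]]) auto
    have "mfps_poly d p z - q z = (\<Sum>l\<in>{l. mdeg l \<le> d} - {l. mdeg l = e}. mfps_nth p l * mpow z l)" for z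
      unfolding mfps_poly_def q_def using e by (intro sum_diff[symmetric] finite_mdeg_le) auto
    moreover have "is_O (\<lambda>z. \<Sum>l\<in>{l. mdeg l \<le> d} - {l. mdeg l = e}. mfps_nth p l * mpow z l) (Suc e)"
    proof (rule is_O_sum)
      fix l :: "nat ^ 'n"
      assume "l \<in> {l. mdeg l \<le> d} - {l. mdeg l = e}"
      then consider "mdeg l < e" | "Suc e \<le> mdeg l" by fastforce
      then show "is_O (\<lambda>z. mfps_nth p l * mpow z l) (Suc e)"
        by cases (use mfps_idealD[OF IH, of l] is_O_mono[OF is_O_monom] in auto)
    qed
    ultimately have "is_O (\<lambda>z. mfps_poly d p z - q z) (Suc e)"
      by simp
    from is_o_diff_is_O[OF is_o_mono[OF poly e] this] have q: "is_o q e"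
      by simp
    have "q v = 0" for v
    proof (rule ccontr)
      assume nz: "q v \<noteq> 0"
      \<comment> \<open>Chosen so that \<open>\<epsilon> |v|^e\<close> is at most half of
        \<open>|q v|\<close>; the summand 1 keeps the denominator positive.\<close>
      define \<epsilon> where "\<epsilon> = norm (q v) / (2 * (norm v ^ e + 1))"
      have \<epsilon>: "\<epsilon> > 0" using nz by (simp add: \<epsilon>_def add_nonneg_pos)
      have "((\<lambda>t. of_real t *s v) \<longlongrightarrow> of_real 0 *s v) (at_right (0::real))"
        unfolding vector_scalar_mult_def by (intro tendsto_vec_lambda tendsto_intros)
      then have lim: "((\<lambda>t. of_real t *s v) \<longlongrightarrow> 0) (at_right (0::real))"
        by simp
      have "\<forall>\<^sub>F t in at_right (0::real). norm (q (of_real t *s v)) \<le> \<epsilon> * norm (of_real t *s v) ^ e"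
        using q \<epsilon> lim unfolding is_o_def by (intro eventually_compose_filterlim[OF _ lim]) auto
      then have "\<forall>\<^sub>F t in at_right (0::real). False"
        using eventually_at_right_less[of "0::real"]
      proof eventually_elim
        case (elim t)
        have "mpow (of_real t *s v) l = of_real (t ^ mdeg l) * mpow v l" for l
          by (simp add: mpow_def power_mult_distrib prod.distrib mdeg_def power_sum)
        then have "q (of_real t *s v) = of_real (t ^ e) * q v"
          unfolding q_def sum_distrib_left by (intro sum.cong) (auto simp: mult_ac)
        then have "norm (q (of_real t *s v)) = t ^ e * norm (q v)"
          using elim by (simp add: norm_mult norm_power)
        moreover have "norm (of_real t *s v) = t * norm v"
        proof -
          have "of_real t *s v = t *\<^sub>R v"
            by (simp add: vec_eq_iff scaleR_conv_of_real[where 'a = complex])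
          then show ?thesis using elim by simp
        qed
        ultimately have "t ^ e * norm (q v) \<le> t ^ e * (\<epsilon> * norm v ^ e)"
          using elim by (simp add: power_mult_distrib mult_ac)
        then have "norm (q v) \<le> \<epsilon> * norm v ^ e"
          using elim by simp
        also have "\<dots> \<le> \<epsilon> * (norm v ^ e + 1)"
          using \<epsilon> by simp
        also have "\<dots> = norm (q v) / 2"
        proof -
          have "norm v ^ e + 1 \<noteq> 0" by (smt (verit) norm_ge_zero zero_le_power)
          then show ?thesis unfolding \<epsilon>_def by (metis divide_divide_eq_left mult.commute
                nonzero_divide_eq_eq)
        qed
        finally show False using nz by simp
      qed
      then show False by simp
    qed
    then have "mfps_nth p l = 0" if "mdeg l = e" for l
      using polynomial_coeffs_zero[OF fin, of "mfps_nth p" l] that by (simp add: q_def)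
    then show ?case
      using IH by (auto simp: mfps_ideal_def less_Suc_eq)
  qed simp
  then show ?thesis by simp
qed


section \<open>One-resonant germs\<close>

lemma mdeg_pos: "\<alpha> \<noteq> 0 \<Longrightarrow> 0 < mdeg \<alpha>"
  using mdeg_eq_0_iff by blast

text \<open>If \<open>lam_i = lam_j\<close>, the resonance \<open>\<alpha> + e_j\<close> yields a
  resonance \<open>\<alpha> + e_i\<close> for the same \<open>j\<close>. It must be of the form
  \<open>k \<alpha> + e_j\<close>, and comparing degrees gives \<open>k = 1\<close> and
  \<open>i = j\<close>.\<close>

lemma one_resonant_eigenvalues_distinct:
  assumes "one_resonant lam J \<alpha>" "j \<in> J" "lam $ i = lam $ j"
  shows "i = j"
proof -
  have \<alpha>: "\<alpha> \<noteq> 0" and res: "\<And>l. resonance lam j l \<longleftrightarrow> (\<exists>k\<ge>1. l = k *s \<alpha> + axis j 1)"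
    using assms by (auto simp: one_resonant_def)
  have pos: "0 < mdeg \<alpha>" by (rule mdeg_pos[OF \<alpha>])
  have "resonance lam j (\<alpha> + axis j 1)"
    unfolding res by (rule exI[of _ 1]) (simp add: vec_eq_iff)
  then have "resonance lam j (\<alpha> + axis i 1)"
    using assms(3) by (simp add: resonance_def mdeg_add mpow_add)
  then obtain k where k: "1 \<le> k" "\<alpha> + axis i 1 = k *s \<alpha> + axis j 1"
    unfolding res by blast
  have "mdeg \<alpha> + 1 = k * mdeg \<alpha> + 1"
    using arg_cong[OF k(2), of mdeg] by (simp add: mdeg_add mdeg_smult)
  then have "k = 1" using pos by simp
  then have "axis i (1::nat) = axis j 1"
    using k(2) by (simp add: vec_eq_iff)
  then show ?thesis by (simp add: axis_eq_nat_iff)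
qed

text \<open>A zero eigenvalue \<open>lam_j\<close> would make \<open>2 e_j\<close> a resonance, so
  \<open>\<alpha>\<close> would be supported at \<open>j\<close> alone.\<close>

lemma one_resonant_eigenvalue_nonzero:
  assumes "one_resonant lam J \<alpha>" "j \<in> J" and \<Lambda>: "(\<Sum>j\<in>J. a j * of_nat (\<alpha> $ j) / lam $ j) \<noteq> 0"
  shows "lam $ j \<noteq> 0"
proof
  assume 0: "lam $ j = 0"
  have \<alpha>: "\<And>i. i \<notin> J \<Longrightarrow> \<alpha> $ i = 0"
    and res: "\<And>l. resonance lam j l \<longleftrightarrow> (\<exists>k\<ge>1. l = k *s \<alpha> + axis j 1)"
    using assms by (auto simp: one_resonant_def)
  have "resonance lam j (axis j 2)"
    by (simp add: resonance_def 0)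
  then obtain k where k: "1 \<le> k" "axis j 2 = k *s \<alpha> + axis j 1"
    unfolding res by blast
  have "\<alpha> $ i = 0" if "i \<noteq> j" for i
  proof -
    have "axis j 2 $ i = (k *s \<alpha> + axis j 1) $ i"
      using k(2) by simp
    then show ?thesis using k(1) that by (simp add: axis_def)
  qed
  \<comment> \<open>At \<open>i = j\<close> the term vanishes because division by zero yields zero;
    elsewhere \<open>\<alpha>\<close> vanishes.\<close>
  then have "a i * of_nat (\<alpha> $ i) / lam $ i = 0" for i
    using 0 by (cases "i = j") auto
  then have "(\<Sum>j\<in>J. a j * of_nat (\<alpha> $ j) / lam $ j) = 0"
    by (intro sum.neutral) blast
  then show False using \<Lambda> by contradiction
qed

lemma holomorphic_germ_series:
  assumes "holomorphic_germ F"
  obtains P where "\<And>j. has_power_series (\<lambda>z. F z $ j) (P j) 0"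
  using assms unfolding holomorphic_germ_def mholomorphic_on_def by metis

lemma has_power_series_ideal:
  assumes "has_power_series f p 0" "f 0 = 0"
  shows "p \<in> mfps_ideal 1"
proof -
  have "\<exists>C. \<forall>\<^sub>F z in nhds 0. norm (f z - mfps_poly 0 p z) \<le> C * norm z ^ Suc 0"
    using expands_has_power_series[OF assms(1), of 0] by (auto simp: expands_def is_O_def)
  then have "f 0 = mfps_poly 0 p 0"
    using eventually_nhds_x_imp_x by fastforce
  moreover have "{l :: nat ^ 'a. mdeg l \<le> 0} = {0}"
    by (auto simp: mdeg_eq_0_iff)
  ultimately have "mfps_nth p 0 = 0"
    using assms(2) by (simp add: mfps_poly_def)
  then show ?thesis
    by (auto simp: mfps_ideal_def mdeg_eq_0_iff)
qed

text \<open>Differentiability says that \<open>F_j - lam_j z_j\<close> is \<open>o(|z|)\<close>, and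
  uniqueness of expansions in degree 1 transfers this to the series.\<close>

lemma diag_tangent_of_derivative:
  fixes F :: "complex ^ 'n \<Rightarrow> complex ^ 'n"
  assumes P: "\<And>j. has_power_series (\<lambda>z. F z $ j) (P j) 0" and F0: "F 0 = 0"
    and F: "(F has_derivative (\<lambda>v. \<chi> j. lam $ j * v $ j)) (at 0)"
  shows "diag_tangent P lam"
  unfolding diag_tangent_def
proof
  fix j
  have "expands 1 (\<lambda>z. F z $ j - lam $ j * mpow z (axis j 1)) (P j - mfps_monom (lam $ j) (axis j 1))"
    by (intro expands_diff expands_monom expands_has_power_series P)
  moreover have "is_o (\<lambda>z. F z $ j - lam $ j * mpow z (axis j 1)) 1"
    unfolding is_o_def
  proof safe
    fix \<epsilon> :: real
    assume "0 < \<epsilon>"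
    then obtain d where "0 < d"
      and d: "\<And>z. norm z < d \<Longrightarrow> norm (F z - (\<chi> j. lam $ j * z $ j)) \<le> \<epsilon> * norm z"
      using F unfolding has_derivative_at_alt by (auto simp: F0)
    have "norm (F z $ j - lam $ j * z $ j) \<le> \<epsilon> * norm z" if "norm z < d" for z
      using Finite_Cartesian_Product.norm_nth_le[of "F z - (\<chi> j. lam $ j * z $ j)" j] d[OF that]
      by simp
    then show "\<forall>\<^sub>F z in nhds 0. norm (F z $ j - lam $ j * mpow z (axis j 1)) \<le> \<epsilon> * norm z ^ 1"
      using \<open>0 < d\<close> unfolding eventually_nhds_metric by (auto simp: dist_norm)
  qed
  ultimately show "P j - mfps_monom (lam $ j) (axis j 1) \<in> mfps_ideal 2"
    using expands_unique by (metis Suc_1)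
qed

lemma is_OI_bigo:
  assumes "(\<lambda>z. norm (f z)) \<in> O[at 0](\<lambda>z. norm z ^ d)" "f 0 = 0"
  shows "is_O f d"
proof -
  obtain C where "\<forall>\<^sub>F z in at 0. norm (f z) \<le> C * norm z ^ d"
    using assms(1) by (auto elim!: landau_o.bigE)
  then have "\<forall>\<^sub>F z in nhds 0. z \<noteq> 0 \<longrightarrow> norm (f z) \<le> C * norm z ^ d"
    by (simp add: eventually_at_filter)
  then have "\<forall>\<^sub>F z in nhds 0. norm (f z) \<le> max C 0 * norm z ^ d"
  proof eventually_elim
    case (elim z)
    have "C * norm z ^ d \<le> max C 0 * norm z ^ d" by (intro mult_right_mono) auto
    then show ?case using elim assms(2) by (cases "z = 0") (auto intro: order_trans)
  qed
  then show ?thesis by (rule is_OI)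
qed

text \<open>The result depends on \<open>Q\<close> only through \<open>Q j\<close> and the powers
  prescribed by \<open>\<alpha>\<close>. For \<open>j\<close> in \<open>J\<close> and
  \<open>\<alpha>\<close> supported there, components outside \<open>J\<close> can thus be exchanged
  freely.\<close>

lemma mfps_compose_resonant_monom:
  assumes Q: "\<And>i. Q i \<in> mfps_ideal 1"
  shows "mfps_compose (mfps_monom c (p *s \<alpha> + axis j 1)) Q
    = Q j * (mfps_monom c 0 * (\<Prod>i\<in>UNIV. Q i ^ (\<alpha> $ i)) ^ p)"
proof -
  have "mfps_monom c (p *s \<alpha> + axis j 1) = mfps_monom c (p *s \<alpha>) * mfps_monom 1 (axis j 1)"
    by (simp add: mfps_monom_mult)
  moreover have "(\<Prod>i\<in>UNIV. Q i ^ ((p *s \<alpha>) $ i)) = (\<Prod>i\<in>UNIV. Q i ^ (\<alpha> $ i)) ^ p"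
    by (simp add: prod_power_distrib mult.commute[of p] power_mult)
  ultimately show ?thesis
    by (simp add: mfps_compose_mult[OF Q] mfps_compose_monom[OF Q, of c] mfps_compose_axis[OF Q]
        mfps_monom_one mult_ac)
qed

lemma prod_power_support:
  assumes "\<forall>i. i \<notin> J \<longrightarrow> \<alpha> $ i = 0"
  shows "(\<Prod>i\<in>UNIV. f i ^ (\<alpha> $ i)) = (\<Prod>i\<in>J. f i ^ (\<alpha> $ i))"
  by (rule prod.mono_neutral_right) (auto simp: assms)

text \<open>Since \<open>\<alpha> \<noteq> 0\<close>, the map \<open>p \<mapsto> p \<alpha>\<close>
  is injective, so coefficients along this ray can be read as those of a series in one variable;
  \<open>p = 0\<close> is the linear term \<open>z_j\<close>.\<close>

lemma mfps_resonant_eq: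
  fixes G :: "(complex, 'n::finite) mfps"
  assumes \<alpha>: "\<alpha> \<noteq> 0" and G: "\<And>l. mfps_nth G l \<noteq> 0 \<Longrightarrow> \<exists>p. l = p *s \<alpha> + axis j 1"
  shows "G = mfps_monom 1 (axis j 1)
    * mfps_of_fps (Abs_fps (\<lambda>p. mfps_nth G (p *s \<alpha> + axis j 1))) (mfps_monom 1 \<alpha>)"
    (is "_ = _ * mfps_of_fps ?g _")
proof (rule mfps_eqI)
  fix l
  have inj: "p = q" if "p *s \<alpha> = q *s \<alpha>" for p q
    using arg_cong[OF that, of mdeg] mdeg_pos[OF \<alpha>] by (simp add: mdeg_smult)
  have coeff: "mfps_nth (mfps_of_fps ?g (mfps_monom 1 \<alpha>)) m
      = (\<Sum>p\<le>mdeg m. if m = p *s \<alpha> then fps_nth ?g p else 0)" for m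
    unfolding mfps_nth_of_fps by (rule sum.cong) (auto simp: mfps_monom_power mfps_nth_monom)
  show "mfps_nth G l = mfps_nth (mfps_monom 1 (axis j 1) * mfps_of_fps ?g (mfps_monom 1 \<alpha>)) l"
  proof (cases "\<exists>p. l = p *s \<alpha> + axis j 1")
    case True
    then obtain p where l: "l = axis j 1 + p *s \<alpha>" by (auto simp: add.commute)
    have "mfps_nth (mfps_of_fps ?g (mfps_monom 1 \<alpha>)) (p *s \<alpha>)
        = (\<Sum>q\<le>mdeg (p *s \<alpha>). if q = p then fps_nth ?g p else 0)"
      unfolding coeff by (rule sum.cong) (auto dest: inj)
    also have "\<dots> = mfps_nth G l"
      using mdeg_pos[OF \<alpha>] by (simp add: mdeg_smult l add.commute)
    finally show ?thesis
      unfolding l mfps_nth_monom_mult by simp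
  next
    case False
    have "mfps_nth (mfps_of_fps ?g (mfps_monom 1 \<alpha>)) q = 0" if "l = axis j 1 + q" for q
      unfolding coeff using False that by (intro sum.neutral) (auto simp: add.commute)
    then have "mfps_nth (mfps_monom 1 (axis j 1) * mfps_of_fps ?g (mfps_monom 1 \<alpha>)) l = 0"
      by (cases "\<exists>q. l = axis j 1 + q") (auto simp: mfps_nth_monom_mult mfps_nth_monom_mult_eq_0)
    then show ?thesis using G[of l] False by auto
  qed
qed

lemma diag_tangent_formal_diffeo:
  fixes \<Phi> :: "'n::finite \<Rightarrow> (complex, 'n) mfps"
  assumes \<Phi>: "diag_tangent \<Phi> c" and c: "\<And>i. c $ i \<noteq> 0"
  shows "formal_diffeo \<Phi>"
  unfolding formal_diffeo_def
proof
  show "\<forall>i. mfps_nth (\<Phi> i) 0 = 0"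
    using mfps_idealD[OF diag_tangent_ideal[OF \<Phi>]] by simp
  have "mfps_nth (\<Phi> i) (axis j 1) = (if i = j then c $ i else 0)" for i j
  proof -
    have "mfps_nth (\<Phi> i - mfps_monom (c $ i) (axis i 1)) (axis j 1) = 0"
      using \<Phi> unfolding diag_tangent_def by (metis mfps_idealD mdeg_axis one_less_numeral_iff semiring_norm(76))
    then show ?thesis by (simp add: mfps_nth_monom axis_eq_nat_iff)
  qed
  then have "det (\<chi> i j. mfps_nth (\<Phi> i) (axis j 1)) = (\<Prod>i\<in>UNIV. c $ i)"
    by (subst det_diagonal) auto
  then show "invertible (\<chi> i j. mfps_nth (\<Phi> i) (axis j 1))"
    using c by (simp add: invertible_det_nz)
qed

text \<open>
  Only the components of the given coordinates \<open>\<phi>\<close> with index in \<open>J\<close> are used; the remaining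
  ones are replaced by the original coordinates.
\<close>

lemma nondegenerate_formal:
  fixes F :: "complex ^ 'n \<Rightarrow> complex ^ 'n"
  assumes P: "\<And>j. has_power_series (\<lambda>z. F z $ j) (P j) 0" and F0: "F 0 = 0"
    and tan: "diag_tangent P lam" and res: "one_resonant lam J \<alpha>"
    and nondeg: "nondegenerate F lam J \<alpha>"
  obtains \<Phi> c k a where "diag_tangent \<Phi> c" "\<And>i. c $ i \<noteq> 0" "1 \<le> k" "J \<noteq> {}"
    and "(\<Sum>j\<in>J. a j * of_nat (\<alpha> $ j) / lam $ j) \<noteq> 0"
    and "\<And>i. i \<notin> J \<Longrightarrow> \<Phi> i = mfps_monom 1 (axis i 1)"
    and "\<And>j. j \<in> J \<Longrightarrow> mfps_compose (\<Phi> j) P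
      - mfps_compose (mfps_monom (lam $ j) (axis j 1) + mfps_monom (a j) (k *s \<alpha> + axis j 1)) \<Phi>
      \<in> mfps_ideal (mdeg \<alpha> * k + 2)"
proof -
  obtain \<phi> \<psi> k a where inv: "inverse_germs \<phi> \<psi>" and k: "1 \<le> k" and a: "\<exists>j\<in>J. a j \<noteq> 0"
    and O: "\<And>j. j \<in> J \<Longrightarrow> (\<lambda>z. norm (\<phi> (F (\<psi> z)) $ j -
        (lam $ j * z $ j + a j * mpow z (k *s \<alpha>) * z $ j))) \<in> O[at 0](\<lambda>z. norm z ^ (mdeg \<alpha> * k + 2))"
    and \<Lambda>: "(\<Sum>j\<in>J. a j * of_nat (\<alpha> $ j) / lam $ j) \<noteq> 0"
    using nondeg unfolding nondegenerate_def by blast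
  have \<alpha>: "\<alpha> \<noteq> 0" "\<forall>i. i \<notin> J \<longrightarrow> \<alpha> $ i = 0"
    using res by (auto simp: one_resonant_def)
  have \<phi>0: "\<phi> 0 = 0" "\<psi> 0 = 0" and germs: "holomorphic_germ \<phi>" "holomorphic_germ \<psi>"
    and ev: "\<forall>\<^sub>F z in nhds 0. \<psi> (\<phi> z) = z" "\<forall>\<^sub>F z in nhds 0. \<phi> (\<psi> z) = z"
    using inv unfolding inverse_germs_def by (auto elim: eventually_mono)
  obtain A where A: "\<And>j. has_power_series (\<lambda>z. \<phi> z $ j) (A j) 0"
    using holomorphic_germ_series[OF germs(1)] by blast
  obtain B where B: "\<And>j. has_power_series (\<lambda>z. \<psi> z $ j) (B j) 0"
    using holomorphic_germ_series[OF germs(2)] by blast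
  have PI: "P i \<in> mfps_ideal 1" and AI: "A i \<in> mfps_ideal 1" and BI: "B i \<in> mfps_ideal 1" for i
    using has_power_series_ideal[OF P] has_power_series_ideal[OF A] has_power_series_ideal[OF B]
    by (simp_all add: F0 \<phi>0)
  define H where "H j = mfps_monom (lam $ j) (axis j 1) + mfps_monom (a j) (k *s \<alpha> + axis j 1)" for j
  have d2: "2 \<le> mdeg \<alpha> * k + 1"
    using mdeg_pos[OF \<alpha>(1)] k by (metis add_le_mono1 one_add_one mult_le_mono nat_mult_1 Suc_leI One_nat_def)
  have conj: "mfps_compose (A j) P - mfps_compose (H j) A \<in> mfps_ideal (mdeg \<alpha> * k + 2)"
    if j: "j \<in> J" for j
  proof -
    define d where "d = mdeg \<alpha> * k + 1"
    have d: "mdeg \<alpha> * k + 2 = Suc d" by (simp add: d_def)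
    define h where "h z = lam $ j * mpow z (axis j 1) + a j * mpow z (k *s \<alpha> + axis j 1)" for z
    have h: "h z = lam $ j * z $ j + a j * mpow z (k *s \<alpha>) * z $ j" for z
      by (simp add: h_def mpow_add)
    have "is_O (\<lambda>z. \<phi> (F (\<psi> z)) $ j - h z) (Suc d)"
      by (rule is_OI_bigo) (use O[OF j] in \<open>simp_all only: h d\<close>, simp add: h \<phi>0 F0)
    \<comment> \<open>Substituting \<open>z = \<phi> w\<close> turns the estimate for
      \<open>\<phi> o F o \<psi>\<close> into one for \<open>\<phi> o F - h o \<phi>\<close>, which
      no longer involves \<open>\<psi>\<close>.\<close>
    moreover have "is_O (\<lambda>z. \<phi> z $ i) 1" for i
      by (rule expands_is_O[OF expands_has_power_series[OF A, of 0] AI]) simp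
    ultimately have "is_O (\<lambda>w. \<phi> (F (\<psi> (\<phi> w))) $ j - h (\<phi> w)) (Suc d)"
      by (rule is_O_compose)
    then have "is_O (\<lambda>w. \<phi> (F w) $ j - h (\<phi> w)) (Suc d)"
      by (subst is_O_cong[of _ "\<lambda>w. \<phi> (F (\<psi> (\<phi> w))) $ j - h (\<phi> w)"])
        (use ev(1) in \<open>auto elim: eventually_mono\<close>)
    moreover have "expands d (\<lambda>w. \<phi> (F w) $ j) (mfps_compose (A j) P)"
      by (rule expands_compose[OF expands_has_power_series[OF A] expands_has_power_series[OF P] PI])
    moreover have "expands d h (H j)"
      unfolding h_def H_def by (intro expands_add expands_monom)
    from expands_compose[OF this expands_has_power_series[OF A] AI]
    have "expands d (\<lambda>w. h (\<phi> w)) (mfps_compose (H j) A)" .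
    ultimately have "mfps_compose (A j) P - mfps_compose (H j) A \<in> mfps_ideal (Suc d)"
      by (intro expands_unique[OF expands_diff is_O_imp_is_o])
    then show ?thesis by (simp only: d)
  qed
  \<comment> \<open>Comparing the coefficients of \<open>z_i\<close> in the conjugacy gives
    \<open>A_ji (lam_i - lam_j) = 0\<close>, and \<open>lam_j\<close> differs from all other
    eigenvalues.\<close>
  have row: "A j - mfps_monom (mfps_nth (A j) (axis j 1)) (axis j 1) \<in> mfps_ideal 2"
    if j: "j \<in> J" for j
  proof -
    have off: "mfps_nth (A j) (axis i 1) = 0" if "i \<noteq> j" for i
    proof -
      have "mfps_nth (mfps_compose (A j) P) (axis i 1) = mfps_nth (A j) (axis i 1) * lam $ i"
        using mfps_nth_compose_diag[OF tan, of "A j" "axis i 1"] AI by simp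
      moreover have "mfps_nth (mfps_compose (H j) A) (axis i 1) = lam $ j * mfps_nth (A j) (axis i 1)"
      proof -
        have "mfps_compose (mfps_monom (a j) (k *s \<alpha> + axis j 1)) A \<in> mfps_ideal 2"
          using d2 by (intro mfps_compose_ideal mfps_monom_in_ideal)
            (simp add: mdeg_add mdeg_smult mult.commute)
        then show ?thesis
          unfolding H_def by (simp add: mfps_compose_add mfps_compose_axis[OF AI] mfps_idealD)
      qed
      moreover have "mfps_nth (mfps_compose (A j) P - mfps_compose (H j) A) (axis i 1) = 0"
        by (rule mfps_idealD[OF conj[OF j]]) simp
      ultimately have "mfps_nth (A j) (axis i 1) * (lam $ i - lam $ j) = 0"
        by (simp add: algebra_simps)
      then show ?thesis
        using one_resonant_eigenvalues_distinct[OF res j, of i] that by auto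
    qed
    have "mfps_nth (A j - mfps_monom (mfps_nth (A j) (axis j 1)) (axis j 1)) l = 0"
      if "mdeg l < 2" for l
    proof (cases "mdeg l = 0")
      case True
      then have "l \<noteq> axis j 1" by auto
      then show ?thesis
        using mfps_idealD[OF AI, of l j] True by (simp add: mfps_nth_monom)
    next
      case False
      then have "mdeg l = 1" using that by linarith
      then obtain i where l: "l = axis i 1" by (rule mdeg_eq_1)
      show ?thesis
        by (cases "i = j") (simp_all add: l off mfps_nth_monom axis_eq_nat_iff)
    qed
    then show ?thesis unfolding mfps_ideal_def by blast
  qed
  \<comment> \<open>Otherwise \<open>A j\<close> would have order 2, and so would the
    \<open>j\<close>-th component of \<open>\<phi> o \<psi>\<close>, which is
    \<open>z_j\<close>.\<close>
  have diag_nz: "mfps_nth (A j) (axis j 1) \<noteq> 0" if j: "j \<in> J" for j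
  proof
    assume "mfps_nth (A j) (axis j 1) = 0"
    then have "mfps_compose (A j) B \<in> mfps_ideal 2"
      using row[OF j] by (simp add: mfps_compose_ideal)
    have "expands 1 (\<lambda>z. \<phi> (\<psi> z) $ j) (mfps_compose (A j) B)"
      by (rule expands_compose[OF expands_has_power_series[OF A] expands_has_power_series[OF B] BI])
    then have "expands 1 (\<lambda>z. z $ j) (mfps_compose (A j) B)"
      by (rule expands_cong) (use ev(2) in \<open>auto elim: eventually_mono\<close>)
    from expands_diff[OF this expands_monom[of 1 1 "axis j 1"]]
    have "expands 1 (\<lambda>z. 0) (mfps_compose (A j) B - mfps_monom 1 (axis j 1))"
      by simp
    from expands_unique[OF this is_O_imp_is_o[OF is_O_zero]]
    have "mfps_compose (A j) B - mfps_monom 1 (axis j 1) \<in> mfps_ideal 2"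
      by (simp add: numeral_2_eq_2 One_nat_def)
    from mfps_idealD[OF mfps_ideal_diff[OF \<open>mfps_compose (A j) B \<in> mfps_ideal 2\<close> this], of "axis j 1"]
    show False by (simp add: mfps_nth_monom)
  qed
  define \<Phi> where "\<Phi> i = (if i \<in> J then A i else mfps_monom 1 (axis i 1))" for i
  define c where "c = (\<chi> i. if i \<in> J then mfps_nth (A i) (axis i 1) else 1)"
  have \<Phi>: "diag_tangent \<Phi> c"
    using row by (auto simp: diag_tangent_def \<Phi>_def c_def)
  show ?thesis
  proof (rule that[OF \<Phi> _ k _ \<Lambda>])
    show "c $ i \<noteq> 0" for i using diag_nz by (simp add: c_def)
    show "J \<noteq> {}" using a by blast
    show "\<Phi> i = mfps_monom 1 (axis i 1)" if "i \<notin> J" for i using that by (simp add: \<Phi>_def)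
    fix j assume j: "j \<in> J"
    have "(\<Prod>i\<in>UNIV. \<Phi> i ^ (\<alpha> $ i)) = (\<Prod>i\<in>UNIV. A i ^ (\<alpha> $ i))"
      unfolding prod_power_support[OF \<alpha>(2)] by (rule prod.cong) (auto simp: \<Phi>_def)
    then have "mfps_compose (H j) \<Phi> = mfps_compose (H j) A"
      using j unfolding H_def mfps_compose_add mfps_compose_axis[OF AI]
        mfps_compose_axis[OF diag_tangent_ideal[OF \<Phi>]] mfps_compose_resonant_monom[OF AI]
        mfps_compose_resonant_monom[OF diag_tangent_ideal[OF \<Phi>]]
      by (simp add: \<Phi>_def)
    then show "mfps_compose (\<Phi> j) P - mfps_compose (mfps_monom (lam $ j) (axis j 1)
        + mfps_monom (a j) (k *s \<alpha> + axis j 1)) \<Phi> \<in> mfps_ideal (mdeg \<alpha> * k + 2)"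
      using conj[OF j] j by (simp add: \<Phi>_def H_def)
  qed
qed

text \<open>The purely formal part of the argument. The data \<open>k\<close> and \<open>a\<close>
  of the given coordinates reappear unchanged in the normal form, and the linear part
  \<open>c\<close> is kept by each successive change of coordinates.\<close>

lemma one_resonant_formal_normal_form:
  fixes P \<Phi>\<^sub>0 :: "'n::finite \<Rightarrow> (complex, 'n) mfps"
  assumes P: "diag_tangent P lam" and res: "one_resonant lam J \<alpha>"
    and \<Phi>0: "diag_tangent \<Phi>\<^sub>0 c" and c: "\<And>i. c $ i \<noteq> 0" and k: "1 \<le> k" and J: "J \<noteq> {}"
    and \<Lambda>: "(\<Sum>j\<in>J. a j * of_nat (\<alpha> $ j) / lam $ j) \<noteq> 0"
    and \<Phi>0': "\<And>i. i \<notin> J \<Longrightarrow> \<Phi>\<^sub>0 i = mfps_monom 1 (axis i 1)"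
    and E0: "\<And>j. j \<in> J \<Longrightarrow> mfps_compose (\<Phi>\<^sub>0 j) P
      - mfps_compose (mfps_monom (lam $ j) (axis j 1) + mfps_monom (a j) (k *s \<alpha> + axis j 1)) \<Phi>\<^sub>0
      \<in> mfps_ideal (mdeg \<alpha> * k + 2)"
  obtains \<Phi> H \<mu> where "diag_tangent \<Phi> c"
    and "\<And>j. mfps_compose (\<Phi> j) P = mfps_compose (H j) \<Phi>"
    and "\<And>j. j \<in> J \<Longrightarrow> H j = mfps_monom (lam $ j) (axis j 1) + mfps_monom (a j) (k *s \<alpha> + axis j 1)
        + mfps_monom (\<mu> * of_nat (\<alpha> $ j) * inverse (cnj (lam $ j))) ((2 * k) *s \<alpha> + axis j 1)"
    and "\<And>j. j \<notin> J \<Longrightarrow> only_resonant lam j (H j)"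
proof -
  have \<alpha>: "\<alpha> \<noteq> 0" "\<forall>i. i \<notin> J \<longrightarrow> \<alpha> $ i = 0"
    and resJ: "\<And>j l. j \<in> J \<Longrightarrow> resonance lam j l \<longleftrightarrow> (\<exists>k\<ge>1. l = k *s \<alpha> + axis j 1)"
    using res by (auto simp: one_resonant_def)
  note prodJ = prod_power_support[OF \<alpha>(2)]
  have lam: "lam $ j \<noteq> 0" if "j \<in> J" for j
    by (rule one_resonant_eigenvalue_nonzero[OF res that \<Lambda>])
  have pos: "0 < mdeg \<alpha>" by (rule mdeg_pos[OF \<alpha>(1)])
  have PI: "P i \<in> mfps_ideal 1" for i
    by (rule diag_tangent_ideal[OF P])

  \<comment> \<open>Normalization of the components with index in \<open>J\<close>\<close>
  define D where "D = mdeg \<alpha> * k + 2"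
  define H\<^sub>0 where "H\<^sub>0 j = mfps_monom (lam $ j) (axis j 1) + mfps_monom (a j) (k *s \<alpha> + axis j 1)" for j
  have "H\<^sub>0 j - mfps_monom (lam $ j) (axis j 1) \<in> mfps_ideal 2" for j
  proof -
    have "1 \<le> mdeg \<alpha> * k" using pos k by (simp add: Suc_le_eq One_nat_def)
    then have "mfps_monom (a j) (k *s \<alpha> + axis j 1) \<in> mfps_ideal 2"
      by (intro mfps_monom_in_ideal) (simp add: mdeg_add mdeg_smult mult.commute One_nat_def)
    then show ?thesis
      by (simp add: H\<^sub>0_def)
  qed
  moreover have "mfps_compose (\<Phi>\<^sub>0 j) P - mfps_compose (H\<^sub>0 j) \<Phi>\<^sub>0 \<in> mfps_ideal D" if "j \<in> J" for j
    using E0[OF that] by (simp add: H\<^sub>0_def D_def)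
  moreover have "2 \<le> D" by (simp add: D_def)
  \<comment> \<open>\<open>D\<close> is one more than the degree of \<open>k \<alpha> + e_j\<close>,
    so both monomials of \<open>H\<^sub>0\<close> persist in \<open>G\<close>.\<close>
  ultimately obtain \<Phi>\<^sub>1 G where \<Phi>1: "diag_tangent \<Phi>\<^sub>1 c"
    and G: "\<And>j. j \<in> J \<Longrightarrow> G j - H\<^sub>0 j \<in> mfps_ideal D"
      "\<And>j l. j \<in> J \<Longrightarrow> mfps_nth (G j) l \<noteq> mfps_nth (H\<^sub>0 j) l \<Longrightarrow> lam $ j = mpow lam l"
    and \<Phi>1': "\<And>i. i \<notin> J \<Longrightarrow> \<Phi>\<^sub>1 i = \<Phi>\<^sub>0 i"
    and conj1: "\<And>j. j \<in> J \<Longrightarrow> mfps_compose (\<Phi>\<^sub>1 j) P = mfps_compose (G j) \<Phi>\<^sub>1"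
    using formal_normal_form[OF P \<Phi>0 c, of J H\<^sub>0 D] by metis
  have \<Phi>1I: "\<Phi>\<^sub>1 i \<in> mfps_ideal 1" for i
    by (rule diag_tangent_ideal[OF \<Phi>1])

  \<comment> \<open>The normalized components as series in one variable\<close>
  define g where "g j = Abs_fps (\<lambda>p. mfps_nth (G j) (p *s \<alpha> + axis j 1))" for j
  define u where "u = (mfps_monom 1 \<alpha> :: (complex, 'n) mfps)"
  have uI: "u \<in> mfps_ideal 1"
    unfolding u_def using pos by (intro mfps_monom_in_ideal) simp
  have Gg: "G j = mfps_monom 1 (axis j 1) * mfps_of_fps (g j) u" if j: "j \<in> J" for j
    unfolding g_def u_def
  proof (rule mfps_resonant_eq[OF \<alpha>(1)])
    fix l assume nz: "mfps_nth (G j) l \<noteq> 0"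
    show "\<exists>p. l = p *s \<alpha> + axis j 1"
    proof (cases "mfps_nth (G j) l = mfps_nth (H\<^sub>0 j) l")
      case True
      with nz have "l = axis j 1 \<or> l = k *s \<alpha> + axis j 1"
        by (auto simp: H\<^sub>0_def mfps_nth_monom split: if_splits)
      moreover have "axis j 1 = 0 *s \<alpha> + axis j 1" by (simp add: vec_eq_iff)
      ultimately show ?thesis by metis
    next
      case False
      then have "\<not> mdeg l < D"
        using mfps_idealD[OF G(1)[OF j], of l] by auto
      then have "resonance lam j l"
        using G(2)[OF j False] by (simp add: resonance_def D_def)
      then show ?thesis using resJ[OF j] by blast
    qed
  qed
  have gk: "fps_eqm (Suc k) (g j) (fps_const (lam $ j) + fps_const (a j) * fps_X ^ k)" if j: "j \<in> J" for j
    unfolding fps_X_power_dvd_iff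
  proof safe
    fix p assume p: "p < Suc k"
    have "p * mdeg \<alpha> \<le> k * mdeg \<alpha>" using p by simp
    then have "mdeg (p *s \<alpha> + axis j 1) < D"
      unfolding D_def mdeg_add mdeg_smult mdeg_axis mult.commute[of "mdeg \<alpha>"] by linarith
    then have "mfps_nth (G j) (p *s \<alpha> + axis j 1) = mfps_nth (H\<^sub>0 j) (p *s \<alpha> + axis j 1)"
      using mfps_idealD[OF G(1)[OF j]] by (simp add: mfps_nth_diff)
    moreover have "p *s \<alpha> = 0 \<longleftrightarrow> p = 0" "p *s \<alpha> = k *s \<alpha> \<longleftrightarrow> p = k"
      using pos arg_cong[of "p *s \<alpha>" 0 mdeg] arg_cong[of "p *s \<alpha>" "k *s \<alpha>" mdeg]
      by (auto simp: mdeg_smult vec_eq_iff)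
    ultimately show "fps_nth (g j - (fps_const (lam $ j) + fps_const (a j) * fps_X ^ k)) p = 0"
      using k by (auto simp: g_def H\<^sub>0_def mfps_nth_monom)
  qed
  interpret resonant_system J "\<lambda>j. \<alpha> $ j" "\<lambda>j. lam $ j" a g k
  proof
    \<comment> \<open>The resonance \<open>\<alpha> + e_j\<close> says
      \<open>lam_j = lam^\<alpha> lam_j\<close>, and \<open>lam_j\<close> can be cancelled.\<close>
    show "(\<Prod>j\<in>J. lam $ j ^ \<alpha> $ j) = 1"
    proof -
      obtain j where j: "j \<in> J" using J by blast
      have "resonance lam j (1 *s \<alpha> + axis j 1)" unfolding resJ[OF j] by blast
      then have "lam $ j = mpow lam \<alpha> * lam $ j"
        by (simp add: resonance_def mpow_add)
      then have "mpow lam \<alpha> = 1" using lam[OF j] by simp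
      then show ?thesis
        by (simp add: mpow_def prodJ)
    qed
  qed (use k lam \<Lambda> gk in auto)
  obtain \<psi> \<mu> where \<psi>0: "\<And>j. j \<in> J \<Longrightarrow> fps_nth (\<psi> j) 0 = 1"
    and \<psi>: "\<And>j. j \<in> J \<Longrightarrow> err \<psi> \<mu> j = 0"
    using conjugation_exists by blast

  \<comment> \<open>The induced map on the resonant monomial\<close>
  define V where "V = (\<Prod>i\<in>J. \<Phi>\<^sub>1 i ^ (\<alpha> $ i))"
  have uV: "mfps_compose u \<Phi>\<^sub>1 = V"
    unfolding u_def V_def by (simp add: mfps_compose_monom[OF \<Phi>1I] prodJ mfps_monom_one)
  have VI: "V \<in> mfps_ideal 1"
    unfolding uV[symmetric] by (rule mfps_compose_ideal[OF uI])
  have conj1': "mfps_compose (\<Phi>\<^sub>1 j) P = \<Phi>\<^sub>1 j * mfps_of_fps (g j) V" if j: "j \<in> J" for j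
    unfolding conj1[OF j] Gg[OF j] mfps_compose_mult[OF \<Phi>1I] mfps_compose_axis[OF \<Phi>1I]
      mfps_compose_of_fps[OF uI \<Phi>1I] uV by (simp add: mfps_monom_one)
  have VP: "mfps_compose V P = mfps_of_fps \<theta> V"
  proof -
    have "mfps_compose V P = (\<Prod>i\<in>J. (\<Phi>\<^sub>1 i * mfps_of_fps (g i) V) ^ (\<alpha> $ i))"
      unfolding V_def mfps_compose_prod[OF PI] mfps_compose_power[OF PI]
      by (rule prod.cong) (simp_all add: conj1' V_def)
    also have "\<dots> = V * mfps_of_fps \<gamma> V"
      unfolding \<gamma>_def mfps_of_fps_prod[OF VI] mfps_of_fps_power[OF VI]
      by (simp add: power_mult_distrib prod.distrib V_def)
    finally show ?thesis
      by (simp add: \<theta>_def mfps_of_fps_mult[OF VI] VI)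
  qed

  \<comment> \<open>Conjugation by the solution of the one-variable problem\<close>
  define \<Phi>\<^sub>2 where "\<Phi>\<^sub>2 i = (if i \<in> J then \<Phi>\<^sub>1 i * mfps_of_fps (\<psi> i) V else \<Phi>\<^sub>1 i)" for i
  have \<Phi>2: "diag_tangent \<Phi>\<^sub>2 c"
    unfolding diag_tangent_def
  proof
    fix i
    have "\<Phi>\<^sub>2 i - \<Phi>\<^sub>1 i \<in> mfps_ideal 2"
    proof (cases "i \<in> J")
      case True
      have "fps_X ^ 1 dvd \<psi> i - 1"
        unfolding fps_X_power_dvd_iff using \<psi>0[OF True] by simp
      then have "mfps_of_fps (\<psi> i - 1) V \<in> mfps_ideal 1"
        by (rule mfps_of_fps_ideal)
      moreover have "mfps_of_fps (\<psi> i) V = mfps_of_fps (\<psi> i - 1) V + 1"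
        using mfps_of_fps_add[of "\<psi> i - 1" 1 V] VI by simp
      ultimately have "mfps_of_fps (\<psi> i) V - 1 \<in> mfps_ideal 1"
        by simp
      from mfps_ideal_mult[OF \<Phi>1I[of i] this] show ?thesis
        using True by (simp add: \<Phi>\<^sub>2_def algebra_simps)
    qed (simp add: \<Phi>\<^sub>2_def)
    then show "\<Phi>\<^sub>2 i - mfps_monom (c $ i) (axis i 1) \<in> mfps_ideal 2"
      using \<Phi>1 mfps_ideal_diff_trans unfolding diag_tangent_def by blast
  qed
  have \<Phi>2I: "\<Phi>\<^sub>2 i \<in> mfps_ideal 1" for i
    by (rule diag_tangent_ideal[OF \<Phi>2])
  define H\<^sub>2 where "H\<^sub>2 j = mfps_monom (lam $ j) (axis j 1) + mfps_monom (a j) (k *s \<alpha> + axis j 1)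
      + mfps_monom (\<mu> * of_nat (\<alpha> $ j) * inverse (cnj (lam $ j))) ((2 * k) *s \<alpha> + axis j 1)" for j
  \<comment> \<open>Stated for arbitrary \<open>Q\<close> so that it applies both to
    \<open>\<Phi>\<^sub>2\<close> and to the final \<open>\<Phi>\<close>, which agree on
    \<open>J\<close>.\<close>
  have H2: "mfps_compose (H\<^sub>2 j) Q = Q j * (mfps_monom (lam $ j) 0
      + mfps_monom (a j) 0 * (\<Prod>i\<in>J. Q i ^ (\<alpha> $ i)) ^ k
      + mfps_monom (\<mu> * \<kappa> j) 0 * (\<Prod>i\<in>J. Q i ^ (\<alpha> $ i)) ^ (2 * k))"
    if Q: "\<And>i. Q i \<in> mfps_ideal 1" for Q j
    unfolding H\<^sub>2_def mfps_compose_add mfps_compose_axis[OF Q] mfps_compose_resonant_monom[OF Q] prodJ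
    by (simp add: \<kappa>_def algebra_simps)
  have conj2: "mfps_compose (\<Phi>\<^sub>2 j) P = mfps_compose (H\<^sub>2 j) \<Phi>\<^sub>2" if j: "j \<in> J" for j
  proof -
    have "mfps_compose (\<Phi>\<^sub>2 j) P = \<Phi>\<^sub>1 j * mfps_of_fps (g j) V * mfps_of_fps (\<psi> j) (mfps_of_fps \<theta> V)"
      using j by (simp add: \<Phi>\<^sub>2_def mfps_compose_mult[OF PI] conj1' mfps_compose_of_fps[OF VI PI] VP)
    also have "\<dots> = \<Phi>\<^sub>1 j * mfps_of_fps (g j * fps_compose (\<psi> j) \<theta>) V"
      by (simp add: mfps_of_fps_mult[OF VI] mfps_of_fps_compose[OF VI] mult.assoc)
    also have "g j * fps_compose (\<psi> j) \<theta> = \<psi> j * nf \<psi> \<mu> j"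
      using \<psi>[OF j] by (simp add: err_def)
    also have "\<Phi>\<^sub>1 j * mfps_of_fps (\<psi> j * nf \<psi> \<mu> j) V = \<Phi>\<^sub>2 j * mfps_of_fps (nf \<psi> \<mu> j) V"
      using j by (simp add: mfps_of_fps_mult[OF VI] \<Phi>\<^sub>2_def mult.assoc)
    also have "mfps_of_fps (nf \<psi> \<mu> j) V = mfps_monom (lam $ j) 0
      + mfps_monom (a j) 0 * (V * mfps_of_fps (\<rho> \<psi>) V) ^ k
      + mfps_monom (\<mu> * \<kappa> j) 0 * (V * mfps_of_fps (\<rho> \<psi>) V) ^ (2 * k)"
      by (simp add: nf_def mfps_of_fps_add mfps_of_fps_mult[OF VI] mfps_of_fps_power[OF VI] VI)
    also have "V * mfps_of_fps (\<rho> \<psi>) V = (\<Prod>i\<in>J. \<Phi>\<^sub>2 i ^ (\<alpha> $ i))"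
      unfolding \<rho>_def mfps_of_fps_prod[OF VI] mfps_of_fps_power[OF VI]
      by (simp add: \<Phi>\<^sub>2_def power_mult_distrib prod.distrib flip: V_def)
    finally show ?thesis
      using H2[OF \<Phi>2I, of j] by simp
  qed

  \<comment> \<open>The components outside \<open>J\<close>\<close>
  define L where "L j = mfps_monom (lam $ j) (axis j 1)" for j
  have "mfps_compose (\<Phi>\<^sub>2 j) P - mfps_compose (L j) \<Phi>\<^sub>2 \<in> mfps_ideal 2" if "j \<in> - J" for j
  proof -
    have "\<Phi>\<^sub>2 j = mfps_monom 1 (axis j 1)"
      using that by (simp add: \<Phi>\<^sub>2_def \<Phi>1' \<Phi>0')
    then have "mfps_compose (\<Phi>\<^sub>2 j) P - mfps_compose (L j) \<Phi>\<^sub>2 = P j - L j"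
      by (simp add: mfps_compose_axis[OF PI] L_def mfps_compose_axis[OF \<Phi>2I] mfps_monom_one mfps_monom_mult)
    then show ?thesis
      using P by (simp add: diag_tangent_def L_def)
  qed
  moreover have "L j - mfps_monom (lam $ j) (axis j 1) \<in> mfps_ideal 2" for j
    by (simp add: L_def)
  ultimately obtain \<Phi> H\<^sub>3 where \<Phi>: "diag_tangent \<Phi> c"
    and H3: "\<And>j. j \<in> - J \<Longrightarrow> H\<^sub>3 j - L j \<in> mfps_ideal 2"
      "\<And>j l. j \<in> - J \<Longrightarrow> mfps_nth (H\<^sub>3 j) l \<noteq> mfps_nth (L j) l \<Longrightarrow> lam $ j = mpow lam l"
    and \<Phi>': "\<And>i. i \<notin> - J \<Longrightarrow> \<Phi> i = \<Phi>\<^sub>2 i"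
    and conj3: "\<And>j. j \<in> - J \<Longrightarrow> mfps_compose (\<Phi> j) P = mfps_compose (H\<^sub>3 j) \<Phi>"
    using formal_normal_form[OF P \<Phi>2 c, of "- J" L 2] by (metis order_refl)
  show ?thesis
  proof (rule that[OF \<Phi>])
    let ?H = "\<lambda>j. if j \<in> J then H\<^sub>2 j else H\<^sub>3 j"
    show "mfps_compose (\<Phi> j) P = mfps_compose (?H j) \<Phi>" for j
    proof (cases "j \<in> J")
      case True
      then have "mfps_compose (H\<^sub>2 j) \<Phi> = mfps_compose (H\<^sub>2 j) \<Phi>\<^sub>2"
        unfolding H2[OF \<Phi>2I] H2[OF diag_tangent_ideal[OF \<Phi>]] by (simp add: \<Phi>')
      then show ?thesis using True conj2[OF True] by (simp add: \<Phi>')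
    qed (simp add: conj3)
    show "?H j = mfps_monom (lam $ j) (axis j 1) + mfps_monom (a j) (k *s \<alpha> + axis j 1)
        + mfps_monom (\<mu> * of_nat (\<alpha> $ j) * inverse (cnj (lam $ j))) ((2 * k) *s \<alpha> + axis j 1)"
      if "j \<in> J" for j using that by (simp add: H\<^sub>2_def)
    show "only_resonant lam j (?H j)" if "j \<notin> J" for j
    proof -
      have low: "mfps_nth (H\<^sub>3 j) l = mfps_nth (L j) l" if "mdeg l < 2" for l
        using mfps_idealD[OF H3(1)[of j] that] \<open>j \<notin> J\<close> by simp
      have "mfps_nth (H\<^sub>3 j) 0 = 0"
        using low[of 0] by (simp add: L_def mfps_nth_monom vec_eq_iff axis_def)
      moreover have "mfps_nth (H\<^sub>3 j) (axis i 1) = (if i = j then lam $ j else 0)" for i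
        using low[of "axis i 1"] by (simp add: L_def mfps_nth_monom axis_eq_nat_iff)
      moreover have "resonance lam j l" if "2 \<le> mdeg l" "mfps_nth (H\<^sub>3 j) l \<noteq> 0" for l
      proof -
        have "l \<noteq> axis j 1" using that(1) by auto
        then have "mfps_nth (L j) l = 0" by (simp add: L_def mfps_nth_monom)
        then show ?thesis
          using H3(2)[of j l] that \<open>j \<notin> J\<close> by (simp add: resonance_def)
      qed
      ultimately show ?thesis
        using \<open>j \<notin> J\<close> by (simp add: only_resonant_def)
    qed
  qed
qed

theorem theorem3p6:
  fixes F :: "complex ^ 'n::{finite,linorder} \<Rightarrow> complex ^ 'n::{finite,linorder}"
    and lam :: "complex ^ 'n::{finite,linorder}"
    and \<alpha> :: "nat ^ 'n::{finite,linorder}"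
    and m :: nat
  assumes "diffeo_germ F"
    and "(F has_derivative (\<lambda>v. \<chi> j. lam $ j * v $ j)) (at 0)"
    and "1 \<le> m" and "m \<le> CARD('n)"
    and "one_resonant lam (first_indices m) \<alpha>"
    and "nondegenerate F lam (first_indices m) \<alpha>"
  shows "\<exists>(k::nat) (\<mu>::complex) (a :: 'n \<Rightarrow> complex) (H :: 'n \<Rightarrow> (complex, 'n) mfps).
           formally_conjugate F H \<and>
           (\<forall>j\<in>first_indices m.
              H j = mfps_monom (lam $ j) (axis j 1)
                  + mfps_monom (a j) (k *s \<alpha> + axis j 1)
                  + mfps_monom (\<mu> * of_nat (\<alpha> $ j) * inverse (cnj (lam $ j)))
                      ((2 * k) *s \<alpha> + axis j 1)) \<and>
           (\<forall>j. j \<notin> first_indices m \<longrightarrow> only_resonant lam j (H j))"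
proof -
  have F: "holomorphic_germ F" "F 0 = 0"
    using assms(1) by (auto simp: diffeo_germ_def inverse_germs_def)
  obtain P where P: "\<And>j. has_power_series (\<lambda>z. F z $ j) (P j) 0"
    using holomorphic_germ_series[OF F(1)] by blast
  have tan: "diag_tangent P lam"
    by (rule diag_tangent_of_derivative[OF P F(2) assms(2)])
  show ?thesis
  proof (rule nondegenerate_formal[OF P F(2) tan assms(5,6)])
    fix \<Phi>\<^sub>0 :: "'n \<Rightarrow> (complex, 'n) mfps" and c k a
    assume c: "\<And>i. c $ i \<noteq> 0"
      and *: "diag_tangent \<Phi>\<^sub>0 c" "1 \<le> k" "first_indices m \<noteq> ({} :: 'n set)"
        "(\<Sum>j\<in>first_indices m. a j * of_nat (\<alpha> $ j) / lam $ j) \<noteq> 0"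
        "\<And>i. i \<notin> first_indices m \<Longrightarrow> \<Phi>\<^sub>0 i = mfps_monom 1 (axis i 1)"
        "\<And>j. j \<in> first_indices m \<Longrightarrow> mfps_compose (\<Phi>\<^sub>0 j) P
          - mfps_compose (mfps_monom (lam $ j) (axis j 1) + mfps_monom (a j) (k *s \<alpha> + axis j 1)) \<Phi>\<^sub>0
          \<in> mfps_ideal (mdeg \<alpha> * k + 2)"
    show ?thesis
    proof (rule one_resonant_formal_normal_form[OF tan assms(5) *(1) c *(2-6)])
      fix \<Phi> H \<mu>
      assume "diag_tangent \<Phi> c"
        and **: "\<And>j. mfps_compose (\<Phi> j) P = mfps_compose (H j) \<Phi>"
          "\<And>j. j \<in> first_indices m \<Longrightarrow> H j = mfps_monom (lam $ j) (axis j 1)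
            + mfps_monom (a j) (k *s \<alpha> + axis j 1)
            + mfps_monom (\<mu> * of_nat (\<alpha> $ j) * inverse (cnj (lam $ j))) ((2 * k) *s \<alpha> + axis j 1)"
          "\<And>j. j \<notin> first_indices m \<Longrightarrow> only_resonant lam j (H j)"
      have "formally_conjugate F H"
        unfolding formally_conjugate_def
        using P **(1) diag_tangent_formal_diffeo[OF \<open>diag_tangent \<Phi> c\<close> c] by blast
      then show ?thesis
        using **(2,3) by blast
    qed
  qed
qed

end
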